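(* Let $N\ge1$. For all $u\in W^{1,2}(\mathbb{R}^N)$ with $\|xu\|_2<\infty$, $$\int_{\mathbb{R}^N}|\nabla u|^2dx+\int_{\mathbb{R}^N}|x|^2|u|^2dx-N\int_{\mathbb{R}^N}|u|^2dx$$ $$\ge\ \frac{2}{N+3}\inf_{c\in\mathbb{R}}\left(\int_{\mathbb{R}^N}\left|\nabla\left(u-ce^{-\frac12|x|^2}\right)\right|^2dx+\int_{\mathbb{R}^N}|x|^2\left|u-ce^{-\frac12|x|^2}\right|^2dx+\int_{\mathbb{R}^N}\left|u-ce^{-\frac12|x|^2}\right|^2dx\right).$$ Moreover, the inequality is sharp and equality is attained by nontrivial functions.
   Context: All functions are real-valued and $\|\cdot\|_2$ is the $L^2(\mathbb{R}^N)$ norm. "Sharp" means that the constant $\frac{2}{N+3}$ cannot be replaced by a larger one; "nontrivial" means that equality holds for some $u$ for which the two sides are not both zero. *)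

theory Defs
  imports "HOL-Analysis.Analysis"
begin

text \<open>Lebesgue (rather than Borel) measurability is used throughout, so that every representative
  of an \<open>L\<^sup>2\<close> class is admitted.\<close>

definition L2_functions :: "('a::euclidean_space \<Rightarrow> 'b::euclidean_space) set" where
  "L2_functions =
     {f. f \<in> borel_measurable lebesgue \<and> integrable lebesgue (\<lambda>x. (norm (f x))\<^sup>2)}"

definition locally_integrable :: "('a::euclidean_space \<Rightarrow> 'b::euclidean_space) \<Rightarrow> bool" where
  "locally_integrable f \<longleftrightarrow> (\<forall>K. compact K \<longrightarrow> set_integrable lebesgue K f)"

text \<open>\<open>C_k k f\<close>: the function \<open>f\<close> is \<open>k\<close> times continuously differentiable on the whole space.\<close>

fun C_k :: "nat \<Rightarrow> ('a::euclidean_space \<Rightarrow> real) \<Rightarrow> bool" where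
  "C_k 0 f \<longleftrightarrow> continuous_on UNIV f"
| "C_k (Suc k) f \<longleftrightarrow>
     f differentiable_on UNIV \<and> (\<forall>i\<in>Basis. C_k k (\<lambda>x. frechet_derivative f (at x) i))"

definition test_functions :: "('a::euclidean_space \<Rightarrow> real) set" where
  "test_functions = {\<phi>. (\<forall>k. C_k k \<phi>) \<and> compact (closure {x. \<phi> x \<noteq> 0})}"

definition has_weak_gradient :: "('a::euclidean_space \<Rightarrow> real) \<Rightarrow> ('a \<Rightarrow> 'a) \<Rightarrow> bool" where
  "has_weak_gradient u v \<longleftrightarrow>
     locally_integrable u \<and> locally_integrable v \<and>
     (\<forall>\<phi>\<in>test_functions. \<forall>i\<in>Basis.
        (LINT x|lebesgue. u x * frechet_derivative \<phi> (at x) i)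
          = - (LINT x|lebesgue. (v x \<bullet> i) * \<phi> x))"

text \<open>A weak gradient is unique up to null sets, so integrals of \<open>weak_gradient u\<close> do not
  depend on the choice made here.\<close>

definition weak_gradient :: "('a::euclidean_space \<Rightarrow> real) \<Rightarrow> 'a \<Rightarrow> 'a" where
  "weak_gradient u = (SOME v. has_weak_gradient u v)"

definition sobolev_W12 :: "('a::euclidean_space \<Rightarrow> real) set" where
  "sobolev_W12 = {u \<in> L2_functions. \<exists>v \<in> L2_functions. has_weak_gradient u v}"

definition admissible :: "('a::euclidean_space \<Rightarrow> real) set" where
  "admissible = {u \<in> sobolev_W12. (\<lambda>x. u x *\<^sub>R x) \<in> L2_functions}"

definition gaussian :: "'a::euclidean_space \<Rightarrow> real" where
  "gaussian x = exp (- (1/2) * (norm x)\<^sup>2)"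

definition uncertainty_deficit :: "(real^'n \<Rightarrow> real) \<Rightarrow> real" where
  "uncertainty_deficit u =
     (LINT x|lebesgue. (norm (weak_gradient u x))\<^sup>2)
     + (LINT x|lebesgue. (norm x)\<^sup>2 * \<bar>u x\<bar>\<^sup>2)
     - real CARD('n) * (LINT x|lebesgue. \<bar>u x\<bar>\<^sup>2)"

definition weighted_norm_sq :: "('a::euclidean_space \<Rightarrow> real) \<Rightarrow> real" where
  "weighted_norm_sq w =
     (LINT x|lebesgue. (norm (weak_gradient w x))\<^sup>2)
     + (LINT x|lebesgue. (norm x)\<^sup>2 * \<bar>w x\<bar>\<^sup>2)
     + (LINT x|lebesgue. \<bar>w x\<bar>\<^sup>2)"

definition gaussian_dist_sq :: "('a::euclidean_space \<Rightarrow> real) \<Rightarrow> real" where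
  "gaussian_dist_sq u = (INF c::real. weighted_norm_sq (\<lambda>x. u x - c * gaussian x))"

end

(* With w the component of u orthogonal to the Gaussian g, both sides are explicit quadratic
   expressions in w, and the inequality is equivalent to the spectral gap
   "energy of w >= (N + 2) * norm of w squared" of the harmonic oscillator -Laplace + |x|^2.
   The gap is proved by duality, without approximating w in the Sobolev norm: the definition of
   the weak gradient, tested against Hermite functions h (after a cutoff), shows that the energy
   form of w and h is (N + 2|alpha|) times their L2 product; completing the square against a
   finite Hermite sum close to w in L2 gives the bound up to epsilon. Completeness of the Hermite
   functions comes from the algebra of bounded multipliers of their closed span, which contains
   sin (a * (x_b - c)) by power series, hence indicators of half-spaces, hence everything.
   Equality holds for the first excited state x_b * g. *)

theory Submission
  imports Defs "HOL-Probability.Distributions"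
begin

section \<open>Smooth functions built from exponentials\<close>

text \<open>The constant comes from the spectrum. On a Hermite function of level N + 2k with k \<ge>
  1 the quotient of deficit and squared distance is 2k / (N + 2k + 1), which increases with k, so
  the first excited level decides. For general w with energy E and squared norm W the same fact is
  the identity (N + 3) (E - N W) - 2 (E + W) = (N + 1) (E - (N + 2) W). The Gaussian is an
  eigenfunction, so projecting onto it in L^2 and in the weighted Sobolev norm gives the same
  coefficient: one choice of c serves both the infimum and the orthogonality that the gap requires.

  Closeness of a Hermite sum s to w in L^2 says nothing about the energy of w - s. Applying the
  inverse oscillator to s, which is explicit on Hermite sums, avoids this: energy products with the
  result are L^2 products with s.

  Multipliers take the place of Fourier uniqueness in the completeness proof; all functions stay
  real and the limits rest on dominated convergence.\<close>

lemma directional_derivative: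
  fixes f :: "'a::real_normed_vector \<Rightarrow> real"
  assumes "f differentiable (at (x + t *\<^sub>R b))"
  shows "((\<lambda>t. f (x + t *\<^sub>R b)) has_real_derivative frechet_derivative f (at (x + t *\<^sub>R b)) b) (at t)"
proof -
  let ?D = "frechet_derivative f (at (x + t *\<^sub>R b))"
  have line: "((\<lambda>t. x + t *\<^sub>R b) has_derivative (\<lambda>t. t *\<^sub>R b)) (at t)"
    by (auto intro!: derivative_eq_intros)
  have "((\<lambda>t. f (x + t *\<^sub>R b)) has_derivative (\<lambda>s. ?D (s *\<^sub>R b))) (at t)"
    using has_derivative_compose[OF line] assms by (simp add: frechet_derivative_works)
  moreover have "(\<lambda>s. ?D (s *\<^sub>R b)) = (*) (?D b)"
    using linear_frechet_derivative[OF assms] by (auto simp: linear_cmul)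
  ultimately show ?thesis by (simp add: has_field_derivative_def)
qed

text \<open>The classical smooth function that vanishes to infinite order at 0, divided by powers of
  t. The powers close the family under differentiation up to linear combinations: member m produces
  members m + 1 and m + 2.\<close>

definition flat :: "nat \<Rightarrow> real \<Rightarrow> real" where
  "flat m t = (if t > 0 then exp (- (1 / t)) / t ^ m else 0)"

lemma flat_nonneg: "0 \<le> flat m t"
  by (simp add: flat_def)

lemma power_over_fact_le_exp:
  fixes x :: real
  assumes "0 \<le> x"
  shows "x ^ n / fact n \<le> exp x"
proof -
  have "(\<Sum>i\<in>{n}. x ^ i /\<^sub>R fact i) \<le> exp x"
    unfolding exp_def using assms
    by (intro sum_le_suminf summable_exp_generic) auto
  then show ?thesis by (simp add: field_simps)
qed

text \<open>A single term of the series of exp (1 / t) beats every power of t. The exponent k is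
  free: k = 2 makes the derivative at 0 vanish, k = 0 bounds the function uniformly.\<close>

lemma flat_bound: "flat m t \<le> fact (m + k) * \<bar>t\<bar> ^ k"
proof (cases "t > 0")
  case True
  have "(1 / t) ^ (m + k) / fact (m + k) \<le> exp (1 / t)"
    using True by (intro power_over_fact_le_exp) auto
  then have "1 \<le> exp (1/t) * fact (m + k) * t ^ (m + k)"
    using True by (simp add: field_simps)
  then show ?thesis
    using True
    by (simp add: flat_def exp_minus power_add field_simps)
qed (simp add: flat_def)

lemma has_real_derivative_flat:
  "(flat m has_real_derivative flat (m + 2) t - real m * flat (m + 1) t) (at t)"
proof -
  consider "t > 0" | "t < 0" | "t = 0" by linarith
  then show ?thesis
  proof cases
    case 1
    have "((\<lambda>t. exp (- (1 / t)) / t ^ m) has_real_derivative flat (m + 2) t - real m * flat (m + 1) t) (at t)"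
    proof -
      have "real m * t ^ (m - 1) * t = real m * t ^ m" by (cases m) auto
      then show ?thesis using 1
        by (auto intro!: derivative_eq_intros simp: flat_def divide_simps power2_eq_square)
          (simp add: algebra_simps)
    qed
    then show ?thesis
      by (rule has_field_derivative_transform_within_open[of _ _ _ "{0<..}"])
        (use 1 in \<open>auto simp: flat_def\<close>)
  next
    case 2
    have "((\<lambda>t. 0) has_real_derivative flat (m + 2) t - real m * flat (m + 1) t) (at t)"
      using 2 by (simp add: flat_def)
    then show ?thesis
      by (rule has_field_derivative_transform_within_open[of _ _ _ "{..<0}"])
        (use 2 in \<open>auto simp: flat_def\<close>)
  next
    case 3
    \<comment> \<open>Quadratic smallness of \<open>flat m\<close> near 0 forces the difference
      quotient to vanish there.\<close>
    have "((\<lambda>h. (flat m (0 + h) - flat m 0) / h) \<longlongrightarrow> 0) (at 0)"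
    proof (rule Lim_null_comparison)
      have "norm ((flat m (0 + h) - flat m 0) / h) \<le> fact (m + 2) * \<bar>h\<bar>" if "h \<noteq> 0" for h
      proof -
        have "norm ((flat m (0 + h) - flat m 0) / h) = flat m h / \<bar>h\<bar>"
          by (simp add: flat_nonneg flat_def[of m 0])
        also have "\<dots> \<le> (fact (m + 2) * \<bar>h\<bar> ^ 2) / \<bar>h\<bar>"
          by (intro divide_right_mono flat_bound) auto
        also have "\<dots> = fact (m + 2) * \<bar>h\<bar>"
          using that by (auto simp: power2_eq_square abs_if)
        finally show ?thesis .
      qed
      then show "\<forall>\<^sub>F h in at 0. norm ((flat m (0 + h) - flat m 0) / h) \<le> fact (m + 2) * \<bar>h\<bar>"
        by (simp add: eventually_at_filter)
      show "((\<lambda>h. fact (m + 2) * \<bar>h\<bar>) \<longlongrightarrow> 0) (at (0::real))"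
        by (auto intro!: tendsto_eq_intros)
    qed
    then show ?thesis
      unfolding 3 by (simp add: DERIV_def flat_def)
  qed
qed

text \<open>Smoothness is obtained syntactically: the class contains its own directional
  derivatives, so one induction on k gives every \<open>C_k\<close>, without product and chain rules
  for \<open>C_k\<close>. The constructors are those from which Hermite functions, box bumps and
  ball cutoffs are built.\<close>

inductive smooth_alg :: "('a::euclidean_space \<Rightarrow> real) \<Rightarrow> bool" where
  const: "smooth_alg (\<lambda>x. c)"
| inner: "smooth_alg (\<lambda>x. x \<bullet> b)"
| add: "smooth_alg f \<Longrightarrow> smooth_alg g \<Longrightarrow> smooth_alg (\<lambda>x. f x + g x)"
| mult: "smooth_alg f \<Longrightarrow> smooth_alg g \<Longrightarrow> smooth_alg (\<lambda>x. f x * g x)"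
| exp: "smooth_alg f \<Longrightarrow> smooth_alg (\<lambda>x. exp (f x))"
| flat: "smooth_alg f \<Longrightarrow> smooth_alg (\<lambda>x. flat m (f x))"

lemma smooth_alg_diff:
  "smooth_alg f \<Longrightarrow> smooth_alg g \<Longrightarrow> smooth_alg (\<lambda>x. f x - g x)"
  using smooth_alg.add[OF _ smooth_alg.mult[OF smooth_alg.const[of "-1"]], of f g] by simp

lemma smooth_alg_sum:
  "(\<And>i. i \<in> I \<Longrightarrow> smooth_alg (f i)) \<Longrightarrow> smooth_alg (\<lambda>x. \<Sum>i\<in>I. f i x)"
  by (induction I rule: infinite_finite_induct) (auto intro: smooth_alg.intros)

lemma smooth_alg_prod:
  "(\<And>i. i \<in> I \<Longrightarrow> smooth_alg (f i)) \<Longrightarrow> smooth_alg (\<lambda>x. \<Prod>i\<in>I. f i x)"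
  by (induction I rule: infinite_finite_induct) (auto intro: smooth_alg.intros)

lemma smooth_alg_has_derivative:
  assumes "smooth_alg f"
  shows "\<exists>f'. (\<forall>x. (f has_derivative f' x) (at x)) \<and> (\<forall>b. smooth_alg (\<lambda>x. f' x b))"
  using assms
proof induction
  case (const c)
  show ?case by (rule exI[of _ "\<lambda>x h. 0"]) (auto intro: smooth_alg.const)
next
  case (inner b)
  show ?case
    by (rule exI[of _ "\<lambda>x h. h \<bullet> b"]) (auto intro!: derivative_eq_intros smooth_alg.const)
next
  case (add f g)
  then obtain f' g' where
    "\<And>x. (f has_derivative f' x) (at x)" "\<And>b. smooth_alg (\<lambda>x. f' x b)"
    "\<And>x. (g has_derivative g' x) (at x)" "\<And>b. smooth_alg (\<lambda>x. g' x b)" by blast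
  then show ?case
    by (intro exI[of _ "\<lambda>x h. f' x h + g' x h"])
      (auto intro!: derivative_eq_intros smooth_alg.intros)
next
  case (mult f g)
  then obtain f' g' where
    "\<And>x. (f has_derivative f' x) (at x)" "\<And>b. smooth_alg (\<lambda>x. f' x b)"
    "\<And>x. (g has_derivative g' x) (at x)" "\<And>b. smooth_alg (\<lambda>x. g' x b)" by blast
  then show ?case using mult.hyps
    by (intro exI[of _ "\<lambda>x h. f x * g' x h + f' x h * g x"])
      (auto intro!: has_derivative_mult smooth_alg.intros)
next
  case (exp f)
  then obtain f' where
    "\<And>x. (f has_derivative f' x) (at x)" "\<And>b. smooth_alg (\<lambda>x. f' x b)" by blast
  then show ?case using exp.hyps
    by (intro exI[of _ "\<lambda>x h. exp (f x) * f' x h"])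
      (auto intro!: derivative_eq_intros smooth_alg.intros)
next
  case (flat f m)
  then obtain f' where
    "\<And>x. (f has_derivative f' x) (at x)" "\<And>b. smooth_alg (\<lambda>x. f' x b)" by blast
  then show ?case using flat.hyps
    by (intro exI[of _ "\<lambda>x h. (flat (m + 2) (f x) - real m * flat (m + 1) (f x)) * f' x h"]
          conjI allI smooth_alg.intros smooth_alg_diff
          has_derivative_compose[OF _ has_field_derivative_imp_has_derivative[OF has_real_derivative_flat]])
      auto
qed

lemma smooth_alg_differentiable: "smooth_alg f \<Longrightarrow> f differentiable (at x)"
  using smooth_alg_has_derivative unfolding differentiable_def by blast

lemma smooth_alg_frechet_derivative:
  assumes "smooth_alg f"
  shows "smooth_alg (\<lambda>x. frechet_derivative f (at x) b)"
proof -
  obtain f' where f': "\<And>x. (f has_derivative f' x) (at x)" "\<And>b. smooth_alg (\<lambda>x. f' x b)"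
    using smooth_alg_has_derivative[OF assms] by blast
  have "frechet_derivative f (at x) = f' x" for x
    using frechet_derivative_at[OF f'(1)] by simp
  with f'(2) show ?thesis by simp
qed

lemma smooth_alg_continuous: "smooth_alg f \<Longrightarrow> continuous_on S f"
  by (intro continuous_at_imp_continuous_on ballI differentiable_imp_continuous_within
      smooth_alg_differentiable)

lemma smooth_alg_C_k: "smooth_alg f \<Longrightarrow> C_k k f"
  by (induction k arbitrary: f)
    (auto simp: smooth_alg_continuous smooth_alg_frechet_derivative differentiable_on_def
      smooth_alg_differentiable)

lemma smooth_alg_borel: "smooth_alg f \<Longrightarrow> f \<in> borel_measurable borel"
  by (intro borel_measurable_continuous_onI smooth_alg_continuous)

lemma smooth_alg_lebesgue: "smooth_alg f \<Longrightarrow> f \<in> borel_measurable lebesgue"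
  by (intro measurable_completion) (simp add: smooth_alg_borel)

section \<open>Test functions: construction, continuity and support\<close>

lemma smooth_alg_test_functions:
  assumes "smooth_alg f" "bounded K" "\<And>x. x \<notin> K \<Longrightarrow> f x = 0"
  shows "f \<in> test_functions"
proof -
  have "{x. f x \<noteq> 0} \<subseteq> K" using assms(3) by auto
  then have "bounded {x. f x \<noteq> 0}" using assms(2) bounded_subset by blast
  with assms(1) show ?thesis
    by (simp add: test_functions_def smooth_alg_C_k)
qed

lemma test_function_differentiable: "\<phi> \<in> test_functions \<Longrightarrow> \<phi> differentiable (at x)"
proof -
  assume "\<phi> \<in> test_functions"
  then have "C_k (Suc 0) \<phi>" unfolding test_functions_def by blast
  then show ?thesis by (simp add: differentiable_on_def)
qed

lemma test_function_continuous: "\<phi> \<in> test_functions \<Longrightarrow> continuous_on S \<phi>"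
  by (intro continuous_at_imp_continuous_on ballI differentiable_imp_continuous_within
      test_function_differentiable)

lemma test_function_derivative_continuous:
  "\<phi> \<in> test_functions \<Longrightarrow> b \<in> Basis \<Longrightarrow> continuous_on UNIV (\<lambda>x. frechet_derivative \<phi> (at x) b)"
proof -
  assume "\<phi> \<in> test_functions" and b: "b \<in> Basis"
  then have "C_k (Suc 0) \<phi>" unfolding test_functions_def by blast
  with b show ?thesis by simp
qed

lemma test_function_support:
  fixes \<phi> :: "'a::euclidean_space \<Rightarrow> real"
  assumes "\<phi> \<in> test_functions"
  obtains r where "r > 0" "\<And>x. r \<le> norm x \<Longrightarrow> \<phi> x = 0"
proof -
  have "bounded {x. \<phi> x \<noteq> 0}"
    using assms bounded_subset[OF compact_imp_bounded closure_subset]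
    unfolding test_functions_def by blast
  then obtain r where r: "r > 0" "\<forall>x\<in>{x. \<phi> x \<noteq> 0}. norm x < r"
    unfolding bounded_pos_less by blast
  show thesis
    by (rule that[OF r(1)]) (use r(2) in force)
qed

section \<open>Hermite functions\<close>

lemma lebesgue_measurable_lborel:
  "f \<in> borel_measurable borel \<Longrightarrow> f \<in> borel_measurable lebesgue"
  by (intro measurable_completion) simp

lemma lebesgue_integrable_iff:
  fixes f :: "'a::euclidean_space \<Rightarrow> 'b::{banach, second_countable_topology}"
  shows "f \<in> borel_measurable borel \<Longrightarrow> integrable lebesgue f \<longleftrightarrow> integrable lborel f"
  by (rule integrable_completion) simp

lemma integrable_gaussian_1d:
  assumes "c > 0"
  shows "integrable lborel (\<lambda>t::real. exp (- (c * t\<^sup>2)))"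
proof -
  \<comment> \<open>The normal density of variance 1 / (2 c) has exponent - c t^2; the prefactor
    removes its normalisation.\<close>
  have "integrable lborel (\<lambda>t::real. sqrt (pi / c) * normal_density 0 (sqrt (1 / (2 * c))) t)"
    by (intro integrable_mult_right integrable_normal_density) (use assms in simp)
  also have "(\<lambda>t::real. sqrt (pi / c) * normal_density 0 (sqrt (1 / (2 * c))) t) = (\<lambda>t. exp (- (c * t\<^sup>2)))"
    using assms by (intro ext) (simp add: normal_density_def real_sqrt_divide field_simps)
  finally show ?thesis .
qed

lemma norm_sq_eq_sum_Basis:
  fixes x :: "'a::euclidean_space"
  shows "(norm x)\<^sup>2 = (\<Sum>b\<in>Basis. (x \<bullet> b)\<^sup>2)"
  unfolding power2_norm_eq_inner euclidean_inner[of x x] by (simp add: power2_eq_square)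

text \<open>The squared norm splits over the coordinates, so the integral is a product of
  one-dimensional ones.\<close>

lemma integrable_gaussian:
  assumes "c > 0"
  shows "integrable lebesgue (\<lambda>x::'a::euclidean_space. exp (- (c * (norm x)\<^sup>2)))"
proof -
  have "integrable lborel (\<lambda>x::'a. exp (- (c * (norm x)\<^sup>2)))"
  proof (rule integrableI_nonneg)
    have "(\<integral>\<^sup>+ x. ennreal (exp (- (c * (norm (x::'a))\<^sup>2))) \<partial>lborel)
        = (\<integral>\<^sup>+ x. (\<Prod>b\<in>(Basis::'a set). ennreal (exp (- (c * (x \<bullet> b)\<^sup>2)))) \<partial>lborel)"
      by (intro nn_integral_cong)
        (simp add: norm_sq_eq_sum_Basis sum_distrib_left exp_sum prod_ennreal flip: sum_negf)
    also have "\<dots> = (\<Prod>b\<in>(Basis :: 'a set). (\<integral>\<^sup>+ t. ennreal (exp (- (c * (t::real)\<^sup>2))) \<partial>lborel))"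
      by (rule nn_integral_lborel_prod) auto
    also have "\<dots> < \<infinity>"
      using integrable_gaussian_1d[OF assms]
      by (simp add: real_integrable_def power_less_top_ennreal top.not_eq_extremum)
    finally show "(\<integral>\<^sup>+ x. ennreal (exp (- (c * (norm (x::'a))\<^sup>2))) \<partial>lborel) < \<infinity>" .
  qed auto
  then show ?thesis
    by (subst lebesgue_integrable_iff) auto
qed

text \<open>The physicists' Hermite polynomial times the Gaussian, generated by the three-term
  recurrence. Without normalisation all ladder coefficients stay rational.\<close>

fun hermite_1d :: "nat \<Rightarrow> real \<Rightarrow> real" where
  "hermite_1d 0 t = exp (- (1/2) * t\<^sup>2)"
| "hermite_1d (Suc 0) t = 2 * t * exp (- (1/2) * t\<^sup>2)"
| "hermite_1d (Suc (Suc n)) t = 2 * t * hermite_1d (Suc n) t - 2 * real (Suc n) * hermite_1d n t"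

text \<open>At n = 0 the truncated index \<open>n - 1\<close> is harmless, because its coefficient
  is 0. The ladder identities below rely on the same convention.\<close>

lemma hermite_1d_mult:
  "t * hermite_1d n t = hermite_1d (Suc n) t / 2 + real n * hermite_1d (n - 1) t"
  by (cases n) (auto simp: field_simps)

lemma hermite_1d_deriv:
  "(hermite_1d n has_real_derivative real n * hermite_1d (n - 1) t - hermite_1d (Suc n) t / 2) (at t)"
proof (induction n arbitrary: t rule: induct_nat_012)
  case 0
  have "((\<lambda>t. exp (- (1/2) * t\<^sup>2)) has_real_derivative - t * exp (- (1/2) * t\<^sup>2)) (at t)"
    by (auto intro!: derivative_eq_intros)
  moreover have "hermite_1d 0 = (\<lambda>t. exp (- (1/2) * t\<^sup>2))" by auto
  ultimately show ?case by simp
next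
  case 1
  have "((\<lambda>t. 2 * t * exp (- (1/2) * t\<^sup>2)) has_real_derivative
      2 * exp (- (1/2) * t\<^sup>2) - 2 * t\<^sup>2 * exp (- (1/2) * t\<^sup>2)) (at t)"
    by (auto intro!: derivative_eq_intros simp: power2_eq_square algebra_simps)
  moreover have "hermite_1d (Suc 0) = (\<lambda>t. 2 * t * exp (- (1/2) * t\<^sup>2))" by auto
  moreover have "2 * exp (- (1/2) * t\<^sup>2) - 2 * t\<^sup>2 * exp (- (1/2) * t\<^sup>2)
      = real (Suc 0) * hermite_1d (Suc 0 - 1) t - hermite_1d (Suc (Suc 0)) t / 2"
    by (simp add: power2_eq_square field_simps)
  ultimately show ?case by (simp only:)
next
  case (ge2 n)
  have eq: "hermite_1d (Suc (Suc n)) = (\<lambda>t. 2 * t * hermite_1d (Suc n) t - 2 * real (Suc n) * hermite_1d n t)"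
    by auto
  have "((\<lambda>t. 2 * t * hermite_1d (Suc n) t - 2 * real (Suc n) * hermite_1d n t) has_real_derivative
      2 * hermite_1d (Suc n) t + 2 * t * (real (Suc n) * hermite_1d n t - hermite_1d (Suc (Suc n)) t / 2)
      - 2 * real (Suc n) * (real n * hermite_1d (n - 1) t - hermite_1d (Suc n) t / 2)) (at t)"
    using ge2.IH[of t]
    by (auto intro!: derivative_eq_intros simp del: hermite_1d.simps(3))
  also have "2 * hermite_1d (Suc n) t + 2 * t * (real (Suc n) * hermite_1d n t - hermite_1d (Suc (Suc n)) t / 2)
      - 2 * real (Suc n) * (real n * hermite_1d (n - 1) t - hermite_1d (Suc n) t / 2)
      = real (Suc (Suc n)) * hermite_1d (Suc n) t - hermite_1d (Suc (Suc (Suc n))) t / 2"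
  proof -
    \<comment> \<open>Here a, b, c, d stand for the Hermite functions of index n, n + 1, n + 2, n -
      1, with m = n + 1 and k = n. The multiplication rule eliminates t * a, and the last bracket is
      the recurrence for index n + 3.\<close>
    have ring: "2 * b + 2 * t * (m * a - c / 2) - 2 * m * (k * d - b / 2) = (m + 1) * b - (2 * t * c - 2 * (m + 1) * b) / 2"
      if "t * a = b / 2 + k * d" for a b c d m k :: real
    proof -
      have "2 * t * (m * a - c / 2) = 2 * m * (b / 2 + k * d) - t * c"
        unfolding that[symmetric] by (simp add: field_simps)
      then show ?thesis by (simp add: field_simps)
    qed
    show ?thesis
      using ring[OF hermite_1d_mult[of t n], of "real (Suc n)" "hermite_1d (Suc (Suc n)) t"]
      unfolding hermite_1d.simps(3)[of "Suc n"] by (simp add: add.commute del: hermite_1d.simps(3))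
  qed
  finally show ?case unfolding eq[symmetric] diff_Suc_1 .
qed

text \<open>An exponential replaces the polynomial factor because \<bar>t\<bar> \<le> exp
  \<bar>t\<bar>: multiplication by t merely raises n by one, so the bound reproduces itself under
  the recurrence.\<close>

lemma hermite_1d_bound:
  "\<exists>C\<ge>0. \<forall>t. \<bar>hermite_1d n t\<bar> \<le> C * exp (real n * \<bar>t\<bar>) * exp (- (1/2) * t\<^sup>2)"
proof (induction n rule: induct_nat_012)
  case 0
  show ?case by (intro exI[of _ 1]) auto
next
  case 1
  have "\<bar>t\<bar> \<le> exp \<bar>t\<bar>" for t :: real using exp_ge_add_one_self[of "\<bar>t\<bar>"] by linarith
  then show ?case by (intro exI[of _ 2]) (auto simp: abs_mult)
next
  case (ge2 n)
  then obtain C D where C: "C \<ge> 0" "\<And>t. \<bar>hermite_1d n t\<bar> \<le> C * exp (real n * \<bar>t\<bar>) * exp (- (1/2) * t\<^sup>2)"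
    and D: "D \<ge> 0" "\<And>t. \<bar>hermite_1d (Suc n) t\<bar> \<le> D * exp (real (Suc n) * \<bar>t\<bar>) * exp (- (1/2) * t\<^sup>2)"
    by blast
  have "\<bar>hermite_1d (Suc (Suc n)) t\<bar> \<le> (2 * D + 2 * real (Suc n) * C) * exp (real (Suc (Suc n)) * \<bar>t\<bar>) * exp (- (1/2) * t\<^sup>2)" for t
  proof -
    have t: "\<bar>t\<bar> \<le> exp \<bar>t\<bar>" using exp_ge_add_one_self[of "\<bar>t\<bar>"] by linarith
    have "\<bar>hermite_1d (Suc (Suc n)) t\<bar> \<le> 2 * (\<bar>t\<bar> * \<bar>hermite_1d (Suc n) t\<bar>) + 2 * real (Suc n) * \<bar>hermite_1d n t\<bar>"
      unfolding hermite_1d.simps(3)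
      by (rule order.trans[OF abs_triangle_ineq4]) (simp add: abs_mult)
    also have "\<dots> \<le> 2 * (exp \<bar>t\<bar> * (D * exp (real (Suc n) * \<bar>t\<bar>) * exp (- (1/2) * t\<^sup>2)))
        + 2 * real (Suc n) * (C * exp (real (Suc (Suc n)) * \<bar>t\<bar>) * exp (- (1/2) * t\<^sup>2))"
    proof (intro add_mono mult_left_mono mult_mono t D(2))
      show "\<bar>hermite_1d n t\<bar> \<le> C * exp (real (Suc (Suc n)) * \<bar>t\<bar>) * exp (- (1/2) * t\<^sup>2)"
        by (rule order.trans[OF C(2)]) (intro mult_right_mono mult_left_mono, auto simp: C(1) intro!: mult_right_mono)
    qed auto
    also have "\<dots> = (2 * D + 2 * real (Suc n) * C) * exp (real (Suc (Suc n)) * \<bar>t\<bar>) * exp (- (1/2) * t\<^sup>2)"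
    proof -
      have "exp (real (Suc (Suc n)) * \<bar>t\<bar>) = exp \<bar>t\<bar> * exp (real (Suc n) * \<bar>t\<bar>)"
        by (simp add: algebra_simps flip: exp_add)
      then show ?thesis by (simp add: algebra_simps)
    qed
    finally show ?thesis .
  qed
  then show ?case using C(1) D(1)
    by (intro exI[of _ "2 * D + 2 * real (Suc n) * C"]) auto
qed

text \<open>Vanishing off the basis makes an index determined by its values on \<open>Basis\<close>.
  Otherwise different indices could name the same Hermite function, and distinct indices would not
  give orthogonal functions.\<close>

definition multi_indices :: "('a::euclidean_space \<Rightarrow> nat) set" where
  "multi_indices = {\<alpha>. \<forall>b. b \<notin> Basis \<longrightarrow> \<alpha> b = 0}"

definition hermite :: "('a::euclidean_space \<Rightarrow> nat) \<Rightarrow> 'a \<Rightarrow> real" where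
  "hermite \<alpha> x = (\<Prod>b\<in>Basis. hermite_1d (\<alpha> b) (x \<bullet> b))"

abbreviation raise :: "'a \<Rightarrow> ('a \<Rightarrow> nat) \<Rightarrow> 'a \<Rightarrow> nat" where
  "raise b \<alpha> \<equiv> \<alpha>(b := Suc (\<alpha> b))"

abbreviation lower :: "'a \<Rightarrow> ('a \<Rightarrow> nat) \<Rightarrow> 'a \<Rightarrow> nat" where
  "lower b \<alpha> \<equiv> \<alpha>(b := \<alpha> b - 1)"

lemma multi_indices_upd [simp]: "b \<in> Basis \<Longrightarrow> \<alpha> \<in> multi_indices \<Longrightarrow> \<alpha>(b := k) \<in> multi_indices"
  by (auto simp: multi_indices_def)

lemma zero_multi_index [simp]: "(\<lambda>b. 0) \<in> multi_indices"
  by (simp add: multi_indices_def)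

lemma hermite_zero: "hermite (\<lambda>b. 0) = gaussian"
  by (intro ext)
    (simp add: hermite_def gaussian_def norm_sq_eq_sum_Basis sum_distrib_left sum_negf flip: exp_sum)

lemma hermite_split:
  "b \<in> Basis \<Longrightarrow> hermite \<alpha> x = hermite_1d (\<alpha> b) (x \<bullet> b) * (\<Prod>i\<in>Basis - {b}. hermite_1d (\<alpha> i) (x \<bullet> i))"
  unfolding hermite_def by (rule prod.remove) auto

lemma hermite_upd_split:
  "b \<in> Basis \<Longrightarrow> hermite (\<alpha>(b := k)) x = hermite_1d k (x \<bullet> b) * (\<Prod>i\<in>Basis - {b}. hermite_1d (\<alpha> i) (x \<bullet> i))"
  by (subst hermite_split[of b]) auto

lemma hermite_mult:
  assumes "b \<in> Basis"
  shows "(x \<bullet> b) * hermite \<alpha> x = hermite (raise b \<alpha>) x / 2 + real (\<alpha> b) * hermite (lower b \<alpha>) x"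
  unfolding hermite_upd_split[OF assms] hermite_split[OF assms, of \<alpha>] mult.assoc[symmetric] hermite_1d_mult
  by (simp add: field_simps)

lemma smooth_alg_hermite_1d: "smooth_alg (\<lambda>x. hermite_1d n (x \<bullet> b))"
proof (induction n rule: induct_nat_012)
  case (ge2 n)
  then show ?case by (simp add: smooth_alg.intros smooth_alg_diff)
next
  case 0
  show ?case
    unfolding hermite_1d.simps power2_eq_square by (intro smooth_alg.intros)
next
  case 1
  show ?case
    unfolding hermite_1d.simps power2_eq_square by (intro smooth_alg.intros)
qed

lemma smooth_alg_hermite: "smooth_alg (hermite \<alpha>)"
  unfolding hermite_def[abs_def] by (intro smooth_alg_prod smooth_alg_hermite_1d)

lemma hermite_derivative:
  assumes b: "b \<in> Basis"
  shows "frechet_derivative (hermite \<alpha>) (at x) b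
    = real (\<alpha> b) * hermite (lower b \<alpha>) x - hermite (raise b \<alpha>) x / 2"
proof -
  have 1: "((\<lambda>t. hermite \<alpha> (x + t *\<^sub>R b)) has_real_derivative
      frechet_derivative (hermite \<alpha>) (at x) b) (at 0)"
    using directional_derivative[of "hermite \<alpha>" x 0 b] smooth_alg_differentiable[OF smooth_alg_hermite, of \<alpha> x]
    by simp
  let ?P = "\<Prod>i\<in>Basis - {b}. hermite_1d (\<alpha> i) (x \<bullet> i)"
  \<comment> \<open>Moving along b changes only the coordinate \<open>x \<bullet> b\<close>, so the
    other factors are constants.\<close>
  have "(\<lambda>t. hermite \<alpha> (x + t *\<^sub>R b)) = (\<lambda>t. hermite_1d (\<alpha> b) (x \<bullet> b + t) * ?P)"
    using b by (intro ext, subst hermite_split[OF b])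
      (simp add: inner_add_left, intro disjI2 prod.cong refl, auto simp: inner_not_same_Basis)
  moreover have "((\<lambda>t. hermite_1d (\<alpha> b) (x \<bullet> b + t) * ?P) has_real_derivative
      (real (\<alpha> b) * hermite_1d (\<alpha> b - 1) (x \<bullet> b) - hermite_1d (Suc (\<alpha> b)) (x \<bullet> b) / 2) * ?P) (at 0)"
    using DERIV_shift[of "hermite_1d (\<alpha> b)" _ "0" "x \<bullet> b"] hermite_1d_deriv[of "\<alpha> b" "x \<bullet> b"]
    by (intro DERIV_cmult_right) (simp add: add.commute)
  ultimately have "((\<lambda>t. hermite \<alpha> (x + t *\<^sub>R b)) has_real_derivative
      real (\<alpha> b) * hermite (lower b \<alpha>) x - hermite (raise b \<alpha>) x / 2) (at 0)"
    by (simp add: hermite_upd_split[OF b] algebra_simps)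
  with 1 show ?thesis by (rule DERIV_unique)
qed

lemma hermite_bound:
  fixes \<alpha> :: "'a::euclidean_space \<Rightarrow> nat"
  shows "\<exists>C\<ge>0. \<forall>x. \<bar>hermite \<alpha> x\<bar> \<le> C * exp (- (1/4) * (norm x)\<^sup>2)"
proof -
  have "\<exists>C\<ge>0. \<forall>t. \<bar>hermite_1d n t\<bar> \<le> C * exp (- (1/4) * t\<^sup>2)" for n
  proof -
    obtain C where C: "C \<ge> 0" "\<And>t. \<bar>hermite_1d n t\<bar> \<le> C * exp (real n * \<bar>t\<bar>) * exp (- (1/2) * t\<^sup>2)"
      using hermite_1d_bound by blast
    have "\<bar>hermite_1d n t\<bar> \<le> C * exp ((real n)\<^sup>2) * exp (- (1/4) * t\<^sup>2)" for t
    proof -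
      \<comment> \<open>Half of the Gaussian exponent pays for exp (n \<bar>t\<bar>), by completing
        the square of n - \<bar>t\<bar> / 2.\<close>
      have "real n * \<bar>t\<bar> \<le> (real n)\<^sup>2 + (1/4) * t\<^sup>2"
        using zero_le_power2[of "real n - \<bar>t\<bar> / 2"]
        by (simp add: power2_eq_square algebra_simps)
      then have "exp (real n * \<bar>t\<bar>) * exp (- (1/2) * t\<^sup>2) \<le> exp ((real n)\<^sup>2) * exp (- (1/4) * t\<^sup>2)"
        by (simp flip: exp_add)
      from mult_left_mono[OF this C(1)] C(2)[of t] show ?thesis by (simp add: mult.assoc)
    qed
    then show ?thesis using C(1) by (intro exI[of _ "C * exp ((real n)\<^sup>2)"]) auto
  qed
  then obtain C where C: "\<And>n. C n \<ge> 0" "\<And>n t. \<bar>hermite_1d n t\<bar> \<le> C n * exp (- (1/4) * t\<^sup>2)"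
    by metis
  have "\<bar>hermite \<alpha> x\<bar> \<le> (\<Prod>b\<in>Basis. C (\<alpha> b)) * exp (- (1/4) * (norm x)\<^sup>2)" for x
  proof -
    have "\<bar>hermite \<alpha> x\<bar> \<le> (\<Prod>b\<in>Basis. C (\<alpha> b) * exp (- (1/4) * (x \<bullet> b)\<^sup>2))"
      unfolding hermite_def abs_prod by (intro prod_mono) (use C in auto)
    also have "\<dots> = (\<Prod>b\<in>Basis. C (\<alpha> b)) * exp (- (1/4) * (norm x)\<^sup>2)"
      by (simp add: prod.distrib norm_sq_eq_sum_Basis sum_distrib_left sum_negf flip: exp_sum)
    finally show ?thesis .
  qed
  then show ?thesis
    using C(1) by (intro exI[of _ "\<Prod>b\<in>Basis. C (\<alpha> b)"]) (auto intro: prod_nonneg)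
qed

section \<open>Integration by parts and the fundamental lemma\<close>

lemma continuous_compact_support_integrable:
  fixes f :: "'a::euclidean_space \<Rightarrow> real"
  assumes "continuous_on UNIV f" "\<And>x. r \<le> norm x \<Longrightarrow> f x = 0"
  shows "integrable lborel f"
proof -
  have "integrable lborel (\<lambda>x. indicator (cball 0 r) x *\<^sub>R f x)"
    by (intro borel_integrable_compact compact_cball continuous_on_subset[OF assms(1)]) auto
  also have "(\<lambda>x. indicator (cball 0 r) x *\<^sub>R f x) = f"
    using assms(2) by (intro ext) (auto simp: indicator_def)
  finally show ?thesis .
qed

text \<open>Translation invariance of Lebesgue measure gives every difference quotient along b the
  integral 0, and dominated convergence passes to the derivative. No coordinates or iterated
  integrals are involved.\<close>

lemma integral_directional_derivative_zero:
  fixes f :: "'a::euclidean_space \<Rightarrow> real"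
  assumes diff: "\<And>x. f differentiable (at x)"
    and cont: "continuous_on UNIV (\<lambda>x. frechet_derivative f (at x) b)"
    and supp: "\<And>x. r \<le> norm x \<Longrightarrow> f x = 0"
  shows "(LINT x|lebesgue. frechet_derivative f (at x) b) = 0"
proof -
  define D where "D x = frechet_derivative f (at x) b" for x
  define h where "h n = 1 / real (Suc n)" for n
  define q where "q n x = (f (x + h n *\<^sub>R b) - f x) / h n" for n x
  have h: "0 < h n" "h n \<le> 1" for n by (auto simp: h_def)
  have contf: "continuous_on UNIV f"
    by (intro continuous_at_imp_continuous_on ballI differentiable_imp_continuous_within diff)
  then have borelf [measurable]: "f \<in> borel_measurable borel"
    by (rule borel_measurable_continuous_onI)
  have intf: "integrable lborel f"
    using contf supp by (rule continuous_compact_support_integrable)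
  have deriv: "((\<lambda>t. f (x + t *\<^sub>R b)) has_real_derivative D (x + t *\<^sub>R b)) (at t)" for x t
    unfolding D_def by (rule directional_derivative[OF diff])
  have "compact (D ` cball 0 (r + 2 * norm b))"
    unfolding D_def using cont by (intro compact_continuous_image compact_cball) (rule continuous_on_subset, auto)
  then obtain C where C: "\<And>x. norm x \<le> r + 2 * norm b \<Longrightarrow> \<bar>D x\<bar> \<le> C"
    using compact_imp_bounded by (fastforce simp: bounded_iff)
  \<comment> \<open>Since \<open>h n \<le> 1\<close>, the quotient vanishes outside the ball of
    radius \<open>r + norm b\<close>; a mean value point on a segment starting in that ball stays
    within \<open>r + 2 * norm b\<close>, where C bounds D.\<close>
  have bound: "\<bar>q n x\<bar> \<le> C * indicator (cball 0 (r + norm b)) x" for n x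
  proof (cases "norm x \<le> r + norm b")
    case True
    obtain z where z: "z > 0" "z < h n" "f (x + h n *\<^sub>R b) - f (x + 0 *\<^sub>R b) = (h n - 0) * D (x + z *\<^sub>R b)"
      using MVT2[OF h(1)[of n], of "\<lambda>t. f (x + t *\<^sub>R b)" "\<lambda>t. D (x + t *\<^sub>R b)"] deriv by blast
    then have "q n x = D (x + z *\<^sub>R b)"
      using h(1)[of n] by (simp add: q_def)
    moreover have "norm (x + z *\<^sub>R b) \<le> r + 2 * norm b"
    proof -
      have "z * norm b \<le> 1 * norm b" using z h(2)[of n] by (intro mult_right_mono) auto
      then show ?thesis using True z norm_triangle_ineq[of x "z *\<^sub>R b"] by simp
    qed
    ultimately show ?thesis using C True by simp
  next
    case False
    have "h n * norm b \<le> 1 * norm b" using h[of n] by (intro mult_right_mono) auto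
    then have "r \<le> norm (x + h n *\<^sub>R b)"
      using False h[of n] norm_diff_ineq[of x "h n *\<^sub>R b"] by simp
    moreover have "r \<le> norm x" using False norm_ge_zero[of b] by linarith
    ultimately show ?thesis using False by (simp add: q_def supp)
  qed
  have lim: "(\<lambda>n. q n x) \<longlonglongrightarrow> D x" for x
  proof -
    have "((\<lambda>t. (f (x + (0 + t) *\<^sub>R b) - f (x + 0 *\<^sub>R b)) / t) \<longlongrightarrow> D (x + 0 *\<^sub>R b)) (at 0)"
      using deriv[of x 0] unfolding DERIV_def .
    moreover have "filterlim h (at 0) sequentially"
      unfolding filterlim_at using h(1) LIMSEQ_inverse_real_of_nat
      by (auto simp: h_def[abs_def] less_imp_neq[symmetric] inverse_eq_divide simp del: of_nat_Suc)
    ultimately show ?thesis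
      unfolding q_def by (auto dest: filterlim_compose)
  qed
  have "(\<lambda>n. LINT x|lborel. q n x) \<longlonglongrightarrow> (LINT x|lborel. D x)"
  proof (rule integral_dominated_convergence)
    show "D \<in> borel_measurable lborel"
      using borel_measurable_continuous_onI[OF cont] by (simp add: D_def[abs_def])
    show "integrable lborel (\<lambda>x. C * indicator (cball 0 (r + norm b)) x)"
      by (intro integrable_mult_right integrable_real_indicator emeasure_lborel_cball_finite) auto
    show "q n \<in> borel_measurable lborel" for n
      unfolding q_def[abs_def] by measurable
  qed (use lim bound in auto)
  moreover have "(LINT x|lborel. q n x) = 0" for n
  proof -
    have tr: "distr lborel borel (\<lambda>x. x + h n *\<^sub>R b) = lborel"
      unfolding add.commute[of _ "h n *\<^sub>R b"] by (rule lborel_distr_plus)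
    have "integrable (distr lborel borel (\<lambda>x. x + h n *\<^sub>R b)) f" "integral\<^sup>L (distr lborel borel (\<lambda>x. x + h n *\<^sub>R b)) f = integral\<^sup>L lborel f"
      unfolding tr using intf by auto
    then have "integrable lborel (\<lambda>x. f (x + h n *\<^sub>R b))" "(LINT x|lborel. f (x + h n *\<^sub>R b)) = integral\<^sup>L lborel f"
      by (simp_all add: integrable_distr_eq integral_distr)
    then show ?thesis using intf by (simp add: q_def)
  qed
  ultimately have "(LINT x|lborel. D x) = 0"
    by (simp add: LIMSEQ_const_iff)
  then show ?thesis
    using borel_measurable_continuous_onI[OF cont] unfolding D_def
    by (subst integral_completion) auto
qed

section \<open>Bumps on boxes and the fundamental lemma\<close>

lemma flat_0_le_1: "flat 0 t \<le> 1"
  by (simp add: flat_def)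

lemma flat_0_scale_tendsto:
  assumes "t > 0"
  shows "(\<lambda>k. flat 0 (real (Suc k) * t)) \<longlonglongrightarrow> 1"
proof -
  have "(\<lambda>k. exp (- (1 / t * inverse (real (Suc k))))) \<longlonglongrightarrow> exp (- (1 / t * 0))"
    by (intro tendsto_intros LIMSEQ_inverse_real_of_nat)
  moreover have "flat 0 (real (Suc k) * t) = exp (- (1 / t * inverse (real (Suc k))))" for k
    using assms by (simp add: flat_def inverse_eq_divide mult.commute zero_less_mult_iff)
  ultimately show ?thesis by simp
qed

text \<open>Each factor is 0 outside its half-space and tends to 1 inside it as the scaling k + 1
  grows, so these test functions converge pointwise, from below, to the indicator of the open
  box.\<close>

definition box_bump :: "'a::euclidean_space \<Rightarrow> 'a \<Rightarrow> nat \<Rightarrow> 'a \<Rightarrow> real" where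
  "box_bump a b k x = (\<Prod>i\<in>Basis. flat 0 (real (Suc k) * (x \<bullet> i - a \<bullet> i)) * flat 0 (real (Suc k) * (b \<bullet> i - x \<bullet> i)))"

lemma box_bump_outside: "x \<notin> box a b \<Longrightarrow> box_bump a b k x = 0"
proof -
  assume "x \<notin> box a b"
  then obtain i where "i \<in> Basis" "\<not> (a \<bullet> i < x \<bullet> i \<and> x \<bullet> i < b \<bullet> i)"
    by (auto simp: mem_box)
  then show ?thesis
    unfolding box_bump_def by (intro prod_zero bexI[of _ i]) (auto simp: flat_def zero_less_mult_iff)
qed

lemma box_bump_nonneg: "0 \<le> box_bump a b k x"
  unfolding box_bump_def by (intro prod_nonneg mult_nonneg_nonneg flat_nonneg ballI)

lemma box_bump_le_indicator: "box_bump a b k x \<le> indicator (box a b) x"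
proof (cases "x \<in> box a b")
  case True
  then show ?thesis
    unfolding box_bump_def
    by (auto intro!: prod_le_1 mult_nonneg_nonneg flat_nonneg mult_le_one flat_0_le_1)
qed (simp add: box_bump_outside)

lemma box_bump_tendsto: "(\<lambda>k. box_bump a b k x) \<longlonglongrightarrow> indicator (box a b) x"
proof (cases "x \<in> box a b")
  case True
  then have "(\<lambda>k. box_bump a b k x) \<longlonglongrightarrow> (\<Prod>i\<in>(Basis::'a set). 1 * 1)"
    unfolding box_bump_def
    by (intro tendsto_prod tendsto_mult flat_0_scale_tendsto) (auto simp: mem_box)
  with True show ?thesis by simp
qed (simp add: box_bump_outside)

lemma box_bump_test_function: "box_bump a b k \<in> test_functions"
proof (rule smooth_alg_test_functions[where K = "box a b"])
  show "smooth_alg (box_bump a b k)"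
    unfolding box_bump_def[abs_def]
    by (intro smooth_alg_prod smooth_alg.mult smooth_alg.flat smooth_alg_diff smooth_alg.const smooth_alg.inner)
qed (auto simp: box_bump_outside bounded_box)

text \<open>Open boxes form an intersection-stable generator of the Borel sets, and the sets over
  which f integrates to 0 form a Dynkin system. The vanishing total integral serves the complements,
  as the whole space is not a box.\<close>

lemma AE_eq_0_if_box_integrals_eq_0:
  fixes f :: "'a::euclidean_space \<Rightarrow> real"
  assumes int: "integrable lborel f"
    and total: "integral\<^sup>L lborel f = 0"
    and box: "\<And>a b. (LINT x|lborel. indicator (box a b) x * f x) = 0"
  shows "AE x in lborel. f x = 0"
proof -
  have int_stable: "Int_stable (range (\<lambda>(a, b). box a b :: 'a set))"
    by (auto simp: Int_stable_def box_Int_box)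
  have subset_Pow: "range (\<lambda>(a, b). box a b :: 'a set) \<subseteq> Pow UNIV" by simp
  have zero: "(LINT x|lborel. indicator A x * f x) = 0" if "A \<in> sets borel" for A
  proof -
    have "A \<in> sigma_sets UNIV (range (\<lambda>(a, b). box a b :: 'a set))"
      using that by (simp add: borel_eq_box)
    with int_stable show ?thesis
    proof (induction A rule: sigma_sets_induct_disjoint[OF _ subset_Pow, consumes 2, case_names basic empty compl union])
      case (basic A)
      then show ?case using box by auto
    next
      case (compl A)
      then have A: "A \<in> sets lborel" by (simp add: borel_eq_box)
      have "(LINT x|lborel. indicator (UNIV - A) x * f x) = (LINT x|lborel. f x - indicator A x * f x)"
        by (intro Bochner_Integration.integral_cong) (auto simp: indicator_def)
      also have "\<dots> = 0"
        using int integrable_real_mult_indicator[OF A int] compl total by (simp add: mult.commute)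
      finally show ?case .
    next
      case (union A)
      have A: "A i \<in> sets lborel" for i using union by (auto simp: borel_eq_box)
      have "set_lebesgue_integral lborel (\<Union>i. A i) f = (\<Sum>i. set_lebesgue_integral lborel (A i) f)"
        using union A integrable_real_mult_indicator[OF _ int, of "\<Union>i. A i"]
        by (intro lebesgue_integral_countable_add) (auto simp: disjoint_family_on_def set_integrable_def mult.commute)
      then show ?case
        using union by (simp add: set_lebesgue_integral_def)
    qed auto
  qed
  show ?thesis
    using zero by (intro density_unique_real int) (auto simp: set_lebesgue_integral_def)
qed

lemma locally_integrable_measurable:
  fixes f :: "'a::euclidean_space \<Rightarrow> 'b::euclidean_space"
  assumes "locally_integrable f"
  shows "f \<in> borel_measurable lebesgue"
proof (rule borel_measurable_LIMSEQ_metric)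
  show "(\<lambda>x. indicator (cball 0 (real n)) x *\<^sub>R f x) \<in> borel_measurable lebesgue" for n
    using assms by (intro borel_measurable_integrable) (auto simp: locally_integrable_def set_integrable_def)
  fix x :: 'a
  obtain n where n: "norm x \<le> real n" using real_arch_simple by blast
  have "indicator (cball 0 (real k)) x *\<^sub>R f x = f x" if "n \<le> k" for k
    using n that by (simp add: indicator_def)
  then show "(\<lambda>n. indicator (cball 0 (real n)) x *\<^sub>R f x) \<longlonglongrightarrow> f x"
    by (intro tendsto_eventually) (auto simp: eventually_sequentially)
qed

text \<open>Bumps turn the hypothesis on test functions into vanishing integrals over boxes. The
  argument is localised to one box at a time, because d is integrable there but perhaps not
  globally.\<close>

lemma fundamental_lemma_calculus_of_variations:
  fixes d :: "'a::euclidean_space \<Rightarrow> real"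
  assumes loc: "locally_integrable d"
    and orth: "\<And>\<phi>. \<phi> \<in> test_functions \<Longrightarrow> (LINT x|lebesgue. d x * \<phi> x) = 0"
  shows "AE x in lebesgue. d x = 0"
proof -
  have cbox: "integrable lebesgue (\<lambda>x. indicator (cbox a b) x * d x)" for a b
    using loc by (auto simp: locally_integrable_def set_integrable_def)
  have boxi: "integrable lebesgue (\<lambda>x. indicator (box a b) x * d x)" for a b
  proof -
    have "(\<lambda>x. indicator (box a b) x * d x) = (\<lambda>x. (indicator (cbox a b) x * d x) * indicator (box a b) x)"
      using box_subset_cbox[of a b] by (auto simp: indicator_def fun_eq_iff)
    then show ?thesis
      using integrable_real_mult_indicator[OF _ cbox, of "box a b" a b] by simp
  qed
  have meas: "d \<in> borel_measurable lebesgue"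
    using loc by (rule locally_integrable_measurable)
  have zero: "(LINT x|lebesgue. indicator (box a b) x * d x) = 0" for a b
  proof -
    have "(\<lambda>k. LINT x|lebesgue. d x * box_bump a b k x) \<longlonglongrightarrow> (LINT x|lebesgue. indicator (box a b) x * d x)"
    proof (rule integral_dominated_convergence[where w = "\<lambda>x. \<bar>indicator (box a b) x * d x\<bar>"])
      show "(\<lambda>x. d x * box_bump a b k x) \<in> borel_measurable lebesgue" for k
      proof -
        have "box_bump a b k \<in> borel_measurable lebesgue"
          by (intro lebesgue_measurable_lborel borel_measurable_continuous_onI test_function_continuous box_bump_test_function)
        then show ?thesis using meas by (intro borel_measurable_times)
      qed
      show "AE x in lebesgue. (\<lambda>k. d x * box_bump a b k x) \<longlonglongrightarrow> indicator (box a b) x * d x"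
      proof (rule AE_I2)
        show "(\<lambda>k. d x * box_bump a b k x) \<longlonglongrightarrow> indicator (box a b) x * d x" for x
          using tendsto_mult_left[OF box_bump_tendsto, of "d x" a b x] by (simp add: mult.commute)
      qed
      show "AE x in lebesgue. norm (d x * box_bump a b k x) \<le> \<bar>indicator (box a b) x * d x\<bar>" for k
        using mult_right_mono[OF box_bump_le_indicator[of a b k], of "\<bar>d _\<bar>"] box_bump_nonneg[of a b k]
        by (simp add: abs_mult mult.commute)
    qed (use boxi meas borel_measurable_integrable[OF boxi] integrable_abs[OF boxi] in auto)
    then show ?thesis
      by (simp add: orth[OF box_bump_test_function] LIMSEQ_const_iff)
  qed
  have AEbox: "AE x in lebesgue. indicator (box a b) x * d x = 0" for a b
  proof -
    define f where "f x = indicator (box a b) x * d x" for x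
    have intf: "integrable lebesgue f" unfolding f_def by (rule boxi)
    \<comment> \<open>The generator argument concerns Borel functions, so f is replaced by a Borel
      function that agrees with it almost everywhere.\<close>
    obtain g where g [measurable]: "g \<in> borel_measurable lborel" and AEg: "AE x in lborel. f x = g x"
      using completion_ex_borel_measurable_real[OF borel_measurable_integrable[OF intf]] by blast
    have fm: "f \<in> borel_measurable lebesgue" and gm: "g \<in> borel_measurable lebesgue"
      using borel_measurable_integrable[OF intf] g by (auto intro: measurable_completion)
    have AEg': "AE x in lebesgue. f x = g x" using AEg by (rule AE_completion)
    have intg: "integrable lebesgue g"
      using integrable_cong_AE[OF fm gm AEg'] intf by blast
    have gbox: "(LINT x|lborel. indicator (box p q) x * g x) = 0" for p q
    proof -
      have "(LINT x|lborel. indicator (box p q) x * g x) = (LINT x|lebesgue. indicator (box p q) x * g x)"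
        by (subst integral_completion) auto
      also have "\<dots> = (LINT x|lebesgue. indicator (box p q) x * f x)"
        using AEg' by (intro integral_cong_AE borel_measurable_times fm gm borel_measurable_indicator) auto
      also have "\<dots> = (LINT x|lebesgue. indicator (box p q \<inter> box a b) x * d x)"
        unfolding f_def by (intro Bochner_Integration.integral_cong) (auto simp: indicator_def)
      also have "\<dots> = 0" unfolding box_Int_box by (rule zero)
      finally show ?thesis .
    qed
    have "integral\<^sup>L lborel g = integral\<^sup>L lebesgue g"
      by (subst integral_completion) auto
    also have "\<dots> = integral\<^sup>L lebesgue f"
      using AEg' by (intro integral_cong_AE fm gm) auto
    also have "\<dots> = 0" unfolding f_def by (rule zero)
    finally have "AE x in lborel. g x = 0"
      using intg g gbox by (intro AE_eq_0_if_box_integrals_eq_0) (simp_all add: integrable_completion)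
    then have "AE x in lebesgue. g x = 0" by (rule AE_completion)
    with AEg' show ?thesis unfolding f_def by eventually_elim simp
  qed
  \<comment> \<open>Countably many boxes exhaust the space, so their exceptional null sets can be
    united.\<close>
  have "AE x in lebesgue. \<forall>n. indicator (box (- real n *\<^sub>R One) (real n *\<^sub>R One)) x * d x = 0"
    using AEbox by (subst AE_all_countable) blast
  then show ?thesis
  proof eventually_elim
    case (elim x)
    obtain n where "norm x < real n" using reals_Archimedean2 by blast
    then have "\<bar>x \<bullet> i\<bar> < real n" if "i \<in> Basis" for i
      using Basis_le_norm[OF that, of x] by linarith
    then have "x \<in> box (- real n *\<^sub>R One) (real n *\<^sub>R One)"
      by (force simp: mem_box abs_less_iff)
    with elim show ?case by (metis indicator_simps(1) mult_1)
  qed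
qed

section \<open>Hermite functions against weak derivatives\<close>

lemma L2_functionsI:
  "f \<in> borel_measurable lebesgue \<Longrightarrow> integrable lebesgue (\<lambda>x. (norm (f x))\<^sup>2) \<Longrightarrow> f \<in> L2_functions"
  by (simp add: L2_functions_def)

lemma L2_functionsD:
  assumes "f \<in> L2_functions"
  shows L2_measurable: "f \<in> borel_measurable lebesgue"
    and L2_integrable: "integrable lebesgue (\<lambda>x. (norm (f x))\<^sup>2)"
  using assms by (simp_all add: L2_functions_def)

lemma L2_integrable_square:
  fixes f :: "'a::euclidean_space \<Rightarrow> real"
  shows "f \<in> L2_functions \<Longrightarrow> integrable lebesgue (\<lambda>x. (f x)\<^sup>2)"
  using L2_integrable[of f] by simp

lemma L2_dominated:
  assumes "g \<in> L2_functions" "f \<in> borel_measurable lebesgue"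
    and "\<And>x. norm (f x) \<le> C * norm (g x)"
  shows "f \<in> L2_functions"
proof (rule L2_functionsI[OF assms(2)])
  show "integrable lebesgue (\<lambda>x. (norm (f x))\<^sup>2)"
  proof (rule Bochner_Integration.integrable_bound)
    show "integrable lebesgue (\<lambda>x. C\<^sup>2 * (norm (g x))\<^sup>2)"
      using L2_integrable[OF assms(1)] by simp
    show "AE x in lebesgue. norm ((norm (f x))\<^sup>2) \<le> norm (C\<^sup>2 * (norm (g x))\<^sup>2)"
      using assms(3) power_mono[OF assms(3) norm_ge_zero, of _ 2] by (simp add: power_mult_distrib)
  qed (use assms(2) in measurable)
qed

lemma L2_inner_integrable:
  assumes "f \<in> L2_functions" "g \<in> L2_functions"
  shows "integrable lebesgue (\<lambda>x. f x \<bullet> g x)"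
proof (rule Bochner_Integration.integrable_bound)
  show "integrable lebesgue (\<lambda>x. (norm (f x))\<^sup>2 + (norm (g x))\<^sup>2)"
    using assms by (intro Bochner_Integration.integrable_add L2_integrable)
  show "(\<lambda>x. f x \<bullet> g x) \<in> borel_measurable lebesgue"
    using assms by (intro borel_measurable_inner L2_measurable)
  have "norm (f x \<bullet> g x) \<le> norm ((norm (f x))\<^sup>2 + (norm (g x))\<^sup>2)" for x
    using Cauchy_Schwarz_ineq2[of "f x" "g x"] sum_squares_bound[of "norm (f x)" "norm (g x)"]
      mult_nonneg_nonneg[OF norm_ge_zero norm_ge_zero, of "f x" "g x"]
    by simp
  then show "AE x in lebesgue. norm (f x \<bullet> g x) \<le> norm ((norm (f x))\<^sup>2 + (norm (g x))\<^sup>2)"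
    by simp
qed

lemma L2_mult_integrable:
  fixes f g :: "'a::euclidean_space \<Rightarrow> real"
  shows "f \<in> L2_functions \<Longrightarrow> g \<in> L2_functions \<Longrightarrow> integrable lebesgue (\<lambda>x. f x * g x)"
  using L2_inner_integrable[of f g] by simp

lemma L2_scaleR: "f \<in> L2_functions \<Longrightarrow> (\<lambda>x. c *\<^sub>R f x) \<in> L2_functions"
  by (rule L2_dominated[of f _ "\<bar>c\<bar>"]) (auto dest: L2_measurable)

lemma L2_add:
  assumes "f \<in> L2_functions" "g \<in> L2_functions"
  shows "(\<lambda>x. f x + g x) \<in> L2_functions"
proof (rule L2_functionsI)
  show "(\<lambda>x. f x + g x) \<in> borel_measurable lebesgue"
    using assms by (intro borel_measurable_add L2_measurable)
  have "integrable lebesgue (\<lambda>x. (norm (f x))\<^sup>2 + 2 * (f x \<bullet> g x) + (norm (g x))\<^sup>2)"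
    using assms by (intro Bochner_Integration.integrable_add L2_integrable integrable_mult_right L2_inner_integrable)
  then show "integrable lebesgue (\<lambda>x. (norm (f x + g x))\<^sup>2)"
    by (simp add: power2_norm_eq_inner inner_add_left inner_add_right inner_commute algebra_simps)
qed

lemma L2_diff: "f \<in> L2_functions \<Longrightarrow> g \<in> L2_functions \<Longrightarrow> (\<lambda>x. f x - g x) \<in> L2_functions"
  using L2_add[OF _ L2_scaleR[of g "-1"], of f] by simp

lemma L2_mult_const:
  fixes f :: "'a::euclidean_space \<Rightarrow> real"
  shows "f \<in> L2_functions \<Longrightarrow> (\<lambda>x. c * f x) \<in> L2_functions"
  using L2_scaleR[of f c] by simp

lemma L2_zero: "(\<lambda>x. 0) \<in> L2_functions"
  by (simp add: L2_functions_def)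

lemma L2_sum: "(\<And>i. i \<in> I \<Longrightarrow> f i \<in> L2_functions) \<Longrightarrow> (\<lambda>x. \<Sum>i\<in>I. f i x) \<in> L2_functions"
  by (induction I rule: infinite_finite_induct) (auto intro: L2_add L2_zero)

lemma L2_inner_Basis: "f \<in> L2_functions \<Longrightarrow> b \<in> Basis \<Longrightarrow> (\<lambda>x. f x \<bullet> b) \<in> L2_functions"
  by (rule L2_dominated[of f _ 1]) (auto dest: L2_measurable simp: Basis_le_norm)

lemma L2_gaussian_decay:
  assumes "c > 0"
  shows "(\<lambda>x::'a::euclidean_space. exp (- c * (norm x)\<^sup>2)) \<in> L2_functions"
proof (rule L2_functionsI)
  have "integrable lebesgue (\<lambda>x::'a. exp (- ((2 * c) * (norm x)\<^sup>2)))"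
    by (rule integrable_gaussian) (use assms in simp)
  moreover have "(norm (exp (- c * (norm x)\<^sup>2)))\<^sup>2 = exp (- ((2 * c) * (norm x)\<^sup>2))" for x :: 'a
    by (simp add: power2_eq_square flip: exp_add)
  ultimately show "integrable lebesgue (\<lambda>x::'a. (norm (exp (- c * (norm x)\<^sup>2)))\<^sup>2)"
    by simp
qed (intro lebesgue_measurable_lborel, measurable)

lemma L2_hermite: "hermite \<alpha> \<in> L2_functions"
proof -
  obtain C where "\<And>x. \<bar>hermite \<alpha> x\<bar> \<le> C * exp (- (1/4) * (norm x)\<^sup>2)"
    using hermite_bound by blast
  then show ?thesis
    by (intro L2_dominated[OF L2_gaussian_decay[of "1/4"], of _ C] smooth_alg_lebesgue smooth_alg_hermite) auto
qed

definition gradient :: "('a::euclidean_space \<Rightarrow> real) \<Rightarrow> 'a \<Rightarrow> 'a" where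
  "gradient f x = (\<Sum>b\<in>Basis. frechet_derivative f (at x) b *\<^sub>R b)"

lemma gradient_inner: "b \<in> Basis \<Longrightarrow> gradient f x \<bullet> b = frechet_derivative f (at x) b"
  by (simp add: gradient_def inner_sum_left_Basis)

lemma L2_hermite_derivative:
  "b \<in> Basis \<Longrightarrow> (\<lambda>x. frechet_derivative (hermite \<alpha>) (at x) b) \<in> L2_functions"
  unfolding hermite_derivative
  using L2_diff[OF L2_mult_const[OF L2_hermite] L2_mult_const[OF L2_hermite, where c = "1/2"]] by simp

lemma L2_gradient_hermite: "gradient (hermite \<alpha>) \<in> L2_functions"
proof -
  have "(\<lambda>x. frechet_derivative (hermite \<alpha>) (at x) b *\<^sub>R b) \<in> L2_functions" if "b \<in> Basis" for b
    using that L2_measurable[OF L2_hermite_derivative[OF that]]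
    by (intro L2_dominated[OF L2_hermite_derivative[OF that], of _ 1 \<alpha>]) auto
  then show ?thesis unfolding gradient_def[abs_def] by (rule L2_sum)
qed

section \<open>Classical gradients as weak gradients\<close>

lemma locally_integrable_continuous:
  fixes f :: "'a::euclidean_space \<Rightarrow> 'b::euclidean_space"
  assumes "continuous_on UNIV f"
  shows "locally_integrable f"
  unfolding locally_integrable_def set_integrable_def
proof (intro allI impI)
  fix K :: "'a set" assume K: "compact K"
  then have "integrable lborel (\<lambda>x. indicator K x *\<^sub>R f x)"
    by (intro borel_integrable_compact continuous_on_subset[OF assms]) auto
  moreover have "(\<lambda>x. indicator K x *\<^sub>R f x) \<in> borel_measurable borel"
    using K borel_measurable_continuous_onI[OF assms] borel_compact[OF K] by measurable
  ultimately show "integrable lebesgue (\<lambda>x. indicator K x *\<^sub>R f x)"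
    by (simp add: lebesgue_integrable_iff)
qed

lemma locally_integrable_add:
  "locally_integrable f \<Longrightarrow> locally_integrable g \<Longrightarrow> locally_integrable (\<lambda>x. f x + g x)"
  by (auto simp: locally_integrable_def intro: set_integral_add)

lemma locally_integrable_scaleR:
  "locally_integrable f \<Longrightarrow> locally_integrable (\<lambda>x. c *\<^sub>R f x)"
  by (auto simp: locally_integrable_def intro: set_integrable_scaleR_right)

lemma frechet_derivative_mult:
  fixes f g :: "'a::real_normed_vector \<Rightarrow> real"
  assumes "f differentiable (at x)" "g differentiable (at x)"
  shows "frechet_derivative (\<lambda>x. f x * g x) (at x) b
    = f x * frechet_derivative g (at x) b + frechet_derivative f (at x) b * g x"
proof -
  have "((\<lambda>x. f x * g x) has_derivative
      (\<lambda>h. f x * frechet_derivative g (at x) h + frechet_derivative f (at x) h * g x)) (at x)"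
    using assms by (intro has_derivative_mult) (auto simp: frechet_derivative_works)
  from frechet_derivative_at[OF this] show ?thesis by metis
qed

lemma test_function_derivative_support:
  fixes \<phi> :: "'a::euclidean_space \<Rightarrow> real"
  assumes "\<And>x. r \<le> norm x \<Longrightarrow> \<phi> x = 0" "r < norm x"
  shows "frechet_derivative \<phi> (at x) b = 0"
proof -
  have "open {x::'a. r < norm x}" by (intro open_Collect_less continuous_intros)
  then have "(\<phi> has_derivative (\<lambda>h. 0)) (at x)"
    using assms by (intro has_derivative_transform_within_open[OF has_derivative_const[of 0]]) auto
  from frechet_derivative_at[OF this] show ?thesis by metis
qed

lemma smooth_alg_has_weak_gradient:
  fixes f :: "'a::euclidean_space \<Rightarrow> real"
  assumes f: "smooth_alg f"
  shows "has_weak_gradient f (gradient f)"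
  unfolding has_weak_gradient_def
proof (intro conjI ballI)
  show "locally_integrable f"
    by (intro locally_integrable_continuous smooth_alg_continuous f)
  show "locally_integrable (gradient f)"
    unfolding gradient_def[abs_def]
    by (intro locally_integrable_continuous continuous_intros smooth_alg_continuous smooth_alg_frechet_derivative f)
next
  fix \<phi> :: "'a \<Rightarrow> real" and b :: 'a
  assume \<phi>: "\<phi> \<in> test_functions" and b: "b \<in> Basis"
  obtain r where r: "r > 0" "\<And>x. r \<le> norm x \<Longrightarrow> \<phi> x = 0"
    using test_function_support[OF \<phi>] by blast
  have d: "f differentiable (at x)" "\<phi> differentiable (at x)" for x
    by (rule smooth_alg_differentiable[OF f], rule test_function_differentiable[OF \<phi>])
  have D: "frechet_derivative (\<lambda>x. f x * \<phi> x) (at x) b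
      = f x * frechet_derivative \<phi> (at x) b + frechet_derivative f (at x) b * \<phi> x" for x
    by (rule frechet_derivative_mult[OF d])
  have c: "continuous_on UNIV (\<lambda>x. f x * frechet_derivative \<phi> (at x) b)"
      "continuous_on UNIV (\<lambda>x. frechet_derivative f (at x) b * \<phi> x)"
    by (intro continuous_intros smooth_alg_continuous smooth_alg_frechet_derivative f
        test_function_derivative_continuous test_function_continuous \<phi> b)+
  have i: "integrable lebesgue (\<lambda>x. f x * frechet_derivative \<phi> (at x) b)"
      "integrable lebesgue (\<lambda>x. frechet_derivative f (at x) b * \<phi> x)"
    \<comment> \<open>The derivative of \<phi> is known to vanish strictly beyond radius r, hence
      the radius r + 1.\<close>
    using continuous_compact_support_integrable[OF c(1), of "r + 1"]
      continuous_compact_support_integrable[OF c(2), of r]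
      r test_function_derivative_support[of r \<phi>] c[THEN borel_measurable_continuous_onI]
    by (auto simp: lebesgue_integrable_iff)
  have "(LINT x|lebesgue. frechet_derivative (\<lambda>x. f x * \<phi> x) (at x) b) = 0"
  proof (rule integral_directional_derivative_zero)
    show "(\<lambda>x. f x * \<phi> x) differentiable (at x)" for x by (intro differentiable_mult d)
    show "continuous_on UNIV (\<lambda>x. frechet_derivative (\<lambda>x. f x * \<phi> x) (at x) b)"
      unfolding D by (intro continuous_on_add c)
  qed (use r in auto)
  then show "(LINT x|lebesgue. f x * frechet_derivative \<phi> (at x) b)
      = - (LINT x|lebesgue. (gradient f x \<bullet> b) * \<phi> x)"
    unfolding D gradient_inner[OF b] using i by simp
qed

text \<open>The factor exp 1 normalises the value at the origin to 1, as
  \<open>flat 0 1 = exp (-1)\<close>. The inner product in place of the norm keeps the cutoff within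
  \<open>smooth_alg\<close>.\<close>

definition cutoff :: "nat \<Rightarrow> 'a::euclidean_space \<Rightarrow> real" where
  "cutoff k x = exp 1 * flat 0 (1 - (x \<bullet> x) / (real (Suc k))\<^sup>2)"

lemma smooth_alg_cutoff: "smooth_alg (cutoff k)"
  unfolding cutoff_def[abs_def] divide_inverse euclidean_inner[of x x for x]
  by (intro smooth_alg.intros smooth_alg_diff smooth_alg_sum)

lemma cutoff_outside: "real (Suc k) \<le> norm x \<Longrightarrow> cutoff k x = 0"
  using power_mono[of "real (Suc k)" "norm x" 2]
  by (simp add: cutoff_def flat_def divide_simps power2_norm_eq_inner del: of_nat_Suc)

lemma cutoff_nonneg: "0 \<le> cutoff k x"
  by (simp add: cutoff_def flat_nonneg)

lemma cutoff_le_1: "cutoff k x \<le> 1"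
proof -
  define t where "t = 1 - (x \<bullet> x) / (real (Suc k))\<^sup>2"
  have "t \<le> 1" by (simp add: t_def)
  then have "exp 1 * flat 0 t \<le> 1"
    by (auto simp: flat_def divide_simps simp flip: exp_add)
  then show ?thesis by (simp add: cutoff_def t_def)
qed

lemma cutoff_tendsto: "(\<lambda>k. cutoff k x) \<longlonglongrightarrow> 1"
proof -
  have "isCont (flat 0) 1"
    using has_real_derivative_flat by (rule DERIV_isCont)
  moreover have "(\<lambda>k. 1 - (x \<bullet> x) * (inverse (real (Suc k)))\<^sup>2) \<longlonglongrightarrow> 1 - (x \<bullet> x) * 0\<^sup>2"
    by (intro tendsto_intros LIMSEQ_inverse_real_of_nat)
  ultimately have "(\<lambda>k. exp 1 * flat 0 (1 - (x \<bullet> x) * (inverse (real (Suc k)))\<^sup>2)) \<longlonglongrightarrow> exp 1 * flat 0 1"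
    by (intro tendsto_mult_left isCont_tendsto_compose[of 1 "flat 0"]) auto
  then show ?thesis
    by (simp add: cutoff_def flat_def divide_inverse power_inverse flip: exp_add)
qed

lemma cutoff_derivative_bound:
  assumes b: "b \<in> Basis"
  shows "\<bar>frechet_derivative (cutoff k) (at x) b\<bar> \<le> 4 * exp 1 / real (Suc k)"
proof -
  define R where "R = real (Suc k)"
  have R: "R > 0" by (simp add: R_def)
  define t where "t = 1 - (x \<bullet> x) / R\<^sup>2"
  have "((\<lambda>x. 1 - (x \<bullet> x) / R\<^sup>2) has_derivative (\<lambda>h. - ((x \<bullet> h + h \<bullet> x) / R\<^sup>2))) (at x)"
    unfolding divide_inverse using R by (auto intro!: derivative_eq_intros)
  then have "((\<lambda>x. flat 0 (1 - (x \<bullet> x) / R\<^sup>2)) has_derivative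
      (\<lambda>h. (flat 2 t - 0 * flat 1 t) * (- ((x \<bullet> h + h \<bullet> x) / R\<^sup>2)))) (at x)"
    using has_derivative_compose[OF _ has_field_derivative_imp_has_derivative[OF has_real_derivative_flat[of 0]]]
    by (fastforce simp: t_def numeral_2_eq_2)
  then have "(cutoff k has_derivative
      (\<lambda>h. exp 1 * ((flat 2 t - 0 * flat 1 t) * (- ((x \<bullet> h + h \<bullet> x) / R\<^sup>2))))) (at x)"
    unfolding cutoff_def[abs_def] R_def[symmetric] by (rule has_derivative_mult_right)
  from fun_cong[OF frechet_derivative_at[OF this], of b]
  have D: "frechet_derivative (cutoff k) (at x) b = - (exp 1 * flat 2 t * (2 * (x \<bullet> b)) / R\<^sup>2)"
    by (simp add: inner_commute mult.assoc)
  \<comment> \<open>On the support the norm is at most R, and \<open>flat 2\<close> is bounded by 2!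
    = 2. With the factor 2 from differentiating the square this produces the constant 4.\<close>
  have "flat 2 t * \<bar>x \<bullet> b\<bar> \<le> 2 * R"
  proof (cases "t > 0")
    case True
    then have "(norm x)\<^sup>2 \<le> R\<^sup>2" using R by (simp add: t_def field_simps power2_norm_eq_inner)
    then have "norm x \<le> R" using R by (simp add: power2_le_iff_abs_le)
    then have "\<bar>x \<bullet> b\<bar> \<le> R" using Basis_le_norm[OF b, of x] by linarith
    moreover have "flat 2 t \<le> 2" using flat_bound[of 2 t 0] by (simp add: fact_numeral)
    ultimately show ?thesis using R by (intro mult_mono) auto
  qed (use R in \<open>simp add: flat_def\<close>)
  then have "exp 1 * (2 * (flat 2 t * \<bar>x \<bullet> b\<bar>)) / R\<^sup>2 \<le> exp 1 * (2 * (2 * R)) / R\<^sup>2"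
    by (intro divide_right_mono mult_left_mono) auto
  also have "\<dots> = 4 * exp 1 / R" using R by (simp add: power2_eq_square)
  finally show ?thesis
    unfolding D R_def[symmetric] by (simp add: abs_mult flat_nonneg mult.assoc mult.left_commute)
qed

text \<open>Hermite functions lack compact support, so the definition of the weak gradient is
  applied to their truncations. The error carries the derivative of the cutoff, which is uniformly
  bounded and of order 1 / k; dominated convergence removes it because u and the Hermite function
  are in L^2.\<close>

lemma weak_gradient_hermite:
  fixes u :: "'a::euclidean_space \<Rightarrow> real"
  assumes u: "u \<in> L2_functions" and v: "v \<in> L2_functions" and weak: "has_weak_gradient u v"
    and b: "b \<in> Basis"
  shows "(LINT x|lebesgue. u x * frechet_derivative (hermite \<alpha>) (at x) b)
    = - (LINT x|lebesgue. (v x \<bullet> b) * hermite \<alpha> x)"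
proof -
  let ?D = "\<lambda>f x. frechet_derivative f (at x) b"
  have vb: "(\<lambda>x. v x \<bullet> b) \<in> L2_functions" by (rule L2_inner_Basis[OF v b])
  have cm: "cutoff k \<in> borel_measurable lebesgue" "?D (cutoff k) \<in> borel_measurable lebesgue" for k
    by (intro smooth_alg_lebesgue smooth_alg_cutoff smooth_alg_frechet_derivative)+
  have hm: "hermite \<alpha> \<in> borel_measurable lebesgue" "?D (hermite \<alpha>) \<in> borel_measurable lebesgue"
    by (intro smooth_alg_lebesgue smooth_alg_hermite smooth_alg_frechet_derivative)+
  have test: "(\<lambda>x. cutoff k x * hermite \<alpha> x) \<in> test_functions" for k
    by (rule smooth_alg_test_functions[where K = "ball 0 (real (Suc k))"])
      (auto intro: smooth_alg.mult smooth_alg_cutoff smooth_alg_hermite cutoff_outside simp del: of_nat_Suc)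
  have D: "?D (\<lambda>x. cutoff k x * hermite \<alpha> x) x = cutoff k x * ?D (hermite \<alpha>) x + ?D (cutoff k) x * hermite \<alpha> x" for k x
    by (intro frechet_derivative_mult smooth_alg_differentiable smooth_alg_cutoff smooth_alg_hermite)
  have bnd: "\<bar>?D (cutoff k) x\<bar> \<le> 4 * exp 1" for k x
    by (rule order.trans[OF cutoff_derivative_bound[OF b]]) (simp add: divide_simps)
  have lim0: "(\<lambda>k. ?D (cutoff k) x) \<longlonglongrightarrow> 0" for x
  proof (rule Lim_null_comparison)
    show "\<forall>\<^sub>F k in sequentially. norm (?D (cutoff k) x) \<le> 4 * exp 1 * inverse (real (Suc k))"
      using cutoff_derivative_bound[OF b] by (simp add: divide_inverse)
    show "(\<lambda>k. 4 * exp 1 * inverse (real (Suc k))) \<longlonglongrightarrow> 0"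
      using tendsto_mult_left[OF LIMSEQ_inverse_real_of_nat, of "4 * exp 1"] by simp
  qed
  have "(\<lambda>k. LINT x|lebesgue. u x * ?D (\<lambda>x. cutoff k x * hermite \<alpha> x) x)
      \<longlonglongrightarrow> (LINT x|lebesgue. u x * ?D (hermite \<alpha>) x)"
    unfolding D
  proof (rule integral_dominated_convergence[where w = "\<lambda>x. \<bar>u x * ?D (hermite \<alpha>) x\<bar> + 4 * exp 1 * \<bar>u x * hermite \<alpha> x\<bar>"])
    show "integrable lebesgue (\<lambda>x. \<bar>u x * ?D (hermite \<alpha>) x\<bar> + 4 * exp 1 * \<bar>u x * hermite \<alpha> x\<bar>)"
      by (intro Bochner_Integration.integrable_add integrable_mult_right integrable_abs
          L2_mult_integrable u L2_hermite L2_hermite_derivative b)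
    show "AE x in lebesgue. (\<lambda>k. u x * (cutoff k x * ?D (hermite \<alpha>) x + ?D (cutoff k) x * hermite \<alpha> x))
        \<longlonglongrightarrow> u x * ?D (hermite \<alpha>) x"
    proof (rule AE_I2)
      fix x
      have "(\<lambda>k. u x * (cutoff k x * ?D (hermite \<alpha>) x + ?D (cutoff k) x * hermite \<alpha> x))
          \<longlonglongrightarrow> u x * (1 * ?D (hermite \<alpha>) x + 0 * hermite \<alpha> x)"
        by (intro tendsto_intros cutoff_tendsto lim0)
      then show "(\<lambda>k. u x * (cutoff k x * ?D (hermite \<alpha>) x + ?D (cutoff k) x * hermite \<alpha> x))
          \<longlonglongrightarrow> u x * ?D (hermite \<alpha>) x" by simp
    qed
    show "AE x in lebesgue. norm (u x * (cutoff k x * ?D (hermite \<alpha>) x + ?D (cutoff k) x * hermite \<alpha> x))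
        \<le> \<bar>u x * ?D (hermite \<alpha>) x\<bar> + 4 * exp 1 * \<bar>u x * hermite \<alpha> x\<bar>" for k
    proof (rule AE_I2)
      fix x
      have "\<bar>cutoff k x * ?D (hermite \<alpha>) x + ?D (cutoff k) x * hermite \<alpha> x\<bar>
          \<le> 1 * \<bar>?D (hermite \<alpha>) x\<bar> + 4 * exp 1 * \<bar>hermite \<alpha> x\<bar>"
        using cutoff_nonneg[of k x] cutoff_le_1[of k x] bnd[of k x]
        by (intro order.trans[OF abs_triangle_ineq] add_mono) (auto simp: abs_mult intro!: mult_right_mono mult_left_le_one_le)
      from mult_left_mono[OF this abs_ge_zero[of "u x"]]
      show "norm (u x * (cutoff k x * ?D (hermite \<alpha>) x + ?D (cutoff k) x * hermite \<alpha> x))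
        \<le> \<bar>u x * ?D (hermite \<alpha>) x\<bar> + 4 * exp 1 * \<bar>u x * hermite \<alpha> x\<bar>"
        unfolding real_norm_def abs_mult by (simp add: distrib_left mult.left_commute)
    qed
  qed (use cm hm L2_measurable[OF u] in \<open>auto intro!: borel_measurable_times borel_measurable_add\<close>)
  moreover have lim2: "(\<lambda>k. LINT x|lebesgue. (v x \<bullet> b) * (cutoff k x * hermite \<alpha> x))
      \<longlonglongrightarrow> (LINT x|lebesgue. (v x \<bullet> b) * hermite \<alpha> x)"
  proof (rule integral_dominated_convergence[where w = "\<lambda>x. \<bar>(v x \<bullet> b) * hermite \<alpha> x\<bar>"])
    show "integrable lebesgue (\<lambda>x. \<bar>(v x \<bullet> b) * hermite \<alpha> x\<bar>)"
      by (intro integrable_abs L2_mult_integrable vb L2_hermite)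
    show "AE x in lebesgue. (\<lambda>k. (v x \<bullet> b) * (cutoff k x * hermite \<alpha> x)) \<longlonglongrightarrow> (v x \<bullet> b) * hermite \<alpha> x"
    proof (rule AE_I2)
      show "(\<lambda>k. (v x \<bullet> b) * (cutoff k x * hermite \<alpha> x)) \<longlonglongrightarrow> (v x \<bullet> b) * hermite \<alpha> x" for x
        using tendsto_mult_left[OF tendsto_mult_right[OF cutoff_tendsto], of "v x \<bullet> b" x "hermite \<alpha> x"] by simp
    qed
    show "AE x in lebesgue. norm ((v x \<bullet> b) * (cutoff k x * hermite \<alpha> x)) \<le> \<bar>(v x \<bullet> b) * hermite \<alpha> x\<bar>" for k
      using mult_right_mono[OF cutoff_le_1, of "\<bar>(v _ \<bullet> b) * hermite \<alpha> _\<bar>"]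
      by (intro AE_I2) (simp add: abs_mult cutoff_nonneg mult.left_commute mult_left_le_one_le cutoff_le_1)
  qed (use cm hm L2_measurable[OF vb] in \<open>auto intro!: borel_measurable_times\<close>)
  moreover have "(LINT x|lebesgue. u x * ?D (\<lambda>x. cutoff k x * hermite \<alpha> x) x)
      = - (LINT x|lebesgue. (v x \<bullet> b) * (cutoff k x * hermite \<alpha> x))" for k
    using weak test b unfolding has_weak_gradient_def by blast
  ultimately show ?thesis
    using LIMSEQ_unique[OF _ tendsto_minus[OF lim2]] by simp
qed

section \<open>Ladder operators and orthogonality\<close>

lemma hermite_raising:
  assumes "b \<in> Basis"
  shows "(x \<bullet> b) * hermite \<alpha> x - frechet_derivative (hermite \<alpha>) (at x) b = hermite (raise b \<alpha>) x"
  unfolding hermite_mult[OF assms] hermite_derivative[OF assms] by simp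

lemma hermite_lowering:
  assumes "b \<in> Basis"
  shows "(x \<bullet> b) * hermite \<alpha> x + frechet_derivative (hermite \<alpha>) (at x) b
    = 2 * real (\<alpha> b) * hermite (lower b \<alpha>) x"
  unfolding hermite_mult[OF assms] hermite_derivative[OF assms] by simp

lemma L2_hermite_mult: "b \<in> Basis \<Longrightarrow> (\<lambda>x. (x \<bullet> b) * hermite \<alpha> x) \<in> L2_functions"
  unfolding hermite_mult
  using L2_add[OF L2_mult_const[OF L2_hermite, where c = "1/2"] L2_mult_const[OF L2_hermite]] by simp

text \<open>Raising by x_b - d/dx_b is adjoint to lowering by x_b + d/dx_b. Writing
  \<open>hermite \<alpha>\<close> as a raised function and moving the operator to the other factor
  lowers \<open>hermite \<beta>\<close> at the price of \<open>2 * real (\<beta> b)\<close>.\<close>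

lemma hermite_inner_ladder:
  fixes \<alpha> \<beta> :: "'a::euclidean_space \<Rightarrow> nat"
  assumes b: "b \<in> Basis" and "\<alpha> b \<noteq> 0"
  shows "(LINT x|lebesgue. hermite \<alpha> x * hermite \<beta> x)
    = 2 * real (\<beta> b) * (LINT x|lebesgue. hermite (lower b \<alpha>) x * hermite (lower b \<beta>) x)"
proof -
  let ?D = "\<lambda>\<gamma> x. frechet_derivative (hermite \<gamma>) (at x) b"
  let ?\<gamma> = "lower b \<alpha>"
  have \<alpha>: "\<alpha> = raise b ?\<gamma>" using assms(2) by auto
  have i1: "integrable lebesgue (\<lambda>x. (x \<bullet> b) * hermite ?\<gamma> x * hermite \<beta> x)"
    by (intro L2_mult_integrable L2_hermite_mult L2_hermite b)
  have i2: "integrable lebesgue (\<lambda>x. hermite \<gamma> x * ?D \<delta> x)" for \<gamma> \<delta>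
    by (intro L2_mult_integrable L2_hermite_derivative L2_hermite b)
  have "(LINT x|lebesgue. hermite \<alpha> x * hermite \<beta> x)
      = (LINT x|lebesgue. (x \<bullet> b) * hermite ?\<gamma> x * hermite \<beta> x - hermite \<beta> x * ?D ?\<gamma> x)"
    by (subst \<alpha>, subst hermite_raising[OF b, symmetric]) (simp add: algebra_simps)
  also have "\<dots> = (LINT x|lebesgue. (x \<bullet> b) * hermite ?\<gamma> x * hermite \<beta> x) - (LINT x|lebesgue. hermite \<beta> x * ?D ?\<gamma> x)"
    by (intro Bochner_Integration.integral_diff i1 i2)
  also have "(LINT x|lebesgue. hermite \<beta> x * ?D ?\<gamma> x) = - (LINT x|lebesgue. hermite ?\<gamma> x * ?D \<beta> x)"
    using weak_gradient_hermite[OF L2_hermite L2_gradient_hermite smooth_alg_has_weak_gradient[OF smooth_alg_hermite] b, of \<beta> ?\<gamma>]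
    by (simp add: gradient_inner[OF b] mult.commute)
  also have "(LINT x|lebesgue. (x \<bullet> b) * hermite ?\<gamma> x * hermite \<beta> x) - - (LINT x|lebesgue. hermite ?\<gamma> x * ?D \<beta> x)
      = (LINT x|lebesgue. (x \<bullet> b) * hermite ?\<gamma> x * hermite \<beta> x + hermite ?\<gamma> x * ?D \<beta> x)"
    using i1 i2 by simp
  also have "\<dots> = (LINT x|lebesgue. 2 * real (\<beta> b) * (hermite ?\<gamma> x * hermite (lower b \<beta>) x))"
  proof (rule Bochner_Integration.integral_cong)
    show "(x \<bullet> b) * hermite ?\<gamma> x * hermite \<beta> x + hermite ?\<gamma> x * ?D \<beta> x
        = 2 * real (\<beta> b) * (hermite ?\<gamma> x * hermite (lower b \<beta>) x)" for x
    proof -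
      have "(x \<bullet> b) * hermite ?\<gamma> x * hermite \<beta> x + hermite ?\<gamma> x * ?D \<beta> x
          = hermite ?\<gamma> x * ((x \<bullet> b) * hermite \<beta> x + ?D \<beta> x)" by (simp add: algebra_simps)
      then show ?thesis unfolding hermite_lowering[OF b] by simp
    qed
  qed simp
  finally show ?thesis by simp
qed

text \<open>A ladder step from either side expresses the inner product through the same integral,
  with factors proportional to \<open>\<beta> b\<close> and \<open>\<alpha> b\<close>. If both are
  positive, their being different kills that integral; if exactly one is 0, one step already gives
  0.\<close>

lemma hermite_orthogonal:
  fixes \<alpha> \<beta> :: "'a::euclidean_space \<Rightarrow> nat"
  assumes "\<alpha> \<in> multi_indices" "\<beta> \<in> multi_indices" "\<alpha> \<noteq> \<beta>"
  shows "(LINT x|lebesgue. hermite \<alpha> x * hermite \<beta> x) = 0"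
proof -
  obtain b where b: "b \<in> Basis" "\<alpha> b \<noteq> \<beta> b"
    using assms by (auto simp: multi_indices_def fun_eq_iff) metis
  let ?I = "LINT x|lebesgue. hermite \<alpha> x * hermite \<beta> x"
  let ?J = "LINT x|lebesgue. hermite (lower b \<alpha>) x * hermite (lower b \<beta>) x"
  have 1: "\<alpha> b \<noteq> 0 \<Longrightarrow> ?I = 2 * real (\<beta> b) * ?J" by (rule hermite_inner_ladder[OF b(1)])
  have 2: "\<beta> b \<noteq> 0 \<Longrightarrow> ?I = 2 * real (\<alpha> b) * ?J"
    using hermite_inner_ladder[OF b(1), of \<beta> \<alpha>] by (simp add: mult.commute)
  show ?thesis
  proof (cases "\<alpha> b = 0 \<or> \<beta> b = 0")
    case True
    then show ?thesis using 1 2 b(2) by auto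
  next
    case False
    then have "2 * real (\<beta> b) * ?J = 2 * real (\<alpha> b) * ?J" using 1 2 by presburger
    then have "?J = 0" using b(2) by simp
    then show ?thesis using 1 False by simp
  qed
qed

text \<open>The polar form of gradient plus potential energy. The gradients are separate arguments,
  so bilinearity can be proved without the choice hidden in \<open>weak_gradient\<close>.\<close>

definition energy :: "('a::euclidean_space \<Rightarrow> real) \<Rightarrow> ('a \<Rightarrow> 'a) \<Rightarrow> ('a \<Rightarrow> real) \<Rightarrow> ('a \<Rightarrow> 'a) \<Rightarrow> real" where
  "energy u v u' v' = (LINT x|lebesgue. v x \<bullet> v' x) + (LINT x|lebesgue. (norm x)\<^sup>2 * (u x * u' x))"

text \<open>The eigenvalue of the oscillator at \<open>hermite \<alpha>\<close>.\<close>

definition level :: "('a::euclidean_space \<Rightarrow> nat) \<Rightarrow> real" where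
  "level \<alpha> = (\<Sum>b\<in>Basis. 2 * real (\<alpha> b) + 1)"

text \<open>This is the eigenvalue equation in one coordinate. The second derivative appears as the
  derivative of the ladder formula for the first, so only first derivatives of Hermite functions
  occur.\<close>

lemma hermite_eigen_1d:
  assumes b: "b \<in> Basis"
  shows "real (\<alpha> b) * frechet_derivative (hermite (lower b \<alpha>)) (at x) b
      - frechet_derivative (hermite (raise b \<alpha>)) (at x) b / 2 + (2 * real (\<alpha> b) + 1) * hermite \<alpha> x
    = (x \<bullet> b)\<^sup>2 * hermite \<alpha> x"
proof -
  have "(x \<bullet> b)\<^sup>2 * hermite \<alpha> x = (x \<bullet> b) * (hermite (raise b \<alpha>) x / 2 + real (\<alpha> b) * hermite (lower b \<alpha>) x)"
    unfolding hermite_mult[OF b, symmetric] by (simp add: power2_eq_square)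
  moreover have "(x \<bullet> b) * hermite (raise b \<alpha>) x + frechet_derivative (hermite (raise b \<alpha>)) (at x) b
      = 2 * (real (\<alpha> b) + 1) * hermite \<alpha> x"
    using hermite_lowering[OF b, of x "raise b \<alpha>"] by (simp add: algebra_simps)
  \<comment> \<open>Raising undoes lowering only when \<open>\<alpha> b\<close> is positive;
    otherwise the coefficient is 0.\<close>
  moreover have "real (\<alpha> b) * ((x \<bullet> b) * hermite (lower b \<alpha>) x - frechet_derivative (hermite (lower b \<alpha>)) (at x) b)
      = real (\<alpha> b) * hermite \<alpha> x"
    unfolding hermite_raising[OF b] by (cases "\<alpha> b = 0") auto
  ultimately show ?thesis by (simp add: algebra_simps)
qed

lemma L2_hermite_mult_sq:
  assumes b: "b \<in> Basis"
  shows "(\<lambda>x. (x \<bullet> b)\<^sup>2 * hermite \<alpha> x) \<in> L2_functions"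
proof -
  have "(x \<bullet> b)\<^sup>2 * hermite \<alpha> x
      = 1 / 2 * ((x \<bullet> b) * hermite (raise b \<alpha>) x) + real (\<alpha> b) * ((x \<bullet> b) * hermite (lower b \<alpha>) x)" for x
  proof -
    have "(x \<bullet> b)\<^sup>2 * hermite \<alpha> x = (x \<bullet> b) * (hermite (raise b \<alpha>) x / 2 + real (\<alpha> b) * hermite (lower b \<alpha>) x)"
      unfolding hermite_mult[OF b, symmetric] by (simp add: power2_eq_square)
    then show ?thesis by (simp add: algebra_simps)
  qed
  then show ?thesis
    by (simp only:) (intro L2_add L2_mult_const L2_hermite_mult b)
qed

text \<open>The derivative of a Hermite function is a combination of two Hermite functions, so the
  weak gradient of u can be integrated by parts against it. The coordinate eigenvalue equation then
  collects the terms, and summing over the basis gives the level.\<close>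

lemma energy_hermite:
  fixes u :: "'a::euclidean_space \<Rightarrow> real"
  assumes u: "u \<in> L2_functions" and v: "v \<in> L2_functions" and weak: "has_weak_gradient u v"
  shows "energy u v (hermite \<alpha>) (gradient (hermite \<alpha>)) = level \<alpha> * (LINT x|lebesgue. u x * hermite \<alpha> x)"
proof -
  let ?D = "\<lambda>\<gamma> b x. frechet_derivative (hermite \<gamma>) (at x) b"
  have vb: "(\<lambda>x. v x \<bullet> b) \<in> L2_functions" if "b \<in> Basis" for b by (rule L2_inner_Basis[OF v that])
  have b: "(LINT x|lebesgue. (v x \<bullet> b) * ?D \<alpha> b x) + (LINT x|lebesgue. u x * ((x \<bullet> b)\<^sup>2 * hermite \<alpha> x))
      = (2 * real (\<alpha> b) + 1) * (LINT x|lebesgue. u x * hermite \<alpha> x)" if b: "b \<in> Basis" for b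
  proof -
    have ivh: "integrable lebesgue (\<lambda>x. (v x \<bullet> b) * hermite \<gamma> x)" for \<gamma>
      by (intro L2_mult_integrable vb b L2_hermite)
    have iud: "integrable lebesgue (\<lambda>x. u x * ?D \<gamma> b x)" for \<gamma>
      by (intro L2_mult_integrable u b L2_hermite_derivative)
    have iuh: "integrable lebesgue (\<lambda>x. u x * hermite \<gamma> x)" for \<gamma>
      by (intro L2_mult_integrable u L2_hermite)
    note ibp = weak_gradient_hermite[OF u v weak b]
    have "(LINT x|lebesgue. (v x \<bullet> b) * ?D \<alpha> b x)
        = (LINT x|lebesgue. real (\<alpha> b) * ((v x \<bullet> b) * hermite (lower b \<alpha>) x) - (v x \<bullet> b) * hermite (raise b \<alpha>) x / 2)"
      unfolding hermite_derivative[OF b] by (simp add: algebra_simps)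
    also have "\<dots> = real (\<alpha> b) * (LINT x|lebesgue. (v x \<bullet> b) * hermite (lower b \<alpha>) x)
        - (LINT x|lebesgue. (v x \<bullet> b) * hermite (raise b \<alpha>) x) / 2"
      using ivh by simp
    finally have 1: "(LINT x|lebesgue. (v x \<bullet> b) * ?D \<alpha> b x)
        = - real (\<alpha> b) * (LINT x|lebesgue. u x * ?D (lower b \<alpha>) b x) + (LINT x|lebesgue. u x * ?D (raise b \<alpha>) b x) / 2"
      unfolding ibp by simp
    have "(LINT x|lebesgue. u x * ((x \<bullet> b)\<^sup>2 * hermite \<alpha> x))
        = (LINT x|lebesgue. real (\<alpha> b) * (u x * ?D (lower b \<alpha>) b x) - u x * ?D (raise b \<alpha>) b x / 2
            + (2 * real (\<alpha> b) + 1) * (u x * hermite \<alpha> x))"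
      unfolding hermite_eigen_1d[OF b, symmetric] by (simp add: algebra_simps)
    also have "\<dots> = real (\<alpha> b) * (LINT x|lebesgue. u x * ?D (lower b \<alpha>) b x)
        - (LINT x|lebesgue. u x * ?D (raise b \<alpha>) b x) / 2 + (2 * real (\<alpha> b) + 1) * (LINT x|lebesgue. u x * hermite \<alpha> x)"
      using iud iuh by simp
    finally show ?thesis using 1 by simp
  qed
  have "energy u v (hermite \<alpha>) (gradient (hermite \<alpha>))
      = (\<Sum>b\<in>Basis. (LINT x|lebesgue. (v x \<bullet> b) * ?D \<alpha> b x) + (LINT x|lebesgue. u x * ((x \<bullet> b)\<^sup>2 * hermite \<alpha> x)))"
  proof -
    have "(LINT x|lebesgue. v x \<bullet> gradient (hermite \<alpha>) x) = (\<Sum>b\<in>Basis. LINT x|lebesgue. (v x \<bullet> b) * ?D \<alpha> b x)"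
      unfolding gradient_def inner_sum_right inner_scaleR_right
      by (subst Bochner_Integration.integral_sum)
        (auto simp: mult.commute intro: L2_mult_integrable vb L2_hermite_derivative)
    moreover have "(LINT x|lebesgue. (norm x)\<^sup>2 * (u x * hermite \<alpha> x)) = (\<Sum>b\<in>Basis. LINT x|lebesgue. u x * ((x \<bullet> b)\<^sup>2 * hermite \<alpha> x))"
      unfolding norm_sq_eq_sum_Basis sum_distrib_right
      by (subst Bochner_Integration.integral_sum[symmetric])
        (auto simp: mult.left_commute intro: L2_mult_integrable u L2_hermite_mult_sq)
    ultimately show ?thesis by (simp add: energy_def sum.distrib)
  qed
  also have "\<dots> = level \<alpha> * (LINT x|lebesgue. u x * hermite \<alpha> x)"
    unfolding level_def sum_distrib_right using b by simp
  finally show ?thesis .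
qed

section \<open>Completeness of the Hermite functions\<close>

definition hermite_span :: "('a::euclidean_space \<Rightarrow> real) set" where
  "hermite_span = {f. \<exists>F c. finite F \<and> F \<subseteq> multi_indices \<and> f = (\<lambda>x. \<Sum>\<alpha>\<in>F. c \<alpha> * hermite \<alpha> x)}"

section \<open>Finite Hermite sums\<close>

lemma hermite_spanI:
  "finite F \<Longrightarrow> F \<subseteq> multi_indices \<Longrightarrow> (\<lambda>x. \<Sum>\<alpha>\<in>F. c \<alpha> * hermite \<alpha> x) \<in> hermite_span"
  unfolding hermite_span_def by blast

lemma hermite_span_hermite: "\<alpha> \<in> multi_indices \<Longrightarrow> hermite \<alpha> \<in> hermite_span"
  using hermite_spanI[of "{\<alpha>}" "\<lambda>_. 1"] by simp

lemma hermite_span_zero: "(\<lambda>x. 0) \<in> hermite_span"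
  using hermite_spanI[of "{}"] by simp

lemma hermite_span_scale:
  assumes "f \<in> hermite_span"
  shows "(\<lambda>x. k * f x) \<in> hermite_span"
proof -
  obtain F c where F: "finite F" "F \<subseteq> multi_indices" "f = (\<lambda>x. \<Sum>\<alpha>\<in>F. c \<alpha> * hermite \<alpha> x)"
    using assms unfolding hermite_span_def by blast
  then show ?thesis
    using hermite_spanI[OF F(1,2), of "\<lambda>\<alpha>. k * c \<alpha>"] by (simp add: sum_distrib_left mult.assoc)
qed

lemma hermite_span_add:
  assumes "f \<in> hermite_span" "g \<in> hermite_span"
  shows "(\<lambda>x. f x + g x) \<in> hermite_span"
proof -
  obtain F c where F: "finite F" "F \<subseteq> multi_indices" "f = (\<lambda>x. \<Sum>\<alpha>\<in>F. c \<alpha> * hermite \<alpha> x)"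
    using assms unfolding hermite_span_def by blast
  obtain G d where G: "finite G" "G \<subseteq> multi_indices" "g = (\<lambda>x. \<Sum>\<alpha>\<in>G. d \<alpha> * hermite \<alpha> x)"
    using assms unfolding hermite_span_def by blast
  have 1: "(\<Sum>\<alpha>\<in>F. c \<alpha> * hermite \<alpha> x) = (\<Sum>\<alpha>\<in>F \<union> G. (if \<alpha> \<in> F then c \<alpha> else 0) * hermite \<alpha> x)" for x
    using F(1) G(1) by (intro sum.mono_neutral_cong_left) auto
  have 2: "(\<Sum>\<alpha>\<in>G. d \<alpha> * hermite \<alpha> x) = (\<Sum>\<alpha>\<in>F \<union> G. (if \<alpha> \<in> G then d \<alpha> else 0) * hermite \<alpha> x)" for x
    using F(1) G(1) by (intro sum.mono_neutral_cong_left) auto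
  have "(\<lambda>x. f x + g x) = (\<lambda>x. \<Sum>\<alpha>\<in>F \<union> G. ((if \<alpha> \<in> F then c \<alpha> else 0) + (if \<alpha> \<in> G then d \<alpha> else 0)) * hermite \<alpha> x)"
    unfolding F(3) G(3) 1 2 by (simp only: sum.distrib distrib_right)
  then show ?thesis
    using F(1,2) G(1,2) by (simp only:) (intro hermite_spanI, auto)
qed

lemma hermite_span_sum:
  "(\<And>i. i \<in> I \<Longrightarrow> f i \<in> hermite_span) \<Longrightarrow> (\<lambda>x. \<Sum>i\<in>I. f i x) \<in> hermite_span"
  by (induction I rule: infinite_finite_induct) (auto intro: hermite_span_add hermite_span_zero)

lemma hermite_span_mult_inner:
  assumes b: "b \<in> Basis" and "f \<in> hermite_span"
  shows "(\<lambda>x. (x \<bullet> b) * f x) \<in> hermite_span"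
proof -
  obtain F c where F: "finite F" "F \<subseteq> multi_indices" "f = (\<lambda>x. \<Sum>\<alpha>\<in>F. c \<alpha> * hermite \<alpha> x)"
    using assms unfolding hermite_span_def by blast
  have "(\<lambda>x. (x \<bullet> b) * hermite \<alpha> x) \<in> hermite_span" if "\<alpha> \<in> F" for \<alpha>
  proof -
    have "(\<lambda>x. 1/2 * hermite (raise b \<alpha>) x + real (\<alpha> b) * hermite (lower b \<alpha>) x) \<in> hermite_span"
      using F(2) that b
      by (intro hermite_span_add hermite_span_scale hermite_span_hermite) auto
    then show ?thesis unfolding hermite_mult[OF b] by simp
  qed
  then have "(\<lambda>x. \<Sum>\<alpha>\<in>F. c \<alpha> * ((x \<bullet> b) * hermite \<alpha> x)) \<in> hermite_span"
    by (intro hermite_span_sum hermite_span_scale)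
  then show ?thesis
    unfolding F(3) by (simp add: sum_distrib_left mult.left_commute)
qed

lemma hermite_span_mult_power:
  assumes b: "b \<in> Basis" and f: "f \<in> hermite_span"
  shows "(\<lambda>x. (a * (x \<bullet> b - c)) ^ k * f x) \<in> hermite_span"
proof (induction k)
  case 0
  show ?case using f by simp
next
  case (Suc k)
  let ?g = "\<lambda>x. (a * (x \<bullet> b - c)) ^ k * f x"
  have "(\<lambda>x. a * ((x \<bullet> b) * ?g x) + (- a * c) * ?g x) \<in> hermite_span"
    by (intro hermite_span_add hermite_span_scale hermite_span_mult_inner b Suc)
  then show ?case by (simp add: algebra_simps)
qed

lemma hermite_span_bound:
  assumes "f \<in> hermite_span"
  shows "\<exists>C\<ge>0. \<forall>x. \<bar>f x\<bar> \<le> C * exp (- (1/4) * (norm x)\<^sup>2)"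
proof -
  obtain F c where F: "finite F" "f = (\<lambda>x. \<Sum>\<alpha>\<in>F. c \<alpha> * hermite \<alpha> x)"
    using assms unfolding hermite_span_def by blast
  obtain C where C: "\<And>\<alpha>::'a \<Rightarrow> nat. C \<alpha> \<ge> 0" "\<And>(\<alpha>::'a \<Rightarrow> nat) x. \<bar>hermite \<alpha> x\<bar> \<le> C \<alpha> * exp (- (1/4) * (norm x)\<^sup>2)"
    using hermite_bound by metis
  have "\<bar>f x\<bar> \<le> (\<Sum>\<alpha>\<in>F. \<bar>c \<alpha>\<bar> * C \<alpha>) * exp (- (1/4) * (norm x)\<^sup>2)" for x
  proof -
    have "\<bar>f x\<bar> \<le> (\<Sum>\<alpha>\<in>F. \<bar>c \<alpha>\<bar> * (C \<alpha> * exp (- (1/4) * (norm x)\<^sup>2)))"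
      unfolding F(2) by (rule order.trans[OF sum_abs], rule sum_mono, unfold abs_mult)
        (intro mult_left_mono C(2) abs_ge_zero)
    then show ?thesis by (simp add: sum_distrib_right mult.assoc)
  qed
  then show ?thesis
    using C(1) by (intro exI[of _ "\<Sum>\<alpha>\<in>F. \<bar>c \<alpha>\<bar> * C \<alpha>"]) (auto intro!: sum_nonneg mult_nonneg_nonneg)
qed

lemma hermite_span_L2: "f \<in> hermite_span \<Longrightarrow> f \<in> L2_functions"
  unfolding hermite_span_def by (auto intro!: L2_sum L2_mult_const L2_hermite)

definition hermite_closure :: "('a::euclidean_space \<Rightarrow> real) set" where
  "hermite_closure = {f \<in> L2_functions. \<forall>e>0. \<exists>s\<in>hermite_span. (LINT x|lebesgue. (f x - s x)\<^sup>2) < e}"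

section \<open>The closure of the Hermite sums in L^2\<close>

lemma hermite_closure_L2: "f \<in> hermite_closure \<Longrightarrow> f \<in> L2_functions"
  by (simp add: hermite_closure_def)

lemma hermite_closure_span: "f \<in> hermite_span \<Longrightarrow> f \<in> hermite_closure"
  by (auto simp: hermite_closure_def hermite_span_L2 intro!: bexI[of _ f])

lemma integrable_diff_square:
  fixes f g :: "'a::euclidean_space \<Rightarrow> real"
  shows "f \<in> L2_functions \<Longrightarrow> g \<in> L2_functions \<Longrightarrow> integrable lebesgue (\<lambda>x. (f x - g x)\<^sup>2)"
  by (intro L2_integrable_square L2_diff)

lemma L2_sum_square_le:
  fixes f g h :: "'a::euclidean_space \<Rightarrow> real"
  assumes "f \<in> L2_functions" "g \<in> L2_functions" "h \<in> L2_functions"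
    and "\<And>x. h x = f x + g x"
  shows "(LINT x|lebesgue. (h x)\<^sup>2) \<le> 2 * (LINT x|lebesgue. (f x)\<^sup>2) + 2 * (LINT x|lebesgue. (g x)\<^sup>2)"
proof -
  have "(LINT x|lebesgue. (h x)\<^sup>2) \<le> (LINT x|lebesgue. 2 * (f x)\<^sup>2 + 2 * (g x)\<^sup>2)"
  proof (rule integral_mono)
    show "(h x)\<^sup>2 \<le> 2 * (f x)\<^sup>2 + 2 * (g x)\<^sup>2" for x
      using sum_squares_bound[of "f x" "g x"] unfolding assms(4) by (simp add: power2_sum)
  qed (intro L2_integrable_square Bochner_Integration.integrable_add integrable_mult_right assms)+
  then show ?thesis using assms by (simp add: L2_integrable_square)
qed

lemma hermite_closure_closed:
  assumes f: "f \<in> L2_functions"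
    and approx: "\<And>e. e > 0 \<Longrightarrow> \<exists>g\<in>hermite_closure. (LINT x|lebesgue. (f x - g x)\<^sup>2) < e"
  shows "f \<in> hermite_closure"
  unfolding hermite_closure_def
proof (safe intro!: f)
  fix e :: real assume "e > 0"
  then obtain g where g: "g \<in> hermite_closure" "(LINT x|lebesgue. (f x - g x)\<^sup>2) < e / 4"
    using approx[of "e / 4"] by auto
  then obtain s where s: "s \<in> hermite_span" "(LINT x|lebesgue. (g x - s x)\<^sup>2) < e / 4"
    using \<open>e > 0\<close> unfolding hermite_closure_def by (auto dest: spec[of _ "e / 4"])
  have "(LINT x|lebesgue. (f x - s x)\<^sup>2)
      \<le> 2 * (LINT x|lebesgue. (f x - g x)\<^sup>2) + 2 * (LINT x|lebesgue. (g x - s x)\<^sup>2)"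
    by (intro L2_sum_square_le L2_diff f hermite_closure_L2[OF g(1)] hermite_span_L2[OF s(1)]) simp
  then show "\<exists>s\<in>hermite_span. (LINT x|lebesgue. (f x - s x)\<^sup>2) < e"
    using g(2) s by (intro bexI[of _ s]) auto
qed

lemma hermite_closure_add:
  assumes f: "f \<in> hermite_closure" and g: "g \<in> hermite_closure"
  shows "(\<lambda>x. f x + g x) \<in> hermite_closure"
proof (rule hermite_closure_closed)
  fix e :: real assume "e > 0"
  obtain s where s: "s \<in> hermite_span" "(LINT x|lebesgue. (f x - s x)\<^sup>2) < e / 4"
    using f \<open>e > 0\<close> unfolding hermite_closure_def by (auto dest: spec[of _ "e / 4"])
  obtain t where t: "t \<in> hermite_span" "(LINT x|lebesgue. (g x - t x)\<^sup>2) < e / 4"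
    using g \<open>e > 0\<close> unfolding hermite_closure_def by (auto dest: spec[of _ "e / 4"])
  have "(LINT x|lebesgue. (f x + g x - (s x + t x))\<^sup>2)
      \<le> 2 * (LINT x|lebesgue. (f x - s x)\<^sup>2) + 2 * (LINT x|lebesgue. (g x - t x)\<^sup>2)"
    by (intro L2_sum_square_le L2_diff L2_add hermite_closure_L2[OF f] hermite_closure_L2[OF g]
        hermite_span_L2[OF s(1)] hermite_span_L2[OF t(1)]) simp
  then show "\<exists>h\<in>hermite_closure. (LINT x|lebesgue. (f x + g x - h x)\<^sup>2) < e"
    using s t by (intro bexI[of _ "\<lambda>x. s x + t x"] hermite_closure_span hermite_span_add) auto
qed (intro L2_add hermite_closure_L2 f g)

text \<open>Squared differences are at most 4 w^2, so dominated convergence turns pointwise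
  convergence into convergence in L^2. Every limit in the completeness proof passes through this
  form.\<close>

lemma hermite_closure_dominated:
  fixes f :: "'a::euclidean_space \<Rightarrow> real"
  assumes g: "\<And>n. g n \<in> hermite_closure" and w: "w \<in> L2_functions"
    and lim: "AE x in lebesgue. (\<lambda>n::nat. g n x) \<longlonglongrightarrow> f x"
    and bound: "\<And>n x. \<bar>g n x\<bar> \<le> w x" "\<And>x. \<bar>f x\<bar> \<le> w x"
    and f: "f \<in> borel_measurable lebesgue"
  shows "f \<in> hermite_closure"
proof (rule hermite_closure_closed)
  have gm: "g n \<in> borel_measurable lebesgue" for n
    by (intro L2_measurable hermite_closure_L2 g)
  show "f \<in> L2_functions"
    by (rule L2_dominated[OF w f, of 1]) (simp add: order.trans[OF bound(2) abs_ge_self])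
  have "(\<lambda>n. LINT x|lebesgue. (f x - g n x)\<^sup>2) \<longlonglongrightarrow> (LINT x|(lebesgue :: 'a measure). (0::real))"
  proof (rule integral_dominated_convergence)
    show "integrable lebesgue (\<lambda>x. 4 * (w x)\<^sup>2)"
      by (intro integrable_mult_right L2_integrable_square w)
    show "AE x in lebesgue. (\<lambda>n. (f x - g n x)\<^sup>2) \<longlonglongrightarrow> 0"
      using lim
    proof eventually_elim
      case (elim x)
      then have "(\<lambda>n. (f x - g n x)\<^sup>2) \<longlonglongrightarrow> (f x - f x)\<^sup>2" by (intro tendsto_intros)
      then show ?case by simp
    qed
    show "AE x in lebesgue. norm ((f x - g n x)\<^sup>2) \<le> 4 * (w x)\<^sup>2" for n
    proof (rule AE_I2)
      fix x
      have "\<bar>f x - g n x\<bar> \<le> 2 * w x" using bound(1)[of n x] bound(2)[of x] by linarith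
      then have "(f x - g n x)\<^sup>2 \<le> (2 * w x)\<^sup>2" by (intro power2_le_iff_abs_le[THEN iffD2]) auto
      then show "norm ((f x - g n x)\<^sup>2) \<le> 4 * (w x)\<^sup>2" by (simp add: power_mult_distrib)
    qed
    show "(\<lambda>x. (f x - g n x)\<^sup>2) \<in> borel_measurable lebesgue" for n
      by (intro borel_measurable_power borel_measurable_diff f gm)
  qed simp
  then have lim0: "(\<lambda>n. LINT x|lebesgue. (f x - g n x)\<^sup>2) \<longlonglongrightarrow> 0" by simp
  fix e :: real assume "e > 0"
  with lim0 have "\<forall>\<^sub>F n in sequentially. (LINT x|lebesgue. (f x - g n x)\<^sup>2) < e"
    by (rule order_tendstoD)
  then show "\<exists>h\<in>hermite_closure. (LINT x|lebesgue. (f x - h x)\<^sup>2) < e"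
    using g eventually_happens'[OF sequentially_bot] by blast
qed

text \<open>These functions form an algebra closed under uniformly bounded pointwise limits, which
  turns completeness into a question about generators of a sigma-algebra. Boundedness keeps products
  in L^2.\<close>

definition multipliers :: "('a::euclidean_space \<Rightarrow> real) set" where
  "multipliers = {m \<in> borel_measurable lebesgue. (\<exists>B. \<forall>x. \<bar>m x\<bar> \<le> B)
     \<and> (\<forall>f\<in>hermite_closure. (\<lambda>x. m x * f x) \<in> hermite_closure)}"

lemma multipliersD:
  assumes "m \<in> multipliers"
  shows multipliers_measurable: "m \<in> borel_measurable lebesgue"
    and multipliers_mult: "f \<in> hermite_closure \<Longrightarrow> (\<lambda>x. m x * f x) \<in> hermite_closure"
  using assms unfolding multipliers_def by blast+

text \<open>Almost everywhere convergence is what later leads from Borel to Lebesgue sets. The bound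
  on l is a separate hypothesis because such a limit need not inherit it at every point.\<close>

lemma multipliers_limit:
  assumes m: "\<And>n. m n \<in> multipliers" and bound: "\<And>n x. \<bar>m n x\<bar> \<le> B" "\<And>x. \<bar>l x\<bar> \<le> B"
    and lim: "AE x in lebesgue. (\<lambda>n::nat. m n x) \<longlonglongrightarrow> l x" and l: "l \<in> borel_measurable lebesgue"
  shows "l \<in> multipliers"
  unfolding multipliers_def
proof (safe intro!: l)
  show "\<exists>B. \<forall>x. \<bar>l x\<bar> \<le> B" using bound by blast
next
  fix f :: "'a \<Rightarrow> real" assume f: "f \<in> hermite_closure"
  show "(\<lambda>x. l x * f x) \<in> hermite_closure"
  proof (rule hermite_closure_dominated)
    show "(\<lambda>x. m n x * f x) \<in> hermite_closure" for n by (rule multipliers_mult[OF m f])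
    have "B \<ge> 0" using bound(2)[of undefined] by linarith
    then show "(\<lambda>x. B * \<bar>f x\<bar>) \<in> L2_functions"
      by (intro L2_dominated[OF hermite_closure_L2[OF f], of _ B] borel_measurable_times
          borel_measurable_const borel_measurable_abs L2_measurable[OF hermite_closure_L2[OF f]])
        (simp add: abs_mult)
    show "AE x in lebesgue. (\<lambda>n. m n x * f x) \<longlonglongrightarrow> l x * f x"
      using lim by eventually_elim (intro tendsto_intros)
    show "(\<lambda>x. l x * f x) \<in> borel_measurable lebesgue"
      by (intro borel_measurable_times l L2_measurable hermite_closure_L2 f)
    show "\<bar>m n x * f x\<bar> \<le> B * \<bar>f x\<bar>" for n x
      unfolding abs_mult by (intro mult_right_mono bound abs_ge_zero)
    show "\<bar>l x * f x\<bar> \<le> B * \<bar>f x\<bar>" for x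
      unfolding abs_mult by (intro mult_right_mono bound abs_ge_zero)
  qed
qed

lemma multipliers_pointwise_limit:
  assumes m: "\<And>n. m n \<in> multipliers" and bound: "\<And>n x. \<bar>m n x\<bar> \<le> B"
    and lim: "\<And>x. (\<lambda>n::nat. m n x) \<longlonglongrightarrow> l x"
  shows "l \<in> multipliers"
proof (rule multipliers_limit[OF m bound])
  show "\<bar>l x\<bar> \<le> B" for x
    using bound by (intro tendsto_upperbound[OF tendsto_rabs[OF lim]] always_eventually) auto
  show "l \<in> borel_measurable lebesgue"
    by (rule borel_measurable_LIMSEQ_real[OF lim multipliers_measurable[OF m]])
  show "AE x in lebesgue. (\<lambda>n. m n x) \<longlonglongrightarrow> l x"
    by (rule AE_I2[OF lim])
qed

lemma hermite_closure_scale: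
  assumes f: "f \<in> hermite_closure"
  shows "(\<lambda>x. k * f x) \<in> hermite_closure"
proof (rule hermite_closure_closed)
  fix e :: real assume "e > 0"
  have k: "k\<^sup>2 + 1 > 0" by (smt (verit) zero_le_power2)
  obtain s where s: "s \<in> hermite_span" "(LINT x|lebesgue. (f x - s x)\<^sup>2) < e / (k\<^sup>2 + 1)"
    using f \<open>e > 0\<close> k unfolding hermite_closure_def by (auto dest: spec[of _ "e / (k\<^sup>2 + 1)"])
  have "(LINT x|lebesgue. (k * f x - k * s x)\<^sup>2) = k\<^sup>2 * (LINT x|lebesgue. (f x - s x)\<^sup>2)"
    unfolding right_diff_distrib[of k, symmetric] power_mult_distrib by simp
  also have "\<dots> \<le> (k\<^sup>2 + 1) * (LINT x|lebesgue. (f x - s x)\<^sup>2)"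
    by (intro mult_right_mono integral_nonneg) auto
  also have "\<dots> < e" using s(2) k by (simp add: pos_less_divide_eq mult.commute)
  finally show "\<exists>h\<in>hermite_closure. (LINT x|lebesgue. (k * f x - h x)\<^sup>2) < e"
    using s(1) by (intro bexI[of _ "\<lambda>x. k * s x"] hermite_closure_span hermite_span_scale)
qed (intro L2_mult_const hermite_closure_L2 f)

lemma hermite_closure_sum:
  "(\<And>i. i \<in> I \<Longrightarrow> f i \<in> hermite_closure) \<Longrightarrow> (\<lambda>x. \<Sum>i\<in>I. f i x) \<in> hermite_closure"
  by (induction I rule: infinite_finite_induct)
    (simp_all add: hermite_closure_add hermite_closure_span[OF hermite_span_zero])

lemma multipliers_const: "(\<lambda>x. c) \<in> multipliers"
  unfolding multipliers_def
proof (safe intro!: hermite_closure_scale)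
  show "\<exists>B. \<forall>x. \<bar>c\<bar> \<le> B" by blast
qed simp

lemma multipliers_add:
  assumes "m \<in> multipliers" "n \<in> multipliers"
  shows "(\<lambda>x. m x + n x) \<in> multipliers"
proof -
  obtain A B where "\<And>x. \<bar>m x\<bar> \<le> A" "\<And>x. \<bar>n x\<bar> \<le> B"
    using assms unfolding multipliers_def by blast
  then have "\<bar>m x + n x\<bar> \<le> A + B" for x
    by (intro order.trans[OF abs_triangle_ineq] add_mono)
  then show ?thesis
    using assms unfolding multipliers_def
    by (simp add: distrib_right hermite_closure_add borel_measurable_add) blast
qed

lemma multipliers_times:
  assumes "m \<in> multipliers" "n \<in> multipliers"
  shows "(\<lambda>x. m x * n x) \<in> multipliers"
proof -
  obtain A B where AB: "\<And>x. \<bar>m x\<bar> \<le> A" "\<And>x. \<bar>n x\<bar> \<le> B"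
    using assms unfolding multipliers_def by blast
  have "\<bar>m x * n x\<bar> \<le> A * B" for x
    unfolding abs_mult using AB(1)[of x] AB(2)[of x] by (intro mult_mono) auto
  then show ?thesis
    using assms unfolding multipliers_def by (simp add: mult.assoc borel_measurable_times) blast
qed

lemma multipliers_scale: "m \<in> multipliers \<Longrightarrow> (\<lambda>x. c * m x) \<in> multipliers"
  using multipliers_times[OF multipliers_const] .

lemma multipliers_diff:
  "m \<in> multipliers \<Longrightarrow> n \<in> multipliers \<Longrightarrow> (\<lambda>x. m x - n x) \<in> multipliers"
  using multipliers_add[of m "\<lambda>x. - 1 * n x"] multipliers_scale[of n "- 1"] by simp

lemma multipliers_power: "m \<in> multipliers \<Longrightarrow> (\<lambda>x. m x ^ k) \<in> multipliers"
proof (induction k)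
  case 0
  show ?case unfolding power_0 by (rule multipliers_const)
next
  case (Suc k)
  show ?case unfolding power_Suc by (rule multipliers_times[OF Suc.prems Suc.IH[OF Suc.prems]])
qed

section \<open>From sine multipliers to completeness\<close>

lemma sin_partial_sum_bound: "\<bar>\<Sum>k<n. sin_coeff k * y ^ k\<bar> \<le> exp \<bar>y\<bar>"
proof -
  have "\<bar>\<Sum>k<n. sin_coeff k * y ^ k\<bar> \<le> (\<Sum>k<n. \<bar>y\<bar> ^ k /\<^sub>R fact k)"
    by (rule order.trans[OF sum_abs])
      (auto intro!: sum_mono simp: abs_mult sin_coeff_def power_abs divide_simps)
  also have "\<dots> \<le> exp \<bar>y\<bar>"
    unfolding exp_def by (intro sum_le_suminf summable_exp_generic) auto
  finally show ?thesis .
qed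

text \<open>Partial sums of the sine series times s are again Hermite sums. All of them lie below
  exp \<bar>a (x_b - c)\<bar> \<bar>s\<bar>, which is still square integrable because the Gaussian
  decay of s beats exponential growth.\<close>

lemma hermite_closure_sin_mult_span:
  assumes b: "b \<in> Basis" and s: "s \<in> hermite_span"
  shows "(\<lambda>x. sin (a * (x \<bullet> b - c)) * s x) \<in> hermite_closure"
proof -
  obtain C where C: "C \<ge> 0" "\<And>x. \<bar>s x\<bar> \<le> C * exp (- (1/4) * (norm x)\<^sup>2)"
    using hermite_span_bound[OF s] by blast
  define K where "K = C * exp (2 * a\<^sup>2 + \<bar>a * c\<bar>)"
  have growth: "exp \<bar>a * (x \<bullet> b - c)\<bar> * \<bar>s x\<bar> \<le> K * exp (- (1/8) * (norm x)\<^sup>2)" for x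
  proof -
    have "\<bar>a * (x \<bullet> b - c)\<bar> \<le> \<bar>a\<bar> * norm x + \<bar>a * c\<bar>"
    proof -
      have "\<bar>a * (x \<bullet> b - c)\<bar> \<le> \<bar>a\<bar> * \<bar>x \<bullet> b\<bar> + \<bar>a * c\<bar>"
        unfolding right_diff_distrib abs_mult[symmetric] by (rule abs_triangle_ineq4)
      moreover have "\<bar>a\<bar> * \<bar>x \<bullet> b\<bar> \<le> \<bar>a\<bar> * norm x"
        by (intro mult_left_mono Basis_le_norm b) auto
      ultimately show ?thesis by linarith
    qed
    \<comment> \<open>Completing the square of norm x / 4 - \<bar>a\<bar> spends half of the decay
      exponent 1/4 of s; the constant 2 a^2 is absorbed in K.\<close>
    also have "\<bar>a\<bar> * norm x \<le> (1/8) * (norm x)\<^sup>2 + 2 * a\<^sup>2"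
      using zero_le_power2[of "norm x / 4 - \<bar>a\<bar>"]
      by (simp add: power2_diff power_divide mult.commute)
    finally have "\<bar>a * (x \<bullet> b - c)\<bar> \<le> (1/8) * (norm x)\<^sup>2 + 2 * a\<^sup>2 + \<bar>a * c\<bar>" by simp
    then have "exp \<bar>a * (x \<bullet> b - c)\<bar> * exp (- (1/4) * (norm x)\<^sup>2)
        \<le> exp (2 * a\<^sup>2 + \<bar>a * c\<bar>) * exp (- (1/8) * (norm x)\<^sup>2)"
      by (simp flip: exp_add)
    from mult_left_mono[OF this C(1)] have "exp \<bar>a * (x \<bullet> b - c)\<bar> * (C * exp (- (1/4) * (norm x)\<^sup>2))
        \<le> K * exp (- (1/8) * (norm x)\<^sup>2)"
      by (simp add: K_def mult.left_commute mult.assoc)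
    with mult_left_mono[OF C(2)[of x] exp_ge_zero, of "\<bar>a * (x \<bullet> b - c)\<bar>"]
    show ?thesis by (rule order.trans)
  qed
  show ?thesis
  proof (rule hermite_closure_dominated[where
        g = "\<lambda>n x. (\<Sum>k<n. sin_coeff k * (a * (x \<bullet> b - c)) ^ k) * s x" and
        w = "\<lambda>x. K * exp (- (1/8) * (norm x)\<^sup>2)"])
    show "(\<lambda>x. (\<Sum>k<n. sin_coeff k * (a * (x \<bullet> b - c)) ^ k) * s x) \<in> hermite_closure" for n
      unfolding sum_distrib_right mult.assoc[of "sin_coeff _"]
      by (intro hermite_closure_span hermite_span_sum hermite_span_scale hermite_span_mult_power b s)
    show "(\<lambda>x::'a. K * exp (- (1/8) * (norm x)\<^sup>2)) \<in> L2_functions"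
      by (intro L2_mult_const L2_gaussian_decay) simp
    show "AE x in lebesgue. (\<lambda>n. (\<Sum>k<n. sin_coeff k * (a * (x \<bullet> b - c)) ^ k) * s x)
        \<longlonglongrightarrow> sin (a * (x \<bullet> b - c)) * s x"
      using sin_converges[of "a * (_ \<bullet> b - c)"] unfolding sums_def real_scaleR_def
      by (intro AE_I2 tendsto_mult_right)
    show "\<bar>(\<Sum>k<n. sin_coeff k * (a * (x \<bullet> b - c)) ^ k) * s x\<bar> \<le> K * exp (- (1/8) * (norm x)\<^sup>2)" for n x
    proof (rule order.trans[OF _ growth])
      show "\<bar>(\<Sum>k<n. sin_coeff k * (a * (x \<bullet> b - c)) ^ k) * s x\<bar> \<le> exp \<bar>a * (x \<bullet> b - c)\<bar> * \<bar>s x\<bar>"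
        by (subst abs_mult) (intro mult_right_mono sin_partial_sum_bound abs_ge_zero)
    qed
    show "\<bar>sin (a * (x \<bullet> b - c)) * s x\<bar> \<le> K * exp (- (1/8) * (norm x)\<^sup>2)" for x
    proof (rule order.trans[OF _ growth])
      have "\<bar>sin (a * (x \<bullet> b - c))\<bar> \<le> exp \<bar>a * (x \<bullet> b - c)\<bar>"
        by (rule order.trans[OF abs_sin_le_one]) simp
      then show "\<bar>sin (a * (x \<bullet> b - c)) * s x\<bar> \<le> exp \<bar>a * (x \<bullet> b - c)\<bar> * \<bar>s x\<bar>"
        by (subst abs_mult) (intro mult_right_mono abs_ge_zero)
    qed
    have "(\<lambda>x. sin (a * (x \<bullet> b - c))) \<in> borel_measurable lebesgue"
      by (intro lebesgue_measurable_lborel) measurable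
    then show "(\<lambda>x. sin (a * (x \<bullet> b - c)) * s x) \<in> borel_measurable lebesgue"
      by (intro borel_measurable_times L2_measurable[OF hermite_span_L2[OF s]])
  qed
qed

text \<open>Since the sine is bounded by 1, multiplication does not increase L^2 distances, and the
  result for Hermite sums extends to their closure.\<close>

lemma multipliers_sin:
  assumes b: "b \<in> Basis"
  shows "(\<lambda>x. sin (a * (x \<bullet> b - c))) \<in> multipliers"
  unfolding multipliers_def
proof safe
  let ?m = "\<lambda>x. sin (a * (x \<bullet> b - c))"
  show m: "?m \<in> borel_measurable lebesgue"
    by (intro lebesgue_measurable_lborel) measurable
  show "\<exists>B. \<forall>x. \<bar>?m x\<bar> \<le> B" using abs_sin_le_one by blast
  fix f :: "'a \<Rightarrow> real" assume f: "f \<in> hermite_closure"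
  have L2: "(\<lambda>x. ?m x * g x) \<in> L2_functions" if "g \<in> L2_functions" for g
    by (intro L2_dominated[OF that, of _ 1] borel_measurable_times m L2_measurable[OF that])
      (simp add: abs_mult mult_left_le_one_le)
  show "(\<lambda>x. ?m x * f x) \<in> hermite_closure"
  proof (rule hermite_closure_closed)
    fix e :: real assume "e > 0"
    then obtain s where s: "s \<in> hermite_span" "(LINT x|lebesgue. (f x - s x)\<^sup>2) < e"
      using f unfolding hermite_closure_def by blast
    have "(LINT x|lebesgue. (?m x * f x - ?m x * s x)\<^sup>2) \<le> (LINT x|lebesgue. (f x - s x)\<^sup>2)"
    proof (rule integral_mono)
      show "(?m x * f x - ?m x * s x)\<^sup>2 \<le> (f x - s x)\<^sup>2" for x
      proof -
        have "(?m x)\<^sup>2 * (f x - s x)\<^sup>2 \<le> 1 * (f x - s x)\<^sup>2"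
          by (intro mult_right_mono) (auto simp: abs_square_le_1 abs_sin_le_one)
        then show ?thesis
          unfolding right_diff_distrib[of "?m x", symmetric] power_mult_distrib by simp
      qed
    qed (intro integrable_diff_square L2 hermite_closure_L2[OF f] hermite_span_L2[OF s(1)])+
    with s(2) show "\<exists>h\<in>hermite_closure. (LINT x|lebesgue. (?m x * f x - h x)\<^sup>2) < e"
      by (intro bexI[of _ "\<lambda>x. ?m x * s x"] hermite_closure_sin_mult_span b s(1)) auto
  qed (intro L2 hermite_closure_L2 f)
qed

text \<open>The value at 1/2 is the limit of (1 - 1/2^n)^(2^n), which is what the power construction
  below produces there.\<close>

definition step :: "real \<Rightarrow> real" where
  "step t = (if t < 1/2 then 1 else if t = 1/2 then exp (-1) else 0)"

text \<open>Powers alone turn a multiplier with values in \<open>[0, 1]\<close> into a step function of it,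
  so no polynomial approximation theorem is needed.\<close>

lemma power_power_tendsto_step:
  fixes t :: real
  assumes "0 \<le> t" "t \<le> 1"
  shows "(\<lambda>n. (1 - t ^ n) ^ (2 ^ n)) \<longlonglongrightarrow> step t"
proof -
  consider "t < 1/2" | "t = 1/2" | "t > 1/2" by linarith
  then show ?thesis
  proof cases
    case 1
    have "(\<lambda>n. 1 - (2 * t) ^ n) \<longlonglongrightarrow> 1 - 0"
      using 1 assms by (intro tendsto_intros LIMSEQ_power_zero) auto
    then have lim: "(\<lambda>n. 1 - (2 * t) ^ n) \<longlonglongrightarrow> 1" by simp
    \<comment> \<open>Bernoulli's inequality with exponent 2^n: the correction 2^n t^n equals (2
      t)^n, which tends to 0 for t < 1/2.\<close>
    have lower: "1 - (2 * t) ^ n \<le> (1 - t ^ n) ^ (2 ^ n)" for n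
      using Bernoulli_inequality[of "- (t ^ n)" "2 ^ n"] power_le_one[OF assms, of n]
      by (simp add: power_mult_distrib)
    have upper: "(1 - t ^ n) ^ (2 ^ n) \<le> 1" for n
      using zero_le_power[OF assms(1), of n] power_le_one[OF assms, of n]
      by (intro power_le_one) linarith+
    have "step t = 1" using 1 by (simp add: step_def)
    then show ?thesis
      using tendsto_sandwich[OF always_eventually[OF allI[OF lower]] always_eventually[OF allI[OF upper]]
          lim tendsto_const] by (simp only:)
  next
    case 2
    have "(\<lambda>n. (1 + (-1) / real (2 ^ n)) ^ (2 ^ n)) \<longlonglongrightarrow> exp (-1)"
    proof (rule filterlim_compose[OF tendsto_exp_limit_sequentially[of "-1"]])
      show "filterlim (\<lambda>n::nat. (2::nat) ^ n) at_top sequentially"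
        by (rule filterlim_subseq) (simp add: strict_mono_def)
    qed
    then show ?thesis unfolding 2 by (simp add: step_def power_divide)
  next
    case 3
    have lim: "(\<lambda>n. (1 / (2 * t)) ^ n) \<longlonglongrightarrow> 0"
      using 3 by (intro LIMSEQ_power_zero) simp
    \<comment> \<open>The chain is (1 - y)^(2^n) \<le> exp (- 2^n y) for y = t^n, then exp (- z)
      \<le> 1 / z for z = (2 t)^n.\<close>
    have upper: "(1 - t ^ n) ^ (2 ^ n) \<le> (1 / (2 * t)) ^ n" for n
    proof -
      have "(1 - t ^ n) ^ (2 ^ n) \<le> exp (- (t ^ n)) ^ (2 ^ n)"
        using power_le_one[OF assms, of n] exp_ge_add_one_self[of "- (t ^ n)"]
        by (intro power_mono) linarith+
      also have "\<dots> = exp (- ((2 * t) ^ n))"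
        by (simp add: power_mult_distrib flip: exp_of_nat_mult)
      also have "\<dots> \<le> (1 / (2 * t)) ^ n"
      proof -
        have "(2 * t) ^ n \<le> exp ((2 * t) ^ n)" "(2 * t) ^ n > 0"
          using 3 exp_ge_add_one_self[of "(2 * t) ^ n"] by (linarith, intro zero_less_power) linarith
        then show ?thesis
          unfolding exp_minus inverse_eq_divide power_one_over by (intro divide_left_mono) auto
      qed
      finally show ?thesis .
    qed
    have lower: "0 \<le> (1 - t ^ n) ^ (2 ^ n)" for n
      using power_le_one[OF assms, of n] by simp
    have "step t = 0" using 3 by (simp add: step_def)
    then show ?thesis
      using tendsto_sandwich[OF always_eventually[OF allI[OF lower]] always_eventually[OF allI[OF upper]]
          tendsto_const lim] by (simp only:)
  qed
qed

lemma multipliers_step: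
  assumes m: "m \<in> multipliers" and "\<And>x. 0 \<le> m x" "\<And>x. m x \<le> 1"
  shows "(\<lambda>x. step (m x)) \<in> multipliers"
proof (rule multipliers_pointwise_limit)
  show "(\<lambda>x. (1 - m x ^ n) ^ (2 ^ n)) \<in> multipliers" for n
    by (intro multipliers_power multipliers_diff multipliers_const m)
  show "\<bar>(1 - m x ^ n) ^ (2 ^ n)\<bar> \<le> 1" for n x
    using assms(2,3)[of x] power_le_one[of "m x" n] by (auto simp: power_abs intro!: power_le_one)
  show "(\<lambda>n. (1 - m x ^ n) ^ (2 ^ n)) \<longlonglongrightarrow> step (m x)" for x
    by (rule power_power_tendsto_step[OF assms(2,3)])
qed

text \<open>As the frequency of \<open>sin (a * (x \<bullet> b - c))\<close> tends to \<open>0\<close>, its sign converges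
  pointwise to the sign of \<open>x \<bullet> b - c\<close>.\<close>

lemma multipliers_halfspace:
  assumes b: "b \<in> Basis"
  shows "indicator {x. x \<bullet> b < c} \<in> multipliers"
proof -
  \<comment> \<open>The sine is rescaled to [0, 1], so that \<open>step\<close> switches exactly
    where it changes sign.\<close>
  define m where "m j x = (1 + sin (inverse (real (Suc j)) * (x \<bullet> b - c))) / 2" for j x
  have m: "m j \<in> multipliers" for j
  proof -
    have "m j = (\<lambda>x. 1 / 2 * (1 + sin (inverse (real (Suc j)) * (x \<bullet> b - c))))"
      by (simp add: m_def fun_eq_iff)
    then show ?thesis
      by (simp only:) (intro multipliers_scale multipliers_add multipliers_const multipliers_sin b)
  qed
  have m01: "0 \<le> m j x \<and> m j x \<le> 1" for j x
    using sin_ge_minus_one[of "inverse (real (Suc j)) * (x \<bullet> b - c)"]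
      sin_le_one[of "inverse (real (Suc j)) * (x \<bullet> b - c)"]
    unfolding m_def by (simp del: of_nat_Suc sin_ge_minus_one sin_le_one)
  have lim: "(\<lambda>j. step (m j x)) \<longlonglongrightarrow> step (1/2 + (x \<bullet> b - c))" for x
  proof (rule tendsto_eventually)
    have "(\<lambda>j. inverse (real (Suc j)) * \<bar>x \<bullet> b - c\<bar>) \<longlonglongrightarrow> 0 * \<bar>x \<bullet> b - c\<bar>"
      by (intro tendsto_mult_right LIMSEQ_inverse_real_of_nat)
    then have "(\<lambda>j. inverse (real (Suc j)) * \<bar>x \<bullet> b - c\<bar>) \<longlonglongrightarrow> 0" by simp
    \<comment> \<open>Once the argument lies in (-pi, pi), the sine has the sign of
      \<open>x \<bullet> b - c\<close>, so the sequence is eventually constant.\<close>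
    then have "\<forall>\<^sub>F j in sequentially. inverse (real (Suc j)) * \<bar>x \<bullet> b - c\<bar> < pi"
      using pi_gt_zero by (rule order_tendstoD)
    then show "\<forall>\<^sub>F j in sequentially. step (m j x) = step (1/2 + (x \<bullet> b - c))"
    proof eventually_elim
      case (elim j)
      define y where "y = inverse (real (Suc j)) * (x \<bullet> b - c)"
      have y: "\<bar>y\<bar> < pi" "y > 0 \<longleftrightarrow> x \<bullet> b - c > 0" "y < 0 \<longleftrightarrow> x \<bullet> b - c < 0"
        using elim by (auto simp: y_def abs_mult zero_less_mult_iff mult_less_0_iff simp del: of_nat_Suc)
      have "sin y > 0" if "y > 0" using y(1) that by (intro sin_gt_zero) auto
      moreover have "sin y < 0" if "y < 0" using y(1) that sin_gt_zero[of "- y"] by auto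
      ultimately show ?case
        using y(2,3) by (cases y "0::real" rule: linorder_cases)
          (auto simp: step_def m_def y_def[symmetric] simp del: of_nat_Suc)
    qed
  qed
  have step: "(\<lambda>x. step (1/2 + (x \<bullet> b - c))) \<in> multipliers"
    by (rule multipliers_pointwise_limit[where m = "\<lambda>j x. step (m j x)" and B = 1])
      (use m01 in \<open>simp_all add: multipliers_step m lim\<close>, simp add: step_def)
  \<comment> \<open>Powers fix the values 0 and 1 and send the value exp (-1) on the bounding
    hyperplane to 0, which leaves the open half-space.\<close>
  show ?thesis
  proof (rule multipliers_pointwise_limit[where m = "\<lambda>k x. step (1/2 + (x \<bullet> b - c)) ^ Suc k" and B = 1])
    show "(\<lambda>x. step (1/2 + (x \<bullet> b - c)) ^ Suc k) \<in> multipliers" for k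
      by (rule multipliers_power[OF step])
    show "\<bar>step (1/2 + (x \<bullet> b - c)) ^ Suc k\<bar> \<le> 1" for k x
      unfolding power_abs by (intro power_le_one) (auto simp: step_def)
    show "(\<lambda>k. step (1/2 + (x \<bullet> b - c)) ^ Suc k) \<longlonglongrightarrow> indicator {x. x \<bullet> b < c} x" for x
      using LIMSEQ_Suc[OF LIMSEQ_power_zero[of "exp (-1::real)"]] by (auto simp: step_def indicator_def)
  qed
qed

text \<open>Half-spaces generate the Borel sets. The algebra operations give complements and, by
  inclusion-exclusion, finite unions; bounded pointwise limits give countable unions.\<close>

lemma multipliers_borel:
  fixes A :: "'a::euclidean_space set"
  assumes "A \<in> sets borel"
  shows "indicator A \<in> multipliers"
proof -
  have "A \<in> sigma_sets UNIV ((\<lambda>(a, i). {x::'a. x \<bullet> i < a}) ` (UNIV \<times> Basis))"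
    using assms unfolding borel_eq_halfspace_less by simp
  then show ?thesis
  proof induction
    case (Basic A)
    then show ?case by (auto intro: multipliers_halfspace)
  next
    case Empty
    show ?case using multipliers_const[of 0] by (simp add: indicator_def[abs_def])
  next
    case (Compl A)
    have "indicator (UNIV - A) = (\<lambda>x. 1 - indicator A x :: real)"
      by (auto simp: indicator_def)
    with Compl.IH show ?case by (simp add: multipliers_diff multipliers_const)
  next
    case (Union A)
    have fin: "indicator (\<Union>i<n. A i) \<in> multipliers" for n :: nat
    proof (induction n)
      case 0
      show ?case using multipliers_const[of 0] by (simp add: indicator_def[abs_def])
    next
      case (Suc n)
      have "indicator (\<Union>i<Suc n. A i)
          = (\<lambda>x. indicator (\<Union>i<n. A i) x + indicator (A n) x - indicator (\<Union>i<n. A i) x * indicator (A n) x :: real)"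
        by (auto simp: indicator_def less_Suc_eq fun_eq_iff)
      with Suc Union.IH[of n] show ?case
        by (simp only:) (intro multipliers_add multipliers_diff multipliers_times)
    qed
    show ?case
      by (rule multipliers_pointwise_limit[OF fin, where B = 1])
        (auto intro: LIMSEQ_indicator_UN)
  qed
qed

text \<open>A Lebesgue set differs from a Borel set by a null set, so the constant sequence of Borel
  indicators converges to its indicator almost everywhere.\<close>

lemma multipliers_lebesgue:
  fixes A :: "'a::euclidean_space set"
  assumes A: "A \<in> sets lebesgue"
  shows "indicator A \<in> multipliers"
proof -
  have Am: "(indicator A :: 'a \<Rightarrow> real) \<in> borel_measurable lebesgue"
    using A by (rule borel_measurable_indicator)
  obtain g where g: "g \<in> borel_measurable lborel" "AE x in lborel. indicator A x = (g x :: real)"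
    using completion_ex_borel_measurable_real[OF Am] by blast
  define B where "B = {x. g x = 1}"
  have "B \<in> sets borel" using g(1) unfolding B_def by measurable
  then have B: "indicator B \<in> multipliers" by (rule multipliers_borel)
  have "AE x in lebesgue. indicator A x = (indicator B x :: real)"
    using AE_completion[OF g(2)]
  proof eventually_elim
    case (elim x)
    then show ?case by (cases "x \<in> A") (auto simp: B_def indicator_def)
  qed
  then have "AE x in lebesgue. (\<lambda>n::nat. indicator B x) \<longlonglongrightarrow> (indicator A x :: real)"
    by eventually_elim simp
  then show ?thesis
    by (rule multipliers_limit[where B = 1, OF B _ _ _ Am, rotated 2])
      (simp_all add: indicator_def)
qed

text \<open>The Gaussian g vanishes nowhere, so f = (f / g) g. Simple functions approximating f / g
  are combinations of indicators, all of which are multipliers, and g is itself a Hermite function.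
  The approximants are bounded by 2 \<bar>f / g\<bar>, hence the majorant 2 \<bar>f\<bar>.\<close>

lemma hermite_complete:
  assumes f: "f \<in> L2_functions"
  shows "f \<in> hermite_closure"
proof -
  have gpos: "gaussian x > 0" for x :: 'a by (simp add: gaussian_def)
  have gH: "gaussian \<in> hermite_closure"
    using hermite_closure_span[OF hermite_span_hermite[OF zero_multi_index]] by (simp add: hermite_zero)
  have "(\<lambda>x. f x / gaussian x) \<in> borel_measurable lebesgue"
    by (intro borel_measurable_divide L2_measurable f hermite_closure_L2 gH)
  from borel_measurable_implies_sequence_metric[OF this, of 0]
  obtain s where s: "\<And>i. simple_function lebesgue (s i)"
      "\<And>x. (\<lambda>i. s i x) \<longlonglongrightarrow> f x / gaussian x"
      "\<And>i x. dist (s i x) 0 \<le> 2 * dist (f x / gaussian x) 0"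
    by auto
  show ?thesis
  proof (rule hermite_closure_dominated[where w = "\<lambda>x. 2 * \<bar>f x\<bar>"])
    show "(\<lambda>x. s i x * gaussian x) \<in> hermite_closure" for i
    proof -
      have "(\<lambda>x. \<Sum>y\<in>range (s i). y * (indicator (s i -` {y}) x * gaussian x)) \<in> hermite_closure"
        using simple_functionD(2)[OF s(1), of i]
        by (intro hermite_closure_sum hermite_closure_scale multipliers_mult multipliers_lebesgue gH) auto
      moreover have "s i x * gaussian x = (\<Sum>y\<in>range (s i). y * (indicator (s i -` {y}) x * gaussian x))" for x
      proof -
        have "s i x = (\<Sum>y\<in>range (s i). indicator (s i -` {y}) x *\<^sub>R y)"
        proof -
          have sp: "space lebesgue = (UNIV :: 'a set)" by simp
          then have "x \<in> space lebesgue" by blast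
          from simple_function_indicator_representation_banach[OF s(1) this, of i]
          show ?thesis unfolding sp Int_UNIV_right .
        qed
        then have "s i x * gaussian x = (\<Sum>y\<in>range (s i). indicator (s i -` {y}) x *\<^sub>R y) * gaussian x"
          by (rule arg_cong)
        then show ?thesis
          unfolding sum_distrib_right real_scaleR_def by (simp only: mult.assoc mult.left_commute)
      qed
      ultimately show ?thesis by (simp only:)
    qed
    show "(\<lambda>x. 2 * \<bar>f x\<bar>) \<in> L2_functions"
      by (intro L2_dominated[OF f, of _ 2] borel_measurable_times borel_measurable_const
          borel_measurable_abs L2_measurable[OF f]) simp
    have "(\<lambda>i. s i x * gaussian x) \<longlonglongrightarrow> f x / gaussian x * gaussian x" for x
      by (intro tendsto_intros s(2))
    then show "AE x in lebesgue. (\<lambda>i. s i x * gaussian x) \<longlonglongrightarrow> f x"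
      using less_imp_neq[OF gpos, symmetric] by simp
    show "\<bar>s i x * gaussian x\<bar> \<le> 2 * \<bar>f x\<bar>" for i x
      using s(3)[of i x] gpos[of x] by (simp add: abs_mult pos_le_divide_eq)
    show "f \<in> borel_measurable lebesgue" by (rule L2_measurable[OF f])
  qed auto
qed

section \<open>Weak gradients and the energy form\<close>

lemma locally_integrable_mult_integrable:
  fixes f g :: "'a::euclidean_space \<Rightarrow> real"
  assumes f: "locally_integrable f" and g: "continuous_on UNIV g" and supp: "\<And>x. r \<le> norm x \<Longrightarrow> g x = 0"
  shows "integrable lebesgue (\<lambda>x. f x * g x)"
proof -
  have "compact (g ` cball 0 r)"
    by (intro compact_continuous_image compact_cball continuous_on_subset[OF g]) auto
  then obtain C where C: "\<And>x. norm x \<le> r \<Longrightarrow> \<bar>g x\<bar> \<le> C"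
    using compact_imp_bounded by (fastforce simp: bounded_iff)
  show ?thesis
  proof (rule Bochner_Integration.integrable_bound)
    have "integrable lebesgue (\<lambda>x. indicator (cball 0 r) x * f x)"
      using f by (auto simp: locally_integrable_def set_integrable_def)
    then show "integrable lebesgue (\<lambda>x. C * (indicator (cball 0 r) x * f x))" by simp
    show "(\<lambda>x. f x * g x) \<in> borel_measurable lebesgue"
      by (intro borel_measurable_times locally_integrable_measurable f lebesgue_measurable_lborel
          borel_measurable_continuous_onI g)
    have "\<bar>f x * g x\<bar> \<le> \<bar>C * (indicator (cball 0 r) x * f x)\<bar>" for x
    proof (cases "norm x \<le> r")
      case True
      then have "\<bar>f x\<bar> * \<bar>g x\<bar> \<le> \<bar>f x\<bar> * \<bar>C\<bar>"
        using C[OF True] by (intro mult_left_mono) auto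
      with True show ?thesis by (simp add: abs_mult mult.commute)
    qed (simp add: supp)
    then show "AE x in lebesgue. norm (f x * g x) \<le> norm (C * (indicator (cball 0 r) x * f x))"
      by simp
  qed
qed

lemma integrable_mult_test_function:
  fixes f :: "'a::euclidean_space \<Rightarrow> real"
  assumes f: "locally_integrable f" and \<phi>: "\<phi> \<in> test_functions"
  shows "integrable lebesgue (\<lambda>x. f x * \<phi> x)"
    and "b \<in> Basis \<Longrightarrow> integrable lebesgue (\<lambda>x. f x * frechet_derivative \<phi> (at x) b)"
proof -
  obtain r where r: "r > 0" "\<And>x. r \<le> norm x \<Longrightarrow> \<phi> x = 0"
    using test_function_support[OF \<phi>] by blast
  show "integrable lebesgue (\<lambda>x. f x * \<phi> x)"
    by (rule locally_integrable_mult_integrable[OF f test_function_continuous[OF \<phi>] r(2)])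
  show "integrable lebesgue (\<lambda>x. f x * frechet_derivative \<phi> (at x) b)" if "b \<in> Basis"
    by (rule locally_integrable_mult_integrable[OF f test_function_derivative_continuous[OF \<phi> that], of "r + 1"])
      (rule test_function_derivative_support[of r, OF r(2)], auto)
qed

lemma locally_integrable_inner: "locally_integrable f \<Longrightarrow> locally_integrable (\<lambda>x. f x \<bullet> b)"
  unfolding locally_integrable_def set_integrable_def
  using integrable_inner_left[of b lebesgue] by fastforce

lemma has_weak_gradient_add_scale:
  assumes "has_weak_gradient u v" "has_weak_gradient u' v'"
  shows "has_weak_gradient (\<lambda>x. u x + k * u' x) (\<lambda>x. v x + k *\<^sub>R v' x)"
  unfolding has_weak_gradient_def
proof (intro conjI ballI)
  have loc: "locally_integrable u" "locally_integrable v" "locally_integrable u'" "locally_integrable v'"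
    using assms by (auto simp: has_weak_gradient_def)
  show "locally_integrable (\<lambda>x. u x + k * u' x)"
    using locally_integrable_add[OF loc(1) locally_integrable_scaleR[OF loc(3), of k]] by simp
  show "locally_integrable (\<lambda>x. v x + k *\<^sub>R v' x)"
    by (intro locally_integrable_add locally_integrable_scaleR loc)
  fix \<phi> :: "'a \<Rightarrow> real" and b :: 'a assume \<phi>: "\<phi> \<in> test_functions" and b: "b \<in> Basis"
  let ?D = "\<lambda>x. frechet_derivative \<phi> (at x) b"
  note i = integrable_mult_test_function(2)[OF _ \<phi> b, OF loc(1)] integrable_mult_test_function(2)[OF _ \<phi> b, OF loc(3)]
    integrable_mult_test_function(1)[OF locally_integrable_inner \<phi>, OF loc(2), of b]
    integrable_mult_test_function(1)[OF locally_integrable_inner \<phi>, OF loc(4), of b]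
  have "(LINT x|lebesgue. (u x + k * u' x) * ?D x) = (LINT x|lebesgue. u x * ?D x) + k * (LINT x|lebesgue. u' x * ?D x)"
    using i by (simp add: distrib_right mult.assoc)
  also have "\<dots> = - ((LINT x|lebesgue. (v x \<bullet> b) * \<phi> x) + k * (LINT x|lebesgue. (v' x \<bullet> b) * \<phi> x))"
    using assms \<phi> b by (simp add: has_weak_gradient_def)
  also have "\<dots> = - (LINT x|lebesgue. ((v x + k *\<^sub>R v' x) \<bullet> b) * \<phi> x)"
    using i by (simp add: distrib_right mult.assoc inner_add_left)
  finally show "(LINT x|lebesgue. (u x + k * u' x) * ?D x) = - (LINT x|lebesgue. ((v x + k *\<^sub>R v' x) \<bullet> b) * \<phi> x)" .
qed

lemma weak_gradient_unique:
  fixes u :: "'a::euclidean_space \<Rightarrow> real"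
  assumes "has_weak_gradient u v" "has_weak_gradient u v'"
  shows "AE x in lebesgue. v x = v' x"
proof -
  have loc: "locally_integrable v" "locally_integrable v'"
    using assms by (auto simp: has_weak_gradient_def)
  have b: "AE x in lebesgue. v x \<bullet> b - v' x \<bullet> b = 0" if b: "b \<in> Basis" for b
  proof (rule fundamental_lemma_calculus_of_variations)
    show "locally_integrable (\<lambda>x. v x \<bullet> b - v' x \<bullet> b)"
      using locally_integrable_add[OF locally_integrable_inner[OF loc(1), of b]
          locally_integrable_scaleR[OF locally_integrable_inner[OF loc(2), of b], of "-1"]] by simp
    fix \<phi> :: "'a \<Rightarrow> real" assume \<phi>: "\<phi> \<in> test_functions"
    have "(LINT x|lebesgue. (v x \<bullet> b - v' x \<bullet> b) * \<phi> x)
        = (LINT x|lebesgue. (v x \<bullet> b) * \<phi> x) - (LINT x|lebesgue. (v' x \<bullet> b) * \<phi> x)"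
      using integrable_mult_test_function(1)[OF locally_integrable_inner \<phi>, OF loc(1), of b]
        integrable_mult_test_function(1)[OF locally_integrable_inner \<phi>, OF loc(2), of b]
      by (simp add: left_diff_distrib)
    also have "\<dots> = 0"
      using assms \<phi> b unfolding has_weak_gradient_def by fastforce
    finally show "(LINT x|lebesgue. (v x \<bullet> b - v' x \<bullet> b) * \<phi> x) = 0" .
  qed
  have "AE x in lebesgue. \<forall>b\<in>Basis. v x \<bullet> b - v' x \<bullet> b = 0"
    using b by (intro AE_finite_allI) auto
  then show ?thesis
    by eventually_elim (auto intro: euclidean_eqI)
qed

text \<open>By almost everywhere uniqueness, any weak gradient at hand can replace the one picked by
  \<open>SOME\<close> under this integral.\<close>

lemma integral_weak_gradient:
  fixes u :: "'a::euclidean_space \<Rightarrow> real"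
  assumes "has_weak_gradient u v"
  shows "(LINT x|lebesgue. (norm (weak_gradient u x))\<^sup>2) = (LINT x|lebesgue. (norm (v x))\<^sup>2)"
proof -
  have wg: "has_weak_gradient u (weak_gradient u)"
    unfolding weak_gradient_def using someI[of "has_weak_gradient u", OF assms] .
  then have "locally_integrable (weak_gradient u)" "locally_integrable v"
    using assms by (auto simp: has_weak_gradient_def)
  then have "weak_gradient u \<in> borel_measurable lebesgue" "v \<in> borel_measurable lebesgue"
    by (auto intro: locally_integrable_measurable)
  then show ?thesis
    using weak_gradient_unique[OF wg assms]
    by (intro integral_cong_AE borel_measurable_power borel_measurable_norm) auto
qed

text \<open>The integrability that makes \<open>energy\<close> finite and bilinear; the relation
  \<open>has_weak_gradient u v\<close> is kept as a separate predicate.\<close>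

definition energy_pair :: "('a::euclidean_space \<Rightarrow> real) \<Rightarrow> ('a \<Rightarrow> 'a) \<Rightarrow> bool" where
  "energy_pair u v \<longleftrightarrow> u \<in> L2_functions \<and> v \<in> L2_functions \<and> (\<lambda>x. u x *\<^sub>R x) \<in> L2_functions"

section \<open>Bilinearity of the energy form\<close>

lemma energy_pairD:
  assumes "energy_pair u v"
  shows "u \<in> L2_functions" "v \<in> L2_functions" "(\<lambda>x. u x *\<^sub>R x) \<in> L2_functions"
  using assms by (auto simp: energy_pair_def)

lemma energy_integrable:
  assumes "energy_pair u v" "energy_pair u' v'"
  shows "integrable lebesgue (\<lambda>x. v x \<bullet> v' x)" "integrable lebesgue (\<lambda>x. (norm x)\<^sup>2 * (u x * u' x))"
proof -
  show "integrable lebesgue (\<lambda>x. v x \<bullet> v' x)"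
    by (intro L2_inner_integrable energy_pairD(2)[OF assms(1)] energy_pairD(2)[OF assms(2)])
  have "integrable lebesgue (\<lambda>x. (u x *\<^sub>R x) \<bullet> (u' x *\<^sub>R x))"
    by (intro L2_inner_integrable energy_pairD(3)[OF assms(1)] energy_pairD(3)[OF assms(2)])
  then show "integrable lebesgue (\<lambda>x. (norm x)\<^sup>2 * (u x * u' x))"
    by (simp add: power2_norm_eq_inner mult.commute mult.left_commute)
qed

lemma energy_commute: "energy u v u' v' = energy u' v' u v"
  by (simp add: energy_def inner_commute mult.commute)

lemma energy_add_scale_left:
  assumes "energy_pair u v" "energy_pair u' v'" "energy_pair w z"
  shows "energy (\<lambda>x. u x + k * u' x) (\<lambda>x. v x + k *\<^sub>R v' x) w z = energy u v w z + k * energy u' v' w z"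
proof -
  have "(LINT x|lebesgue. (v x + k *\<^sub>R v' x) \<bullet> z x) = (LINT x|lebesgue. v x \<bullet> z x) + k * (LINT x|lebesgue. v' x \<bullet> z x)"
    using energy_integrable(1)[OF assms(1,3)] energy_integrable(1)[OF assms(2,3)]
    by (simp add: inner_add_left)
  moreover have "(LINT x|lebesgue. (norm x)\<^sup>2 * ((u x + k * u' x) * w x))
      = (LINT x|lebesgue. (norm x)\<^sup>2 * (u x * w x) + k * ((norm x)\<^sup>2 * (u' x * w x)))"
    by (simp add: algebra_simps)
  moreover have "\<dots> = (LINT x|lebesgue. (norm x)\<^sup>2 * (u x * w x)) + k * (LINT x|lebesgue. (norm x)\<^sup>2 * (u' x * w x))"
    using energy_integrable(2)[OF assms(1,3)] energy_integrable(2)[OF assms(2,3)] by simp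
  ultimately show ?thesis by (simp add: energy_def algebra_simps)
qed

lemma energy_pair_add_scale:
  assumes "energy_pair u v" "energy_pair u' v'"
  shows "energy_pair (\<lambda>x. u x + k * u' x) (\<lambda>x. v x + k *\<^sub>R v' x)"
  unfolding energy_pair_def
proof (intro conjI)
  show "(\<lambda>x. u x + k * u' x) \<in> L2_functions"
    by (intro L2_add L2_mult_const energy_pairD(1)[OF assms(1)] energy_pairD(1)[OF assms(2)])
  show "(\<lambda>x. v x + k *\<^sub>R v' x) \<in> L2_functions"
    by (intro L2_add L2_scaleR energy_pairD(2)[OF assms(1)] energy_pairD(2)[OF assms(2)])
  show "(\<lambda>x. (u x + k * u' x) *\<^sub>R x) \<in> L2_functions"
    unfolding scaleR_add_left scaleR_scaleR[symmetric]
    by (intro L2_add L2_scaleR energy_pairD(3)[OF assms(1)] energy_pairD(3)[OF assms(2)])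
qed

lemma energy_add_scale_square:
  assumes "energy_pair u v" "energy_pair u' v'"
  shows "energy (\<lambda>x. u x + k * u' x) (\<lambda>x. v x + k *\<^sub>R v' x) (\<lambda>x. u x + k * u' x) (\<lambda>x. v x + k *\<^sub>R v' x)
    = energy u v u v + 2 * k * energy u v u' v' + k\<^sup>2 * energy u' v' u' v'"
proof -
  let ?w = "\<lambda>x. u x + k * u' x" and ?z = "\<lambda>x. v x + k *\<^sub>R v' x"
  note wz = energy_pair_add_scale[OF assms, of k]
  have "energy ?w ?z ?w ?z = energy u v ?w ?z + k * energy u' v' ?w ?z"
    by (rule energy_add_scale_left[OF assms wz])
  also have "energy u v ?w ?z = energy u v u v + k * energy u v u' v'"
    using energy_add_scale_left[OF assms assms(1), of k]
    unfolding energy_commute[of u v ?w ?z] energy_commute[of u' v' u v] .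
  also have "energy u' v' ?w ?z = energy u v u' v' + k * energy u' v' u' v'"
    using energy_add_scale_left[OF assms assms(2), of k]
    unfolding energy_commute[of u' v' ?w ?z] .
  finally show ?thesis by (simp add: power2_eq_square algebra_simps)
qed

lemma energy_nonneg: "0 \<le> energy u v u v"
proof -
  have "0 \<le> (LINT x|lebesgue. v x \<bullet> v x)"
    by (rule Bochner_Integration.integral_nonneg) (rule inner_ge_zero)
  moreover have "0 \<le> (LINT x|lebesgue. (norm x)\<^sup>2 * (u x * u x))"
    by (rule Bochner_Integration.integral_nonneg) (intro mult_nonneg_nonneg zero_le_power2 zero_le_square)
  ultimately show ?thesis unfolding energy_def by (rule add_nonneg_nonneg)
qed

lemma energy_pair_zero: "energy_pair (\<lambda>x. 0) (\<lambda>x. 0)"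
  by (simp add: energy_pair_def L2_zero)

lemma energy_pair_hermite: "energy_pair (hermite \<alpha>) (gradient (hermite \<alpha>))"
proof -
  have "(\<lambda>x. hermite \<alpha> x *\<^sub>R x) \<in> L2_functions"
  proof (rule L2_functionsI)
    show "(\<lambda>x. hermite \<alpha> x *\<^sub>R x) \<in> borel_measurable lebesgue"
      by (intro borel_measurable_scaleR L2_measurable[OF L2_hermite] lebesgue_measurable_lborel) simp
    have "integrable lebesgue (\<lambda>x. \<Sum>b\<in>Basis. ((x \<bullet> b) * hermite \<alpha> x)\<^sup>2)"
      by (intro Bochner_Integration.integrable_sum L2_integrable_square L2_hermite_mult)
    then show "integrable lebesgue (\<lambda>x. (norm (hermite \<alpha> x *\<^sub>R x))\<^sup>2)"
      by (simp add: power_mult_distrib norm_sq_eq_sum_Basis sum_distrib_left mult.commute)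
  qed
  then show ?thesis by (simp add: energy_pair_def L2_hermite L2_gradient_hermite)
qed

text \<open>Both claims share one induction, because adding a summand to the energy requires the
  partial sum to be an energy pair.\<close>

lemma energy_sum_right:
  assumes u: "energy_pair u v" and f: "\<And>i. i \<in> I \<Longrightarrow> energy_pair (f i) (g i)"
  shows "energy_pair (\<lambda>x. \<Sum>i\<in>I. a i * f i x) (\<lambda>x. \<Sum>i\<in>I. a i *\<^sub>R g i x)
    \<and> energy u v (\<lambda>x. \<Sum>i\<in>I. a i * f i x) (\<lambda>x. \<Sum>i\<in>I. a i *\<^sub>R g i x) = (\<Sum>i\<in>I. a i * energy u v (f i) (g i))"
  using f
proof (induction I rule: infinite_finite_induct)
  case (insert i I)
  let ?F = "\<lambda>x. \<Sum>i\<in>I. a i * f i x" and ?G = "\<lambda>x. \<Sum>i\<in>I. a i *\<^sub>R g i x"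
  have IH: "energy_pair ?F ?G" "energy u v ?F ?G = (\<Sum>i\<in>I. a i * energy u v (f i) (g i))"
    using insert.IH insert.prems by auto
  have i: "energy_pair (f i) (g i)" using insert.prems by simp
  have F: "(\<lambda>x. \<Sum>j\<in>insert i I. a j * f j x) = (\<lambda>x. ?F x + a i * f i x)"
    and G: "(\<lambda>x. \<Sum>j\<in>insert i I. a j *\<^sub>R g j x) = (\<lambda>x. ?G x + a i *\<^sub>R g i x)"
    using insert.hyps by (auto simp: add.commute)
  have "energy u v (\<lambda>x. ?F x + a i * f i x) (\<lambda>x. ?G x + a i *\<^sub>R g i x) = energy u v ?F ?G + a i * energy u v (f i) (g i)"
    using energy_add_scale_left[OF IH(1) i u, of "a i"] by (simp only: energy_commute[of u v])
  with IH(2) energy_pair_add_scale[OF IH(1) i, of "a i"] insert.hyps show ?case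
    unfolding F G by simp
qed (simp_all add: energy_pair_zero, simp_all add: energy_def)

section \<open>The spectral gap\<close>

lemma level_ge:
  fixes \<alpha> :: "'a::euclidean_space \<Rightarrow> nat"
  assumes "\<alpha> \<in> multi_indices" "\<alpha> \<noteq> (\<lambda>b. 0)"
  shows "real DIM('a) + 2 \<le> level \<alpha>"
proof -
  obtain b where b: "\<alpha> b \<noteq> 0" using assms(2) by (auto simp: fun_eq_iff)
  with assms(1) have "b \<in> Basis" by (auto simp: multi_indices_def)
  have "1 \<le> real (\<alpha> b)" using b by simp
  also have "\<dots> \<le> (\<Sum>b\<in>Basis. real (\<alpha> b))" by (rule member_le_sum[OF \<open>b \<in> Basis\<close>]) auto
  finally show ?thesis by (simp add: level_def sum.distrib flip: sum_distrib_left)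
qed

lemma hermite_inner_sum:
  assumes "finite F" "F \<subseteq> multi_indices" "\<alpha> \<in> F"
  shows "(LINT x|lebesgue. (\<Sum>\<beta>\<in>F. c \<beta> * hermite \<beta> x) * hermite \<alpha> x) = c \<alpha> * (LINT x|lebesgue. (hermite \<alpha> x)\<^sup>2)"
proof -
  have i: "integrable lebesgue (\<lambda>x. hermite \<beta> x * hermite \<alpha> x)" for \<beta>
    by (intro L2_mult_integrable L2_hermite)
  have "(LINT x|lebesgue. (\<Sum>\<beta>\<in>F. c \<beta> * hermite \<beta> x) * hermite \<alpha> x)
      = (\<Sum>\<beta>\<in>F. c \<beta> * (LINT x|lebesgue. hermite \<beta> x * hermite \<alpha> x))"
    using i by (simp add: sum_distrib_right mult.assoc)
  also have "\<dots> = (\<Sum>\<beta>\<in>F. if \<beta> = \<alpha> then c \<alpha> * (LINT x|lebesgue. (hermite \<alpha> x)\<^sup>2) else 0)"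
    using assms hermite_orthogonal[of _ \<alpha>] by (intro sum.cong) (auto simp: power2_eq_square)
  also have "\<dots> = c \<alpha> * (LINT x|lebesgue. (hermite \<alpha> x)\<^sup>2)"
    using assms by (simp add: sum.delta)
  finally show ?thesis .
qed

lemma L2_diff_hermite_sum_square:
  assumes u: "u \<in> L2_functions" and F: "finite F" "F \<subseteq> multi_indices"
  shows "(LINT x|lebesgue. (u x - (\<Sum>\<alpha>\<in>F. c \<alpha> * hermite \<alpha> x))\<^sup>2)
    = (LINT x|lebesgue. (u x)\<^sup>2)
      - (\<Sum>\<alpha>\<in>F. 2 * (c \<alpha> * (LINT x|lebesgue. u x * hermite \<alpha> x)) - (c \<alpha>)\<^sup>2 * (LINT x|lebesgue. (hermite \<alpha> x)\<^sup>2))"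
proof -
  let ?s = "\<lambda>x. \<Sum>\<alpha>\<in>F. c \<alpha> * hermite \<alpha> x"
  have s: "?s \<in> L2_functions" by (intro L2_sum L2_mult_const L2_hermite)
  have lin: "(LINT x|lebesgue. w x * ?s x) = (\<Sum>\<alpha>\<in>F. c \<alpha> * (LINT x|lebesgue. w x * hermite \<alpha> x))"
    if "w \<in> L2_functions" for w
    using L2_mult_integrable[OF that L2_hermite] by (simp add: sum_distrib_left mult.left_commute)
  have sq: "(a - b)\<^sup>2 = a\<^sup>2 - 2 * (a * b) + b * b" for a b :: real
    by (simp add: power2_eq_square algebra_simps)
  have "(LINT x|lebesgue. (u x - ?s x)\<^sup>2) = (LINT x|lebesgue. (u x)\<^sup>2 - 2 * (u x * ?s x) + ?s x * ?s x)"
    unfolding sq ..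
  also have "\<dots> = (LINT x|lebesgue. (u x)\<^sup>2) - 2 * (LINT x|lebesgue. u x * ?s x) + (LINT x|lebesgue. ?s x * ?s x)"
    using L2_integrable_square[OF u] L2_mult_integrable[OF u s] L2_mult_integrable[OF s s] by simp
  also have "(LINT x|lebesgue. ?s x * ?s x) = (\<Sum>\<alpha>\<in>F. (c \<alpha>)\<^sup>2 * (LINT x|lebesgue. (hermite \<alpha> x)\<^sup>2))"
    unfolding lin[OF s] using hermite_inner_sum[OF F] by (simp add: power2_eq_square mult.assoc)
  finally show ?thesis
    unfolding lin[OF u] by (simp add: sum_subtractf sum_distrib_left)
qed

text \<open>Testing the energy form against \<open>\<phi> = (\<Sum> c \<alpha> / level \<alpha> * hermite \<alpha>)\<close>, the preimage
  under the oscillator of an approximation of \<open>u\<close>, and completing the square.\<close>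

lemma oscillator_spectral_gap:
  fixes u :: "'a::euclidean_space \<Rightarrow> real"
  assumes pair: "energy_pair u v" and weak: "has_weak_gradient u v"
    and orth: "(LINT x|lebesgue. u x * gaussian x) = 0"
  shows "(real DIM('a) + 2) * (LINT x|lebesgue. (u x)\<^sup>2) \<le> energy u v u v"
proof -
  define N where "N = real DIM('a) + 2"
  have N: "N > 0" by (simp add: N_def)
  note u = energy_pairD(1)[OF pair] and v = energy_pairD(2)[OF pair]
  define p where "p \<alpha> = (LINT x|lebesgue. u x * hermite \<alpha> x)" for \<alpha>
  define q where "q \<alpha> = (LINT x|lebesgue. (hermite \<alpha> x)\<^sup>2)" for \<alpha> :: "'a \<Rightarrow> nat"
  have q: "q \<alpha> \<ge> 0" for \<alpha> unfolding q_def by (intro Bochner_Integration.integral_nonneg) auto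
  have p0: "p (\<lambda>b. 0) = 0" unfolding p_def hermite_zero by (rule orth)
  have "N * (LINT x|lebesgue. (u x)\<^sup>2) \<le> energy u v u v + e" if "e > 0" for e
  proof -
    obtain s where s: "s \<in> hermite_span" "(LINT x|lebesgue. (u x - s x)\<^sup>2) < e / N"
      using hermite_complete[OF u] \<open>e > 0\<close> N unfolding hermite_closure_def by (auto dest: spec[of _ "e / N"])
    then obtain F c where F: "finite F" "F \<subseteq> multi_indices" and sF: "s = (\<lambda>x. \<Sum>\<alpha>\<in>F. c \<alpha> * hermite \<alpha> x)"
      unfolding hermite_span_def by blast
    \<comment> \<open>The Gaussian mode has level N - 2 in the local notation, below the gap. As u
      is orthogonal to it, dropping it from the sum cannot worsen the approximation.\<close>
    define G where "G = F - {\<lambda>b. 0}"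
    have G: "finite G" "G \<subseteq> multi_indices" "\<And>\<alpha>. \<alpha> \<in> G \<Longrightarrow> N \<le> level \<alpha>"
      using F level_ge by (auto simp: G_def N_def)
    have "(\<Sum>\<alpha>\<in>F. 2 * (c \<alpha> * p \<alpha>) - (c \<alpha>)\<^sup>2 * q \<alpha>) \<le> (\<Sum>\<alpha>\<in>G. 2 * (c \<alpha> * p \<alpha>) - (c \<alpha>)\<^sup>2 * q \<alpha>)"
    proof (cases "(\<lambda>b. 0) \<in> F")
      case True
      then show ?thesis
        using sum.remove[OF F(1) True, of "\<lambda>\<alpha>. 2 * (c \<alpha> * p \<alpha>) - (c \<alpha>)\<^sup>2 * q \<alpha>"] q
        by (simp add: G_def p0)
    qed (simp add: G_def)
    then have approx: "(LINT x|lebesgue. (u x)\<^sup>2) - (\<Sum>\<alpha>\<in>G. 2 * (c \<alpha> * p \<alpha>) - (c \<alpha>)\<^sup>2 * q \<alpha>) \<le> e / N"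
      using s(2) L2_diff_hermite_sum_square[OF u F, of c] by (simp add: sF p_def q_def)
    define \<phi> where "\<phi> = (\<lambda>x. \<Sum>\<alpha>\<in>G. c \<alpha> / level \<alpha> * hermite \<alpha> x)"
    define \<psi> where "\<psi> = (\<lambda>x. \<Sum>\<alpha>\<in>G. (c \<alpha> / level \<alpha>) *\<^sub>R gradient (hermite \<alpha>) x)"
    have lev: "\<alpha> \<in> G \<Longrightarrow> level \<alpha> > 0" for \<alpha> using G(3) N by fastforce
    note sum = energy_sum_right[where f = hermite and g = "\<lambda>\<alpha>. gradient (hermite \<alpha>)"
        and I = G and a = "\<lambda>\<alpha>. c \<alpha> / level \<alpha>", OF _ energy_pair_hermite, folded \<phi>_def \<psi>_def]
    have \<phi>: "energy_pair \<phi> \<psi>"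
      by (rule conjunct1[OF sum[OF pair]])
    \<comment> \<open>With \<psi> a weak gradient of \<phi>, the eigenvalue identity applies to
      \<phi> itself and yields its energy exactly.\<close>
    have \<phi>w: "has_weak_gradient \<phi> \<psi>"
      unfolding \<phi>_def \<psi>_def
    proof (induction G rule: infinite_finite_induct)
      case (insert \<alpha> G)
      from has_weak_gradient_add_scale[OF insert.IH smooth_alg_has_weak_gradient[OF smooth_alg_hermite], of "c \<alpha> / level \<alpha>" \<alpha>]
      show ?case using insert.hyps by (simp add: add.commute)
    qed (auto simp: has_weak_gradient_def locally_integrable_continuous)
    have "energy u v \<phi> \<psi> = (\<Sum>\<alpha>\<in>G. c \<alpha> / level \<alpha> * energy u v (hermite \<alpha>) (gradient (hermite \<alpha>)))"
      by (rule conjunct2[OF sum[OF pair]])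
    also have "\<dots> = (\<Sum>\<alpha>\<in>G. c \<alpha> * p \<alpha>)"
      using lev by (intro sum.cong refl) (auto simp: energy_hermite[OF u v weak] p_def less_imp_neq[symmetric])
    finally have e1: "energy u v \<phi> \<psi> = (\<Sum>\<alpha>\<in>G. c \<alpha> * p \<alpha>)" .
    have "energy \<phi> \<psi> \<phi> \<psi> = (\<Sum>\<alpha>\<in>G. c \<alpha> / level \<alpha> * energy \<phi> \<psi> (hermite \<alpha>) (gradient (hermite \<alpha>)))"
      by (rule conjunct2[OF sum[OF \<phi>]])
    also have "\<dots> = (\<Sum>\<alpha>\<in>G. c \<alpha> * (c \<alpha> / level \<alpha> * q \<alpha>))"
    proof (intro sum.cong refl)
      fix \<alpha> assume \<alpha>: "\<alpha> \<in> G"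
      have "(LINT x|lebesgue. \<phi> x * hermite \<alpha> x) = c \<alpha> / level \<alpha> * q \<alpha>"
        unfolding \<phi>_def q_def by (rule hermite_inner_sum[OF G(1,2) \<alpha>])
      then show "c \<alpha> / level \<alpha> * energy \<phi> \<psi> (hermite \<alpha>) (gradient (hermite \<alpha>)) = c \<alpha> * (c \<alpha> / level \<alpha> * q \<alpha>)"
        using lev[OF \<alpha>] by (simp add: energy_hermite[OF energy_pairD(1,2)[OF \<phi>] \<phi>w])
    qed
    also have "\<dots> \<le> (\<Sum>\<alpha>\<in>G. (c \<alpha>)\<^sup>2 * q \<alpha> / N)"
    proof (intro sum_mono)
      fix \<alpha> assume \<alpha>: "\<alpha> \<in> G"
      have "(c \<alpha>)\<^sup>2 * q \<alpha> / level \<alpha> \<le> (c \<alpha>)\<^sup>2 * q \<alpha> / N"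
        using G(3)[OF \<alpha>] N q lev[OF \<alpha>] by (intro divide_left_mono mult_nonneg_nonneg) auto
      then show "c \<alpha> * (c \<alpha> / level \<alpha> * q \<alpha>) \<le> (c \<alpha>)\<^sup>2 * q \<alpha> / N" by (simp add: power2_eq_square)
    qed
    also have "\<dots> = (\<Sum>\<alpha>\<in>G. (c \<alpha>)\<^sup>2 * q \<alpha>) / N" by (simp add: sum_divide_distrib)
    finally have e2: "energy \<phi> \<psi> \<phi> \<psi> \<le> (\<Sum>\<alpha>\<in>G. (c \<alpha>)\<^sup>2 * q \<alpha>) / N" .
    \<comment> \<open>The multiple N is sharp: if u is a Hermite sum of level N and s = u, then
      \<phi> = u / N and the energy of u - N \<phi> is 0.\<close>
    have "0 \<le> energy u v u v + 2 * (- N) * energy u v \<phi> \<psi> + (- N)\<^sup>2 * energy \<phi> \<psi> \<phi> \<psi>"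
      unfolding energy_add_scale_square[OF pair \<phi>, symmetric] by (rule energy_nonneg)
    also have "\<dots> \<le> energy u v u v + 2 * (- N) * energy u v \<phi> \<psi> + (- N)\<^sup>2 * ((\<Sum>\<alpha>\<in>G. (c \<alpha>)\<^sup>2 * q \<alpha>) / N)"
      by (intro add_left_mono mult_left_mono e2) simp
    also have "\<dots> = energy u v u v - N * (\<Sum>\<alpha>\<in>G. 2 * (c \<alpha> * p \<alpha>) - (c \<alpha>)\<^sup>2 * q \<alpha>)"
    proof -
      have "(\<Sum>\<alpha>\<in>G. 2 * (c \<alpha> * p \<alpha>) - (c \<alpha>)\<^sup>2 * q \<alpha>) = 2 * (\<Sum>\<alpha>\<in>G. c \<alpha> * p \<alpha>) - (\<Sum>\<alpha>\<in>G. (c \<alpha>)\<^sup>2 * q \<alpha>)"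
        by (simp add: sum_subtractf sum_distrib_left)
      moreover have "(- N)\<^sup>2 * (B / N) = N * B" for B
        using N by (simp add: power2_eq_square)
      ultimately show ?thesis
        unfolding e1 by (simp only: right_diff_distrib)
    qed
    finally have "N * (\<Sum>\<alpha>\<in>G. 2 * (c \<alpha> * p \<alpha>) - (c \<alpha>)\<^sup>2 * q \<alpha>) \<le> energy u v u v" by simp
    moreover have "N * (LINT x|lebesgue. (u x)\<^sup>2) \<le> N * (\<Sum>\<alpha>\<in>G. 2 * (c \<alpha> * p \<alpha>) - (c \<alpha>)\<^sup>2 * q \<alpha>) + e"
      using mult_left_mono[OF approx, of N] N by (simp add: right_diff_distrib)
    ultimately show ?thesis by linarith
  qed
  then show ?thesis unfolding N_def by (rule field_le_epsilon)
qed

section \<open>The stability inequality and its extremal function\<close>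

lemma admissibleE:
  assumes "u \<in> admissible"
  obtains v where "energy_pair u v" "has_weak_gradient u v"
proof -
  obtain v where "u \<in> L2_functions" "v \<in> L2_functions" "has_weak_gradient u v"
      "(\<lambda>x. u x *\<^sub>R x) \<in> L2_functions"
    using assms unfolding admissible_def sobolev_W12_def by auto
  then show thesis by (intro that[of v]) (simp_all add: energy_pair_def)
qed

lemma hermite_admissible: "hermite \<alpha> \<in> admissible"
  unfolding admissible_def sobolev_W12_def
  by (intro CollectI conjI bexI[of _ "gradient (hermite \<alpha>)"] energy_pairD[OF energy_pair_hermite]
      smooth_alg_has_weak_gradient smooth_alg_hermite)

lemma uncertainty_deficit_eq:
  fixes u :: "real^'n \<Rightarrow> real"
  assumes "has_weak_gradient u v"
  shows "uncertainty_deficit u = energy u v u v - real CARD('n) * (LINT x|lebesgue. (u x)\<^sup>2)"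
  unfolding uncertainty_deficit_def energy_def integral_weak_gradient[OF assms]
  unfolding power2_norm_eq_inner power2_abs
  unfolding power2_eq_square ..

lemma weighted_norm_sq_eq:
  assumes "has_weak_gradient w v"
  shows "weighted_norm_sq w = energy w v w v + (LINT x|lebesgue. (w x)\<^sup>2)"
  unfolding weighted_norm_sq_def energy_def integral_weak_gradient[OF assms]
  unfolding power2_norm_eq_inner power2_abs
  unfolding power2_eq_square ..

lemma gaussian_norm_pos: "0 < (LINT x|lebesgue. (gaussian (x :: 'a::euclidean_space))\<^sup>2)"
proof -
  have i: "integrable lebesgue (\<lambda>x :: 'a. (gaussian x)\<^sup>2)"
    unfolding hermite_zero[symmetric] by (rule L2_integrable_square[OF L2_hermite])
  have "(LINT x|lebesgue. (gaussian (x :: 'a))\<^sup>2) \<noteq> 0"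
  proof
    assume "(LINT x|lebesgue. (gaussian (x :: 'a))\<^sup>2) = 0"
    then have "AE x :: 'a in lebesgue. (gaussian x)\<^sup>2 = 0"
      by (subst (asm) integral_nonneg_eq_0_iff_AE[OF i]) auto
    then have "AE x :: 'a in lebesgue. False" by eventually_elim (simp add: gaussian_def)
    then show False by (simp add: AE_iff_null null_sets_def)
  qed
  moreover have "0 \<le> (LINT x|lebesgue. (gaussian (x :: 'a))\<^sup>2)" by (intro Bochner_Integration.integral_nonneg) auto
  ultimately show ?thesis by linarith
qed

lemma L2_square_sub_gaussian:
  fixes u :: "'a::euclidean_space \<Rightarrow> real"
  assumes "u \<in> L2_functions"
  shows "(LINT x|lebesgue. (u x - c * gaussian x)\<^sup>2) = (LINT x|lebesgue. (u x)\<^sup>2)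
    - 2 * c * (LINT x|lebesgue. u x * gaussian x) + c\<^sup>2 * (LINT x|lebesgue. (gaussian (x::'a))\<^sup>2)"
  using L2_diff_hermite_sum_square[OF assms, of "{\<lambda>b. 0}" "\<lambda>_. c"] by (simp add: hermite_zero)

text \<open>The Gaussian is the ground state, of level \<open>DIM('a)\<close>, so its energy product
  with any weakly differentiable pair is that multiple of the L^2 product. Expanding the square
  gives the last identity.\<close>

lemma energy_sub_gaussian:
  fixes u :: "'a::euclidean_space \<Rightarrow> real"
  assumes "energy_pair u v" "has_weak_gradient u v"
  defines "g \<equiv> gradient (gaussian :: 'a \<Rightarrow> real)"
  shows "energy_pair (\<lambda>x. u x - c * gaussian x) (\<lambda>x. v x - c *\<^sub>R g x)"
    and "has_weak_gradient (\<lambda>x. u x - c * gaussian x) (\<lambda>x. v x - c *\<^sub>R g x)"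
    and "energy (\<lambda>x. u x - c * gaussian x) (\<lambda>x. v x - c *\<^sub>R g x) (\<lambda>x. u x - c * gaussian x) (\<lambda>x. v x - c *\<^sub>R g x)
      = energy u v u v + real DIM('a) * (c\<^sup>2 * (LINT x|lebesgue. (gaussian (x::'a))\<^sup>2) - 2 * c * (LINT x|lebesgue. u x * gaussian x))"
proof -
  have gp: "energy_pair gaussian g" and gw: "has_weak_gradient gaussian g"
    unfolding g_def hermite_zero[symmetric]
    by (rule energy_pair_hermite, rule smooth_alg_has_weak_gradient[OF smooth_alg_hermite])
  have eg: "energy w z gaussian g = real DIM('a) * (LINT x|lebesgue. w x * gaussian x)"
    if "energy_pair w z" "has_weak_gradient w z" for w z
    using energy_hermite[OF energy_pairD(1,2)[OF that(1)] that(2), of "\<lambda>b. 0"]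
    by (simp add: hermite_zero g_def level_def)
  show "energy_pair (\<lambda>x. u x - c * gaussian x) (\<lambda>x. v x - c *\<^sub>R g x)"
    using energy_pair_add_scale[OF assms(1) gp, of "- c"] by simp
  show "has_weak_gradient (\<lambda>x. u x - c * gaussian x) (\<lambda>x. v x - c *\<^sub>R g x)"
    using has_weak_gradient_add_scale[OF assms(2) gw, of "- c"] by simp
  show "energy (\<lambda>x. u x - c * gaussian x) (\<lambda>x. v x - c *\<^sub>R g x) (\<lambda>x. u x - c * gaussian x) (\<lambda>x. v x - c *\<^sub>R g x)
      = energy u v u v + real DIM('a) * (c\<^sup>2 * (LINT x|lebesgue. (gaussian (x::'a))\<^sup>2) - 2 * c * (LINT x|lebesgue. u x * gaussian x))"
    using energy_add_scale_square[OF assms(1) gp, of "- c"] eg[OF assms(1,2)] eg[OF gp gw]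
    by (simp add: power2_eq_square algebra_simps)
qed

text \<open>As a function of c this is, up to a constant, \<open>DIM('a) + 1\<close> times the
  squared L^2 distance, so both have the same minimiser.\<close>

lemma weighted_norm_sq_sub_gaussian:
  fixes u :: "'a::euclidean_space \<Rightarrow> real"
  assumes "energy_pair u v" "has_weak_gradient u v"
  shows "weighted_norm_sq (\<lambda>x. u x - c * gaussian x)
    = energy u v u v + (LINT x|lebesgue. (u x)\<^sup>2)
      + (real DIM('a) + 1) * (c\<^sup>2 * (LINT x|lebesgue. (gaussian (x::'a))\<^sup>2) - 2 * c * (LINT x|lebesgue. u x * gaussian x))"
  unfolding weighted_norm_sq_eq[OF energy_sub_gaussian(2)[OF assms]] energy_sub_gaussian(3)[OF assms]
    L2_square_sub_gaussian[OF energy_pairD(1)[OF assms(1)]] distrib_right mult_1_left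
  by linarith

text \<open>This supplies the lower bound that the infimum in \<open>gaussian_dist_sq\<close>
  requires over the conditionally complete reals.\<close>

lemma weighted_norm_sq_nonneg: "0 \<le> weighted_norm_sq w"
  unfolding weighted_norm_sq_def by (intro add_nonneg_nonneg Bochner_Integration.integral_nonneg) auto

lemma gaussian_dist_sq_le: "gaussian_dist_sq u \<le> weighted_norm_sq (\<lambda>x. u x - c * gaussian x)"
  unfolding gaussian_dist_sq_def
  by (rule cINF_lower[OF bdd_belowI2[OF weighted_norm_sq_nonneg]]) simp

lemma uncertainty_stability:
  fixes u :: "real^'n \<Rightarrow> real"
  assumes "u \<in> admissible"
  shows "2 / (real CARD('n) + 3) * gaussian_dist_sq u \<le> uncertainty_deficit u"
proof -
  obtain v where pair: "energy_pair u v" and weak: "has_weak_gradient u v"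
    using assms by (rule admissibleE)
  define N where "N = real CARD('n)"
  define E where "E = energy u v u v"
  define U where "U = (LINT x|lebesgue. (u x)\<^sup>2)"
  define p where "p = (LINT x|lebesgue. u x * gaussian x)"
  define G where "G = (LINT x|lebesgue. (gaussian (x :: real^'n))\<^sup>2)"
  have G: "G > 0" unfolding G_def by (rule gaussian_norm_pos)
  \<comment> \<open>The L^2 projection coefficient onto the Gaussian; it makes the remainder
    orthogonal, as the spectral gap demands.\<close>
  define c where "c = p / G"
  have c: "c\<^sup>2 * G - 2 * c * p = - (c * p)" "c * G = p"
    using G by (simp_all add: c_def power2_eq_square field_simps)
  note sub = energy_sub_gaussian[OF pair weak, of c]
  have N: "real DIM(real^'n) = N" by (simp add: N_def)
  have gL: "gaussian \<in> (L2_functions :: (real^'n \<Rightarrow> real) set)"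
    using L2_hermite[of "\<lambda>b. 0"] by (simp add: hermite_zero)
  have "(LINT x|lebesgue. (u x - c * gaussian x) * gaussian x) = p - c * G"
    using L2_mult_integrable[OF energy_pairD(1)[OF pair] gL] L2_mult_integrable[OF gL gL]
    by (simp add: left_diff_distrib p_def G_def power2_eq_square mult.assoc)
  then have "(N + 2) * (LINT x|lebesgue. (u x - c * gaussian x)\<^sup>2) \<le> E + N * (c\<^sup>2 * G - 2 * c * p)"
    using oscillator_spectral_gap[OF sub(1,2)]
    unfolding sub(3) c(2) N E_def[symmetric] p_def[symmetric] G_def[symmetric] by simp
  moreover have "(LINT x|lebesgue. (u x - c * gaussian x)\<^sup>2) = U - c * p"
    using c(1) unfolding L2_square_sub_gaussian[OF energy_pairD(1)[OF pair]]
      U_def[symmetric] p_def[symmetric] G_def[symmetric] by linarith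
  ultimately have gap: "(N + 2) * (U - c * p) \<le> E - N * (c * p)"
    unfolding c(1) by simp
  have "gaussian_dist_sq u \<le> E + U + (N + 1) * (- (c * p))"
    using gaussian_dist_sq_le[of u c] c(1)
    unfolding weighted_norm_sq_sub_gaussian[OF pair weak] U_def p_def G_def E_def N by simp
  then have "2 * gaussian_dist_sq u \<le> 2 * (E + U - (N + 1) * (c * p))" by simp
  also have "\<dots> \<le> (N + 3) * (E - N * U)"
  proof -
    \<comment> \<open>The right side of the goal minus the left side is exactly N + 1 times the
      slack in the gap inequality.\<close>
    have "(N + 1) * ((N + 2) * (U - c * p)) \<le> (N + 1) * (E - N * (c * p))"
      using gap by (intro mult_left_mono) (auto simp: N_def)
    then show ?thesis by (simp add: algebra_simps)
  qed
  finally have "2 * gaussian_dist_sq u \<le> (N + 3) * (E - N * U)" .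
  moreover have "N + 3 > 0" by (simp add: N_def)
  ultimately have "2 * gaussian_dist_sq u / (N + 3) \<le> E - N * U"
    by (simp add: pos_divide_le_eq mult.commute)
  then show ?thesis
    unfolding uncertainty_deficit_eq[OF weak] E_def U_def N_def by simp
qed

text \<open>The index has order 1, so u is 2 x_b times the Gaussian, at the first excited level N +
  2. It is orthogonal to the Gaussian, hence c = 0 is optimal and the quotient of deficit and
  distance is 2 / (N + 3).\<close>

lemma extremal_function:
  fixes b :: "real^'n"
  assumes b: "b \<in> Basis"
  defines "u \<equiv> hermite (raise b (\<lambda>b. 0)) :: real^'n \<Rightarrow> real"
  defines "U \<equiv> (LINT x|lebesgue. (u x)\<^sup>2)"
  shows "0 < U" "uncertainty_deficit u = 2 * U" "gaussian_dist_sq u = (real CARD('n) + 3) * U"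
proof -
  let ?\<alpha> = "raise b (\<lambda>b. 0)"
  have \<alpha>: "?\<alpha> \<in> multi_indices" "?\<alpha> \<noteq> (\<lambda>b. 0)" using b by (auto simp: fun_eq_iff)
  have pair: "energy_pair u (gradient u)" and weak: "has_weak_gradient u (gradient u)"
    unfolding u_def by (rule energy_pair_hermite, rule smooth_alg_has_weak_gradient[OF smooth_alg_hermite])
  have lower: "(\<lambda>b. 0)(b := 0) = (\<lambda>b. 0 :: nat)" by auto
  \<comment> \<open>One ladder step down reaches the Gaussian, whose norm is positive.\<close>
  have "U = 2 * (LINT x|lebesgue. (gaussian (x :: real^'n))\<^sup>2)"
    using hermite_inner_ladder[OF b, of ?\<alpha> ?\<alpha>]
    by (simp add: U_def u_def power2_eq_square lower hermite_zero)
  then show U: "0 < U" using gaussian_norm_pos[where 'a = "real^'n"] by simp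
  have "level ?\<alpha> = real CARD('n) + 2"
  proof -
    have "level ?\<alpha> = (\<Sum>i\<in>Basis. (if i = b then 2 else 0) + 1)"
      unfolding level_def by (intro sum.cong) auto
    then show ?thesis using b by (simp add: sum.distrib)
  qed
  then have E: "energy u (gradient u) u (gradient u) = (real CARD('n) + 2) * U"
    using energy_hermite[OF energy_pairD(1,2)[OF pair] weak, of ?\<alpha>]
    by (simp add: u_def U_def power2_eq_square)
  show "uncertainty_deficit u = 2 * U"
    unfolding uncertainty_deficit_eq[OF weak] E U_def[symmetric] by (simp add: algebra_simps)
  have orth: "(LINT x|lebesgue. u x * gaussian x) = 0"
    unfolding u_def hermite_zero[symmetric] by (rule hermite_orthogonal[OF \<alpha>(1) zero_multi_index \<alpha>(2)])
  have w: "weighted_norm_sq (\<lambda>x. u x - c * gaussian x)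
      = (real CARD('n) + 3) * U + (real CARD('n) + 1) * (c\<^sup>2 * (LINT x|lebesgue. (gaussian (x :: real^'n))\<^sup>2))" for c
    unfolding weighted_norm_sq_sub_gaussian[OF pair weak] E orth U_def[symmetric] by (simp add: algebra_simps)
  show "gaussian_dist_sq u = (real CARD('n) + 3) * U"
  proof (rule antisym)
    show "gaussian_dist_sq u \<le> (real CARD('n) + 3) * U"
      using gaussian_dist_sq_le[of u 0] unfolding w by simp
    \<comment> \<open>No term linear in c remains, so every c contributes a nonnegative
      square.\<close>
    show "(real CARD('n) + 3) * U \<le> gaussian_dist_sq u"
      unfolding gaussian_dist_sq_def w
      using gaussian_norm_pos[where 'a = "real^'n"] by (intro cINF_greatest) auto
  qed
qed

theorem theorem1p4:
  "(\<forall>u \<in> (admissible :: (real^'n \<Rightarrow> real) set).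
      uncertainty_deficit u \<ge> 2 / (real CARD('n) + 3) * gaussian_dist_sq u)
   \<and> (\<forall>C::real. C > 2 / (real CARD('n) + 3) \<longrightarrow>
        \<not> (\<forall>u \<in> (admissible :: (real^'n \<Rightarrow> real) set).
             uncertainty_deficit u \<ge> C * gaussian_dist_sq u))
   \<and> (\<exists>u \<in> (admissible :: (real^'n \<Rightarrow> real) set).
        uncertainty_deficit u = 2 / (real CARD('n) + 3) * gaussian_dist_sq u
        \<and> \<not> (uncertainty_deficit u = 0 \<and> 2 / (real CARD('n) + 3) * gaussian_dist_sq u = 0))"
proof (intro conjI allI impI)
  obtain b :: "real^'n" where b: "b \<in> Basis" using nonempty_Basis by blast
  let ?u = "hermite (raise b (\<lambda>b. 0)) :: real^'n \<Rightarrow> real"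
  define U where "U = (LINT x|lebesgue. (?u x)\<^sup>2)"
  note u = extremal_function[OF b, folded U_def]
  have N: "real CARD('n) + 3 > 0" by simp
  show "\<forall>u \<in> (admissible :: (real^'n \<Rightarrow> real) set).
      uncertainty_deficit u \<ge> 2 / (real CARD('n) + 3) * gaussian_dist_sq u"
    using uncertainty_stability by blast
  show "\<not> (\<forall>u \<in> (admissible :: (real^'n \<Rightarrow> real) set). uncertainty_deficit u \<ge> C * gaussian_dist_sq u)"
    if C: "C > 2 / (real CARD('n) + 3)" for C
  proof
    assume "\<forall>u \<in> (admissible :: (real^'n \<Rightarrow> real) set). uncertainty_deficit u \<ge> C * gaussian_dist_sq u"
    \<comment> \<open>The extremal function also refutes every larger constant, since U is
      positive.\<close>
    then have "C * ((real CARD('n) + 3) * U) \<le> 2 * U"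
      using hermite_admissible u(2,3) by metis
    moreover have "2 * U < C * (real CARD('n) + 3) * U"
      using C N u(1) by (intro mult_strict_right_mono) (simp_all add: pos_divide_less_eq)
    ultimately show False by (simp add: mult.assoc)
  qed
  show "\<exists>u \<in> (admissible :: (real^'n \<Rightarrow> real) set).
        uncertainty_deficit u = 2 / (real CARD('n) + 3) * gaussian_dist_sq u
        \<and> \<not> (uncertainty_deficit u = 0 \<and> 2 / (real CARD('n) + 3) * gaussian_dist_sq u = 0)"
    using hermite_admissible u N by (intro bexI[of _ ?u]) auto
qed

end
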